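(* Let $n\geq 3$ and let $\Lambda\subset\mathbb{C}$ be an $n$-cyclotomic Delone set. (a) There exist sets $U$ of four pairwise nonparallel $\Lambda$-directions such that the convex subsets of $\Lambda$ are determined by the X-rays in the directions of $U$. In addition, fewer than four pairwise nonparallel $\Lambda$-directions never suffice for this purpose, i.e., for no set $U$ of fewer than four pairwise nonparallel $\Lambda$-directions are the convex subsets of $\Lambda$ determined by the X-rays in the directions of $U$. (b) There is a natural number $c_n$ that only depends on $n$ (and not on $\Lambda$) such that, for every set $U$ of $c_n$ pairwise nonparallel $\Lambda$-directions, the convex subsets of $\Lambda$ are determined by the X-rays in the directions of $U$. In particular, one can choose $c_3=c_4=7$, $c_5=11$, $c_8=9$ and $c_{12}=13$.
   Context: The Euclidean plane is identified with $\mathbb{C}$; natural numbers are positive; $\zeta_n:=e^{2\pi i/n}$. For $r>0$, $B_r(z)$ is the open ball of radius $r$ about $z\in\mathbb{C}$. A set $\Lambda\subset\mathbb{C}$ is uniformly discrete if there is $r>0$ such that every $B_r(z)$, $z\in\mathbb{C}$, contains at most one point of $\Lambda$; it is relatively dense if there is $R>0$ such that every $B_R(z)$, $z\in\mathbb{C}$, contains at least one point of $\Lambda$; it is a Delone set if it is both. Let $\Lambda-\Lambda=\{v-w : v,w\in\Lambda\}$ and let $K_\Lambda:=\mathbb{Q}\big((\Lambda-\Lambda)\cup\overline{(\Lambda-\Lambda)}\big)\subset\mathbb{C}$, the field generated over $\mathbb{Q}$ by all differences of points of $\Lambda$ and their complex conjugates. A homothety of the complex plane is a map $z\mapsto\lambda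 z+t$ with $\lambda\in\mathbb{R}$, $\lambda>0$, $t\in\mathbb{C}$. For $n\ge 3$, a Delone set $\Lambda\subset\mathbb{C}$ is an $n$-cyclotomic Delone set if: ($n$-Cyc) $K_\Lambda\subset\mathbb{Q}(\zeta_n)$; and (Hom) for any finite subset $F$ of $K_\Lambda$ there is a homothety $h$ of the complex plane with $h(F)\subset\Lambda$. Elements of the unit circle $\mathbb{S}^1\subset\mathbb{C}$ are called directions. A direction is a $\Lambda$-direction if it is parallel to a nonzero element of $\Lambda-\Lambda$. A convex subset of $\Lambda$ is a bounded subset $C\subset\Lambda$ with $C=\operatorname{conv}(C)\cap\Lambda$ (such a set is finite). For a finite set $F\subset\mathbb{C}$ and a direction $u$, the (discrete parallel) X-ray $X_uF$ is the function on the set of lines $\ell$ in $\mathbb{C}$ in direction $u$ given by $X_uF(\ell)=\operatorname{card}(F\cap\ell)$. For a finite set $U$ of directions, the elements of a collection $\mathcal{F}$ of finite subsets of $\mathbb{C}$ are determined by the X-rays in the directions of $U$ if for all $F,F'\in\mathcal{F}$: $X_uF=X_uF'$ for all $u\in U$ implies $F=F'$. *)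

theory Defs
  imports
    "HOL-Analysis.Analysis"
    "HOL-Algebra.Generated_Fields"
    "HOL-Algebra.Algebraic_Closure_Type"
begin

definition relatively_dense :: "complex set \<Rightarrow> bool" where
  "relatively_dense \<Lambda> \<longleftrightarrow> (\<exists>R>0. \<forall>z. ball z R \<inter> \<Lambda> \<noteq> {})"

text \<open>\<^const>\<open>uniform_discrete\<close> asks for a positive lower bound on the distances of distinct points,
  which is the same as balls of some fixed radius containing at most one point each.\<close>

definition delone_set :: "complex set \<Rightarrow> bool" where
  "delone_set \<Lambda> \<longleftrightarrow> uniform_discrete \<Lambda> \<and> relatively_dense \<Lambda>"

definition difference_set :: "complex set \<Rightarrow> complex set" where
  "difference_set \<Lambda> = {v - w | v w. v \<in> \<Lambda> \<and> w \<in> \<Lambda>}"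

text \<open>\<^const>\<open>ring_of_type_algebra\<close> presents the type \<^typ>\<open>complex\<close> as a ring with carrier,
  so the following is the subfield of the complex numbers generated by \<open>S\<close> over the rationals.\<close>

definition rat_adjoin :: "complex set \<Rightarrow> complex set" where
  "rat_adjoin S = generate_field (ring_of_type_algebra :: complex ring) (\<rat> \<union> S)"

definition K_field :: "complex set \<Rightarrow> complex set" where
  "K_field \<Lambda> = rat_adjoin (difference_set \<Lambda> \<union> cnj ` difference_set \<Lambda>)"

definition zeta :: "nat \<Rightarrow> complex" where
  "zeta n = exp (2 * of_real pi * \<i> / of_nat n)"

definition homothety :: "(complex \<Rightarrow> complex) \<Rightarrow> bool" where
  "homothety h \<longleftrightarrow> (\<exists>(c::real) t. c > 0 \<and> h = (\<lambda>z. of_real c * z + t))"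

definition cyclotomic_delone_set :: "nat \<Rightarrow> complex set \<Rightarrow> bool" where
  "cyclotomic_delone_set n \<Lambda> \<longleftrightarrow>
     delone_set \<Lambda> \<and>
     K_field \<Lambda> \<subseteq> rat_adjoin {zeta n} \<and>
     (\<forall>F. finite F \<and> F \<subseteq> K_field \<Lambda> \<longrightarrow> (\<exists>h. homothety h \<and> h ` F \<subseteq> \<Lambda>))"

text \<open>Used for nonzero vectors only.\<close>

definition parallel :: "complex \<Rightarrow> complex \<Rightarrow> bool" where
  "parallel u w \<longleftrightarrow> (\<exists>c::real. c \<noteq> 0 \<and> w = of_real c * u)"

definition is_direction_of :: "complex set \<Rightarrow> complex \<Rightarrow> bool" where
  "is_direction_of \<Lambda> u \<longleftrightarrow>
     norm u = 1 \<and> (\<exists>w \<in> difference_set \<Lambda>. w \<noteq> 0 \<and> parallel u w)"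

definition nonparallel_directions :: "complex set \<Rightarrow> complex set \<Rightarrow> bool" where
  "nonparallel_directions \<Lambda> U \<longleftrightarrow>
     (\<forall>u\<in>U. is_direction_of \<Lambda> u) \<and> pairwise (\<lambda>u v. \<not> parallel u v) U"

definition convex_subsets :: "complex set \<Rightarrow> complex set set" where
  "convex_subsets \<Lambda> = {C. C \<subseteq> \<Lambda> \<and> bounded C \<and> C = convex hull C \<inter> \<Lambda>}"

definition lines_in_direction :: "complex \<Rightarrow> complex set set" where
  "lines_in_direction u = range (\<lambda>z. {z + of_real t * u | t::real. True})"

text \<open>An X-ray is a function on the lines in direction \<open>u\<close> only; the restriction makes equality
  of X-rays as functions mean agreement on these lines.\<close>

definition xray :: "complex \<Rightarrow> complex set \<Rightarrow> complex set \<Rightarrow> nat" where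
  "xray u F = restrict (\<lambda>l. card (F \<inter> l)) (lines_in_direction u)"

definition determined_by_xrays :: "complex set set \<Rightarrow> complex set \<Rightarrow> bool" where
  "determined_by_xrays \<F> U \<longleftrightarrow>
     (\<forall>F\<in>\<F>. \<forall>F'\<in>\<F>. (\<forall>u\<in>U. xray u F = xray u F') \<longrightarrow> F = F')"

end

theory Submission
  imports Defs "HOL-Number_Theory.Cong"
begin

text \<open>Let two convex subsets have the same X-rays in the directions \<open>u \<in> U\<close>. Seen from their common
  centroid, the points of the symmetric difference form \<open>N\<close> runs of alternating colour, and
  convexity forces every \<open>u\<close> to act on these runs as a reflection of the cyclic order, because the
  points on a line in direction \<open>u\<close> match up in pairs of opposite colour. Give the points of
  the \<open>j\<close>-th run the weight \<open>\<zeta>\<^sub>N\<^sup>j\<close>. The weighted sum of the coordinates transversal to \<open>u\<close> is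
  then a nonzero vector depending linearly on \<open>u\<close> whose argument is determined by a root of unity
  \<open>x u\<close>. So a linear map of the plane turns the slopes of \<open>U\<close> into distinct roots of unity, and
  cross ratios of slopes, which lie in the field of \<open>\<Lambda>\<close>, become cross ratios of roots of unity.

  Conjugating a relation between four roots of unity with cross ratio in the \<open>n\<close>-th cyclotomic
  field (\<open>n\<close> even) by automorphisms that fix this field, one finds that more than six roots of unity
  with all cross ratios in it are, up to a common factor, \<open>n\<close>-th roots of unity. This
  yields the constants \<open>c\<^sub>n\<close>. The cross ratio 5 does not occur at all, since the conjugates of the
  numerator have modulus at most 4 while the norm of the denominator is at least 1; this yields
  four determining directions. For three directions the alternating vertices of an affinely
  regular hexagon give a counterexample.\<close>

section \<open>Galois conjugation of roots of unity\<close>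

text \<open>The angular order around the centroid and the order by the transversal coordinate
  disagree on points of equal colour, and a line may carry several points, so no order can be
  transported pointwise. On points of opposite colour the two are compatible, up to a change of the
  starting point, since a misplaced point would fall into a convex hull that omits it. Hence the
  argument runs through the numbers of the runs, which depend on comparisons of opposite colours
  only.

  The number six is three times two. If the roots of unity need a larger order, some prime p has to
  be added to it, and conjugation multiplies each root by powers of a primitive p-th root of unity
  according to its exponent modulo p. A residue class holds at most two of the roots, and four roots
  in four different classes are impossible, so at most three classes occur.

  Automorphisms are realised without field theory: a relation between roots of unity is the
  vanishing of an integer polynomial at a root of unity z of order dividing N, and it carries over
  to \<open>z ^ t\<close> for t coprime to N.\<close>

hide_const (open) Divisibility.prime

text \<open>The functions given by polynomials with integer coefficients. In this form the conjugate
  of \<open>f z\<close> is simply \<open>f (z ^ t)\<close>, and statements about the ring generated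
  by z become rule inductions.\<close>

inductive int_poly_fun :: "(complex \<Rightarrow> complex) \<Rightarrow> bool" where
  one: "int_poly_fun (\<lambda>z. 1)"
| ident: "int_poly_fun (\<lambda>z. z)"
| uminus: "int_poly_fun f \<Longrightarrow> int_poly_fun (\<lambda>z. - f z)"
| add: "int_poly_fun f \<Longrightarrow> int_poly_fun g \<Longrightarrow> int_poly_fun (\<lambda>z. f z + g z)"
| mult: "int_poly_fun f \<Longrightarrow> int_poly_fun g \<Longrightarrow> int_poly_fun (\<lambda>z. f z * g z)"

named_theorems int_poly_intros

lemmas [int_poly_intros] = int_poly_fun.intros

lemma int_poly_fun_diff [int_poly_intros]:
  "int_poly_fun f \<Longrightarrow> int_poly_fun g \<Longrightarrow> int_poly_fun (\<lambda>z. f z - g z)"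
  using int_poly_fun.add[OF _ int_poly_fun.uminus, of f g] by simp

lemma int_poly_fun_zero [int_poly_intros]: "int_poly_fun (\<lambda>z. 0)"
  using int_poly_fun_diff[OF int_poly_fun.one int_poly_fun.one] by simp

lemma int_poly_fun_of_nat [int_poly_intros]: "int_poly_fun (\<lambda>z. of_nat n)"
  by (induction n) (auto intro: int_poly_intros)

lemma int_poly_fun_of_int [int_poly_intros]: "int_poly_fun (\<lambda>z. of_int k)"
  by (cases k rule: int_cases2) (auto intro: int_poly_intros)

lemma int_poly_fun_numeral [int_poly_intros]: "int_poly_fun (\<lambda>z. numeral k)"
  using int_poly_fun_of_nat[of "numeral k"] by simp

lemma int_poly_fun_power [int_poly_intros]: "int_poly_fun f \<Longrightarrow> int_poly_fun (\<lambda>z. f z ^ n)"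
  by (induction n) (auto intro: int_poly_intros)

lemma int_poly_fun_sum [int_poly_intros]:
  "(\<And>i. i \<in> I \<Longrightarrow> int_poly_fun (f i)) \<Longrightarrow> int_poly_fun (\<lambda>z. \<Sum>i\<in>I. f i z)"
  by (induction I rule: infinite_finite_induct) (auto intro: int_poly_intros)

lemma int_poly_fun_comp:
  assumes "int_poly_fun f" "int_poly_fun g" shows "int_poly_fun (\<lambda>z. f (g z))"
  using assms(1) by induction (auto intro: int_poly_intros assms(2))

text \<open>The inner binomial coefficients are divisible by p. The quotient is kept explicit
  because it has to be an integer polynomial in a and b again.\<close>

lemma power_prime_add:
  fixes a b :: complex
  assumes "prime p"
  shows "(a + b) ^ p = a ^ p + b ^ p + of_nat p * (\<Sum>k\<in>{1..<p}. of_nat ((p choose k) div p) * a ^ k * b ^ (p - k))"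
proof -
  have p: "p > 1" using assms prime_gt_1_nat by blast
  have split: "{..p} = insert 0 (insert p {1..<p})" using p by auto
  have "(a + b) ^ p = (\<Sum>k\<le>p. of_nat (p choose k) * a ^ k * b ^ (p - k))"
    by (simp add: binomial_ring)
  also have "\<dots> = a ^ p + b ^ p + (\<Sum>k\<in>{1..<p}. of_nat (p choose k) * a ^ k * b ^ (p - k))"
    using p by (simp add: split)
  also have "(\<Sum>k\<in>{1..<p}. of_nat (p choose k) * a ^ k * b ^ (p - k))
     = of_nat p * (\<Sum>k\<in>{1..<p}. of_nat ((p choose k) div p) * a ^ k * b ^ (p - k))"
    unfolding sum_distrib_left
  proof (rule sum.cong[OF refl])
    fix k assume k: "k \<in> {1..<p}"
    then have "p dvd (p choose k)" by (intro dvd_choose_prime) (use assms in auto)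
    then have "p choose k = p * ((p choose k) div p)" by simp
    then have "(of_nat (p choose k)::complex) = of_nat p * of_nat ((p choose k) div p)"
      by (metis of_nat_mult)
    then show "of_nat (p choose k) * a ^ k * b ^ (p - k) =
         of_nat p * (of_nat ((p choose k) div p) * a ^ k * b ^ (p - k))" by simp
  qed
  finally show ?thesis .
qed

text \<open>Modulo p the p-th power respects sums by \<open>power_prime_add\<close>, and products in
  any case; negation uses that p is odd. So taking p-th powers acts like the substitution of
  \<open>z ^ p\<close>.\<close>

lemma int_poly_fun_power_prime:
  assumes f: "int_poly_fun f" and p: "prime p" "odd p"
  shows "\<exists>g. int_poly_fun g \<and> (\<forall>z. f (z ^ p) = f z ^ p + of_nat p * g z)"
  using f
proof induction
  case one
  show ?case by (rule exI[of _ "\<lambda>z. 0"]) (simp add: int_poly_intros)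
next
  case ident
  show ?case by (rule exI[of _ "\<lambda>z. 0"]) (simp add: int_poly_intros)
next
  case (uminus f)
  then obtain g where g: "int_poly_fun g" "\<forall>z. f (z ^ p) = f z ^ p + of_nat p * g z" by blast
  show ?case
    by (rule exI[of _ "\<lambda>z. - g z"]) (use g p in \<open>auto intro: int_poly_intros\<close>)
next
  case (add f1 f2)
  then obtain g1 g2 where g: "int_poly_fun g1" "\<forall>z. f1 (z ^ p) = f1 z ^ p + of_nat p * g1 z"
    "int_poly_fun g2" "\<forall>z. f2 (z ^ p) = f2 z ^ p + of_nat p * g2 z" by blast
  define h where "h = (\<lambda>z. \<Sum>k\<in>{1..<p}. of_nat ((p choose k) div p) * f1 z ^ k * f2 z ^ (p - k))"
  have h: "int_poly_fun h" unfolding h_def by (intro int_poly_intros add.hyps)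
  have "f1 (z ^ p) + f2 (z ^ p) = (f1 z + f2 z) ^ p + of_nat p * (g1 z + g2 z - h z)" for z
    using g power_prime_add[OF p(1), of "f1 z" "f2 z"] unfolding h_def by (simp add: algebra_simps)
  then show ?case
    by (intro exI[of _ "\<lambda>z. g1 z + g2 z - h z"]) (use g h in \<open>auto intro!: int_poly_intros\<close>)
next
  case (mult f1 f2)
  then obtain g1 g2 where g: "int_poly_fun g1" "\<forall>z. f1 (z ^ p) = f1 z ^ p + of_nat p * g1 z"
    "int_poly_fun g2" "\<forall>z. f2 (z ^ p) = f2 z ^ p + of_nat p * g2 z" by blast
  have "f1 (z ^ p) * f2 (z ^ p) = (f1 z * f2 z) ^ p +
      of_nat p * (f1 z ^ p * g2 z + g1 z * f2 z ^ p + of_nat p * (g1 z * g2 z))" for z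
    using g by (simp add: algebra_simps power_mult_distrib)
  then show ?case
    by (intro exI[of _ "\<lambda>z. f1 z ^ p * g2 z + g1 z * f2 z ^ p + of_nat p * (g1 z * g2 z)"])
      (use g mult.hyps in \<open>auto intro!: int_poly_intros\<close>)
qed

text \<open>The coordinate of b in a basis of the complex numbers over the rationals that contains
  b. It takes the place of a norm in bounding the divisors of b.\<close>

lemma exists_rational_functional:
  fixes b :: complex
  assumes "b \<noteq> 0"
  shows "\<exists>l :: complex \<Rightarrow> rat. (\<forall>x y. l (x + y) = l x + l y) \<and> l b = 1"
proof -
  interpret vector_space "\<lambda>(q::rat) (z::complex). of_rat q * z"
    by unfold_locales (simp_all add: algebra_simps of_rat_add of_rat_mult)
  have ind: "independent {b}" using assms by (simp add: dependent_single)
  let ?B = "extend_basis {b}"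
  have B: "independent ?B" "span ?B = UNIV" "{b} \<subseteq> ?B"
    using independent_extend_basis[OF ind] span_extend_basis[OF ind] extend_basis_superset[OF ind] by auto
  have "representation ?B (x + y) b = representation ?B x b + representation ?B y b" for x y
    using representation_add[OF B(1)] B(2) by simp
  moreover have "representation ?B b b = 1" using representation_basis[OF B(1)] B(3) by simp
  ultimately show ?thesis by (intro exI[of _ "\<lambda>x. representation ?B x b"]) simp
qed

text \<open>The y satisfying the hypothesis form a module over the ring generated by z. Therefore y
  stays arbitrary in the induction: in the product case the inner factor is absorbed into
  it.\<close>

lemma int_poly_fun_additive_Ints:
  fixes l :: "complex \<Rightarrow> rat"
  assumes f: "int_poly_fun f" and l: "\<And>x y. l (x + y) = l x + l y"
    and y: "\<And>i::nat. M * l (z ^ i * y) \<in> \<int>"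
  shows "M * l (z ^ i * (f z * y)) \<in> \<int>"
proof -
  have l0: "l 0 = 0" using l[of 0 0] by simp
  have lm: "l (- x) = - l x" for x using l[of x "-x"] l0 by simp
  show ?thesis using f y
  proof (induction arbitrary: i y)
    case ident
    show ?case using ident[of "Suc i"] by (simp add: mult.assoc mult.left_commute)
  next
    case (add f g)
    have "M * l (z ^ i * (f z * y)) + M * l (z ^ i * (g z * y)) \<in> \<int>"
      using add by (intro Ints_add) auto
    then show ?case by (simp add: algebra_simps l)
  next
    case (mult f g)
    have "\<And>i. M * l (z ^ i * (g z * y)) \<in> \<int>" using mult by blast
    then have "M * l (z ^ i * (f z * (g z * y))) \<in> \<int>" using mult.IH(1) by blast
    then show ?case by (simp add: mult.assoc)
  qed (auto simp: lm)
qed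

lemma root_of_unity_power_mod:
  fixes z :: "'a :: monoid_mult"
  assumes "z ^ N = 1" shows "z ^ (i mod N) = z ^ i"
  by (metis assms mod_mult_div_eq mult.right_neutral power_add power_mult power_one)

text \<open>The functional l maps the ring generated by z into the fractions with denominator M. If
  b is p times an element of that ring, then \<open>l b = 1\<close> makes p a divisor of M, so M
  itself is the bound.\<close>

lemma finitely_many_prime_divisors:
  fixes z b :: complex
  assumes z: "z ^ N = 1" "N > 0" and b: "b \<noteq> 0"
  shows "\<exists>A. \<forall>p>A. \<forall>g. int_poly_fun g \<longrightarrow> b \<noteq> of_nat p * g z"
proof -
  obtain l :: "complex \<Rightarrow> rat" where l: "\<And>x y. l (x + y) = l x + l y" "l b = 1"
    using exists_rational_functional[OF b] by blast
  define M :: nat where "M = (\<Prod>i<N. nat (snd (quotient_of (l (z ^ i)))))"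
  have den: "snd (quotient_of q) > 0" for q using quotient_of_denom_pos' by blast
  have M: "M > 0" unfolding M_def using den by (intro prod_pos) auto
  have Mi: "of_nat M * l (z ^ i) \<in> \<int>" if "i < N" for i
  proof -
    have "nat (snd (quotient_of (l (z ^ i)))) dvd M" unfolding M_def
      using that by (intro dvd_prodI) auto
    then obtain k where k: "M = nat (snd (quotient_of (l (z ^ i)))) * k" by (elim dvdE)
    have "l (z ^ i) = of_int (fst (quotient_of (l (z ^ i)))) / of_int (snd (quotient_of (l (z ^ i))))"
      by (metis quotient_of_div prod.collapse)
    then have "of_int (snd (quotient_of (l (z ^ i)))) * l (z ^ i) = of_int (fst (quotient_of (l (z ^ i))))"
      using den[of "l (z ^ i)"] by (simp add: field_simps)
    moreover have "(of_nat M :: rat) = of_int (snd (quotient_of (l (z ^ i)))) * of_nat k"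
      using den[of "l (z ^ i)"] by (simp add: k)
    ultimately have "of_nat M * l (z ^ i) = of_int (fst (quotient_of (l (z ^ i))) * int k)"
      by (simp add: mult.assoc mult.left_commute)
    then show ?thesis by simp
  qed
  have M1: "of_nat M * l (z ^ i * 1) \<in> \<int>" for i
    using Mi[of "i mod N"] z root_of_unity_power_mod[OF z(1), of i] by simp
  have lsum: "l (of_nat n * x) = of_nat n * l x" for n x
  proof (induction n)
    case 0 then show ?case using l(1)[of 0 0] by simp
  qed (simp add: l algebra_simps)
  show ?thesis
  proof (intro exI[of _ M] allI impI notI)
    fix p g assume p: "M < p" and g: "int_poly_fun g" and eq: "b = of_nat p * g z"
    have "of_nat M * l (z ^ 0 * (g z * 1)) \<in> \<int>"
      by (rule int_poly_fun_additive_Ints[OF g l(1) M1])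
    then obtain k where k: "of_nat M * l (g z) = of_int k" by (auto elim: Ints_cases)
    have "(of_nat M :: rat) = of_nat M * l b" by (simp add: l)
    also have "\<dots> = of_nat p * of_int k" unfolding eq lsum using k by (simp add: mult.left_commute)
    finally have "of_int (int M) = (of_int (int p * k) :: rat)" by simp
    then have "int M = int p * k" using of_int_eq_iff by blast
    then have "int p dvd int M" by simp
    then show False using M p by (auto dest: zdvd_imp_le)
  qed
qed

text \<open>With k the product of the primes up to A that do not divide t, every prime up to A
  divides exactly one of t and \<open>N * k\<close>, because a prime factor of t does not divide N.
  This avoids having to find a prime in the residue class of t.\<close>

lemma coprime_add_mult_large_factors:
  fixes t N A :: nat
  assumes "coprime t N"
  shows "\<exists>k. \<forall>q. prime q \<longrightarrow> q dvd t + N * k \<longrightarrow> q > A"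
proof -
  let ?k = "\<Prod>{q. prime q \<and> q \<le> A \<and> \<not> q dvd t}"
  have fin: "finite {q. prime q \<and> q \<le> A \<and> \<not> q dvd t}" by (rule finite_subset[of _ "{..A}"]) auto
  have "q > A" if q: "prime q" "q dvd t + N * ?k" for q
  proof (rule ccontr)
    assume "\<not> A < q"
    then have qA: "q \<le> A" by simp
    show False
    proof (cases "q dvd t")
      case True
      then have "q dvd N * ?k" using q(2) by (simp add: dvd_add_right_iff)
      then consider "q dvd N" | "q dvd ?k" using q(1) prime_dvd_mult_iff by blast
      then show False
      proof cases
        case 1 then show False using True assms q(1) by (meson coprime_common_divisor not_prime_unit)
      next
        case 2
        then obtain r where r: "prime r" "q dvd r" "\<not> r dvd t"
          using q(1) fin by (auto simp: prime_dvd_prod_iff)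
        then show False using True q(1) primes_dvd_imp_eq by blast
      qed
    next
      case False
      then have "q dvd ?k" using q(1) qA fin by (auto intro: dvd_prodI)
      then have "q dvd N * ?k" by simp
      then show False using False q(2) by (metis dvd_add_left_iff)
    qed
  qed
  then show ?thesis by blast
qed

text \<open>If \<open>f (z ^ k) = 0\<close>, then \<open>f (z ^ (k * p))\<close> is p times an
  element of the ring generated by z, hence 0 once the prime p exceeds the bounds for all nonzero
  values \<open>f (z ^ j)\<close>. Since t may be replaced by a number congruent to it modulo N with
  large prime factors only, it is reached prime by prime.\<close>

theorem int_poly_fun_galois:
  assumes f: "int_poly_fun f" and z: "z ^ N = 1" "N > 0" and fz: "f z = 0" and t: "coprime t N"
  shows "f (z ^ t) = 0"
proof -
  have "\<exists>A. \<forall>j<N. f (z ^ j) \<noteq> 0 \<longrightarrow> (\<forall>p>A. \<forall>g. int_poly_fun g \<longrightarrow> f (z ^ j) \<noteq> of_nat p * g z)"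
  proof -
    have "\<forall>j. \<exists>A. f (z ^ j) \<noteq> 0 \<longrightarrow> (\<forall>p>A. \<forall>g. int_poly_fun g \<longrightarrow> f (z ^ j) \<noteq> of_nat p * g z)"
      using finitely_many_prime_divisors[OF z] by blast
    then obtain A where A: "\<And>j p g. f (z ^ j) \<noteq> 0 \<Longrightarrow> p > A j \<Longrightarrow> int_poly_fun g \<Longrightarrow> f (z ^ j) \<noteq> of_nat p * g z"
      by metis
    have le: "A j \<le> (\<Sum>j<N. A j)" if "j < N" for j
      using that by (intro member_le_sum) auto
    show ?thesis
    proof (intro exI[of _ "\<Sum>j<N. A j"] allI impI)
      fix j p g assume "j < N" "f (z ^ j) \<noteq> 0" "(\<Sum>j<N. A j) < p" "int_poly_fun g"
      then show "f (z ^ j) \<noteq> of_nat p * g z" using A[of j p g] le[of j] by linarith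
    qed
  qed
  then obtain A where A: "\<And>j p g. j < N \<Longrightarrow> f (z ^ j) \<noteq> 0 \<Longrightarrow> p > A \<Longrightarrow> int_poly_fun g
      \<Longrightarrow> f (z ^ j) \<noteq> of_nat p * g z" by blast
  have step: "f (z ^ (k * p)) = 0" if k: "f (z ^ k) = 0" and p: "prime p" "p > max A 2" for k p
  proof (rule ccontr)
    assume nz: "f (z ^ (k * p)) \<noteq> 0"
    have "odd p" using p by (metis primes_dvd_imp_eq two_is_prime_nat max.strict_boundedE order_less_irrefl)
    then obtain g where g: "int_poly_fun g" "\<And>z. f (z ^ p) = f z ^ p + of_nat p * g z"
      using int_poly_fun_power_prime[OF f p(1)] by metis
    have "f (z ^ (k * p)) = of_nat p * g (z ^ k)"
      using g(2)[of "z ^ k"] k p by (simp add: power_mult)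
    moreover have "int_poly_fun (\<lambda>z. g (z ^ k))"
      by (intro int_poly_fun_comp[OF g(1)] int_poly_intros)
    ultimately show False
      using A[of "k * p mod N" p "\<lambda>z. g (z ^ k)"] nz p z root_of_unity_power_mod[OF z(1)] by simp
  qed
  obtain k where k: "\<And>q. prime q \<Longrightarrow> q dvd t + N * k \<Longrightarrow> q > max A 2"
    using coprime_add_mult_large_factors[OF t] by metis
  have "f (z ^ (j * s)) = 0" if "f (z ^ j) = 0" "s > 0" "\<And>q. prime q \<Longrightarrow> q dvd s \<Longrightarrow> q > max A 2" for s j
    using that
  proof (induction s arbitrary: j rule: less_induct)
    case (less s)
    show ?case
    proof (cases "s = 1")
      case True then show ?thesis using less by simp
    next
      case False
      then obtain q where q: "prime q" "q dvd s" using prime_factor_nat by blast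
      then obtain r where r: "s = q * r" by (elim dvdE)
      have "f (z ^ (j * q)) = 0" using step less q by blast
      moreover have "r < s" "r > 0" using r less.prems(2) prime_gt_1_nat[OF q(1)] by auto
      ultimately have "f (z ^ (j * q * r)) = 0" using less r by (metis dvd_mult)
      then show ?thesis using r by (simp add: mult.assoc)
    qed
  qed
  \<comment> \<open>Every prime divides 0, so the bound \<open>max A 2\<close> rules out 0. The 2 in
    it also makes all primes in the chain odd.\<close>
  moreover have "t + N * k > 0"
  proof (rule ccontr)
    assume "\<not> ?thesis"
    then have "2 dvd t + N * k" by (metis dvd_0_right not_gr_zero)
    then show False using k[OF two_is_prime_nat] by simp
  qed
  ultimately have "f (z ^ (1 * (t + N * k))) = 0" using fz k by (metis power_one_right)
  then show ?thesis using z by (simp add: power_add power_mult)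
qed

section \<open>Traces of cyclotomic integers\<close>

lemma sum_powers_root_of_unity:
  fixes z :: complex
  assumes "z ^ N = 1"
  shows "(\<Sum>t<N. z ^ t) = (if z = 1 then of_nat N else 0)"
  using assms geometric_sum[of z N] by auto

text \<open>Removing the multiples of one more prime p subtracts a sum of the same kind for
  \<open>z ^ p\<close> and the quotient of N by p, so z and N vary in the induction. Without primes
  it is a geometric sum.\<close>

lemma sifted_power_sum_Ints:
  fixes z :: complex
  assumes "finite P" "\<And>p. p \<in> P \<Longrightarrow> prime p \<and> p dvd N" "z ^ N = 1" "N > 0"
  shows "(\<Sum>t | t < N \<and> (\<forall>p\<in>P. \<not> p dvd t). z ^ t) \<in> \<int>"
  using assms
proof (induction P arbitrary: N z rule: finite_induct)
  case empty
  have "{t. t < N \<and> (\<forall>p\<in>{}. \<not> p dvd t)} = {..<N}" by auto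
  then show ?case using sum_powers_root_of_unity[OF empty(2)] by simp
next
  case (insert p P)
  have p: "prime p" "p dvd N" using insert.prems by auto
  then obtain M where M: "N = p * M" by (elim dvdE)
  have pP: "\<not> q dvd p" if "q \<in> P" for q
    using that insert.prems(1) insert.hyps(2) p primes_dvd_imp_eq by blast
  have dvdP: "q dvd p * t \<longleftrightarrow> q dvd t" if "q \<in> P" for q t
    using that pP[OF that] insert.prems(1) by (metis insertI2 prime_dvd_mult_iff)
  have pP': "prime q" "q dvd M" if "q \<in> P" for q
    using that insert.prems(1) dvdP[of q M] M by auto
  let ?S = "{t. t < N \<and> (\<forall>q\<in>P. \<not> q dvd t)}"
  have p0: "p > 0" using p by (simp add: prime_gt_0_nat)
  have im: "?S - {t. t < N \<and> (\<forall>q\<in>insert p P. \<not> q dvd t)} = (\<lambda>t. p * t) ` {t. t < M \<and> (\<forall>q\<in>P. \<not> q dvd t)}"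
  proof (intro equalityI subsetI)
    fix t assume t: "t \<in> ?S - {t. t < N \<and> (\<forall>q\<in>insert p P. \<not> q dvd t)}"
    then obtain s where s: "t = p * s" by (auto elim: dvdE)
    then show "t \<in> (\<lambda>t. p * t) ` {t. t < M \<and> (\<forall>q\<in>P. \<not> q dvd t)}"
      using t dvdP[of _ s] p0 unfolding M by auto
  next
    fix t assume "t \<in> (\<lambda>t. p * t) ` {t. t < M \<and> (\<forall>q\<in>P. \<not> q dvd t)}"
    then obtain s where "t = p * s" "s < M" "\<forall>q\<in>P. \<not> q dvd s" by auto
    then show "t \<in> ?S - {t. t < N \<and> (\<forall>q\<in>insert p P. \<not> q dvd t)}"
      using dvdP[of _ s] p0 unfolding M by simp
  qed
  have "(\<Sum>t\<in>?S. z ^ t) = (\<Sum>t | t < N \<and> (\<forall>q\<in>insert p P. \<not> q dvd t). z ^ t)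
     + (\<Sum>t\<in>?S - {t. t < N \<and> (\<forall>q\<in>insert p P. \<not> q dvd t)}. z ^ t)"
    by (subst sum.subset_diff[of "{t. t < N \<and> (\<forall>q\<in>insert p P. \<not> q dvd t)}" ?S]) (auto simp: add.commute)
  also have "(\<Sum>t\<in>?S - {t. t < N \<and> (\<forall>q\<in>insert p P. \<not> q dvd t)}. z ^ t)
     = (\<Sum>t | t < M \<and> (\<forall>q\<in>P. \<not> q dvd t). (z ^ p) ^ t)"
    unfolding im using p0 by (subst sum.reindex) (auto simp: inj_on_def power_mult)
  finally have "(\<Sum>t | t < N \<and> (\<forall>q\<in>insert p P. \<not> q dvd t). z ^ t) =
     (\<Sum>t\<in>?S. z ^ t) - (\<Sum>t | t < M \<and> (\<forall>q\<in>P. \<not> q dvd t). (z ^ p) ^ t)" by simp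
  moreover have "(\<Sum>t\<in>?S. z ^ t) \<in> \<int>" using insert.prems by (intro insert.IH) auto
  moreover have "(\<Sum>t | t < M \<and> (\<forall>q\<in>P. \<not> q dvd t). (z ^ p) ^ t) \<in> \<int>"
    using insert.prems pP' M by (intro insert.IH) (auto simp: power_mult)
  ultimately show ?case by simp
qed

abbreviation unit_residues :: "nat \<Rightarrow> nat set" where
  "unit_residues N \<equiv> {t. t < N \<and> coprime t N}"

lemma coprime_iff_no_prime_factor:
  fixes t N :: nat
  assumes "N > 0"
  shows "coprime t N \<longleftrightarrow> (\<forall>p\<in>prime_factors N. \<not> p dvd t)"
proof
  assume c: "coprime t N"
  show "\<forall>p\<in>prime_factors N. \<not> p dvd t"
    by (metis c coprime_common_divisor in_prime_factors_iff not_prime_unit)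
next
  assume a: "\<forall>p\<in>prime_factors N. \<not> p dvd t"
  show "coprime t N"
  proof (rule ccontr)
    assume "\<not> coprime t N"
    then have "gcd t N \<noteq> 1" by (simp add: coprime_iff_gcd_eq_1)
    then obtain p where "prime p" "p dvd gcd t N" using prime_factor_nat by blast
    then show False using a assms by (auto simp: in_prime_factors_iff)
  qed
qed

lemma ramanujan_sum_Ints:
  fixes z :: complex
  assumes "z ^ N = 1" "N > 0"
  shows "(\<Sum>t\<in>unit_residues N. z ^ t) \<in> \<int>"
proof -
  have "unit_residues N = {t. t < N \<and> (\<forall>p\<in>prime_factors N. \<not> p dvd t)}"
    using coprime_iff_no_prime_factor[OF assms(2)] by auto
  then show ?thesis
    using sifted_power_sum_Ints[of "prime_factors N" N z] assms by (auto simp: in_prime_factors_iff)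
qed

text \<open>The induction needs a weighted statement: the weight g absorbs one factor of a product,
  and the power \<open>z ^ (i * t)\<close> absorbs the identity function. Its starting point is the
  integrality of Ramanujan sums.\<close>

lemma int_poly_fun_trace_Ints:
  assumes f: "int_poly_fun f" and z: "z ^ N = 1" "N > 0"
  shows "(\<Sum>t\<in>unit_residues N. f (z ^ t)) \<in> \<int>"
proof -
  have *: "(\<Sum>t\<in>unit_residues N. z ^ (i * t) * (f (z ^ t) * g t)) \<in> \<int>"
    if "\<And>i. (\<Sum>t\<in>unit_residues N. z ^ (i * t) * g t) \<in> \<int>" for g :: "nat \<Rightarrow> complex" and i
    using f that
  proof (induction arbitrary: i g)
    case ident
    show ?case using ident[of "Suc i"] by (simp add: power_add mult.assoc mult.left_commute)
  next
    case (uminus f)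
    then show ?case by (simp add: sum_negf)
  next
    case (add f1 f2)
    have "(\<Sum>t\<in>unit_residues N. z ^ (i * t) * (f1 (z ^ t) * g t)) +
      (\<Sum>t\<in>unit_residues N. z ^ (i * t) * (f2 (z ^ t) * g t)) \<in> \<int>"
      using add by (intro Ints_add) auto
    then show ?case by (simp add: algebra_simps sum.distrib)
  next
    case (mult f1 f2)
    have "\<And>i. (\<Sum>t\<in>unit_residues N. z ^ (i * t) * (f2 (z ^ t) * g t)) \<in> \<int>"
      using mult by blast
    then have "(\<Sum>t\<in>unit_residues N. z ^ (i * t) * (f1 (z ^ t) * (f2 (z ^ t) * g t))) \<in> \<int>"
      by (rule mult.IH(1))
    then show ?case by (simp add: mult.assoc)
  qed auto
  have "(\<Sum>t\<in>unit_residues N. z ^ (i * t) * 1) \<in> \<int>" for i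
    using ramanujan_sum_Ints[of "z ^ i" N] z by (simp add: power_mult[symmetric]) (metis power_mult mult.commute power_one)
  then have "(\<Sum>t\<in>unit_residues N. z ^ (0 * t) * (f (z ^ t) * 1)) \<in> \<int>"
    by (rule *[where g = "\<lambda>t. 1"])
  then show ?thesis by simp
qed

lemma unit_residues_pos: "N > 0 \<Longrightarrow> card (unit_residues N) > 0"
proof -
  assume "N > 0"
  then have "1 mod N \<in> unit_residues N" by simp
  moreover have "finite (unit_residues N)" by simp
  ultimately show ?thesis using card_gt_0_iff by blast
qed

lemma root_of_unity_norm: "z ^ N = 1 \<Longrightarrow> N > 0 \<Longrightarrow> norm (z::complex) = 1"
  by (metis order_less_le power_eq_1_iff)

lemma root_of_unity_cnj: "z ^ N = 1 \<Longrightarrow> N > 0 \<Longrightarrow> cnj z = z ^ (N - 1)"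
proof -
  assume z: "z ^ N = 1" "N > 0"
  have "z * cnj z = 1" using root_of_unity_norm[OF z] by (simp add: complex_norm_square[symmetric])
  moreover have "z * z ^ (N - 1) = 1" using z by (metis Suc_diff_1 power_Suc)
  ultimately show ?thesis by (metis mult_cancel_left mult_zero_left zero_neq_one)
qed

text \<open>The trace of a large power of the squared modulus is an integer of absolute value below 1.\<close>

lemma int_poly_fun_conjugates_small:
  assumes f: "int_poly_fun f" and z: "z ^ N = 1" "N > 0"
    and small: "\<And>t. coprime t N \<Longrightarrow> norm (f (z ^ t)) \<le> c" and c: "c < 1"
  shows "f z = 0"
proof -
  \<comment> \<open>On N-th roots of unity complex conjugation is the power map with exponent
    \<open>N - 1\<close>, so the squared modulus of \<open>f\<close> is there an integer polynomial
    as well.\<close>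
  define g where "g = (\<lambda>w. f w * f (w ^ (N - 1)))"
  have fcnj: "f (cnj w) = cnj (f w)" for w using f by induction auto
  have g: "int_poly_fun g" unfolding g_def
    by (intro int_poly_intros f int_poly_fun_comp[OF f])
  have gz: "g (z ^ t) = of_real (norm (f (z ^ t)) ^ 2)" for t
  proof -
    have "(z ^ t) ^ N = 1" using z(1) by (metis mult.commute power_mult power_one)
    then have "cnj (z ^ t) = (z ^ t) ^ (N - 1)" using z(2) by (rule root_of_unity_cnj)
    then have "g (z ^ t) = f (z ^ t) * cnj (f (z ^ t))" unfolding g_def using fcnj[of "z ^ t"] by simp
    then show ?thesis by (metis complex_norm_square)
  qed
  have c0: "c \<ge> 0" using small[OF coprime_1_left] norm_ge_zero order_trans by blast
  obtain k where k: "(c ^ 2) ^ k < 1 / real N"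
    using real_arch_pow_inv[of "1 / real N" "c ^ 2"] z(2) power_strict_mono[of c 1 2] c c0 by auto
  define T where "T = (\<Sum>t\<in>unit_residues N. (norm (f (z ^ t)) ^ 2) ^ k)"
  have "(\<Sum>t\<in>unit_residues N. (g (z ^ t)) ^ k) \<in> \<int>"
    by (rule int_poly_fun_trace_Ints[OF _ z, of "\<lambda>w. g w ^ k"]) (intro int_poly_intros g)
  then have "of_real T \<in> (\<int> :: complex set)" unfolding T_def gz by simp
  then obtain m where m: "T = of_int m" by (metis Ints_cases of_real_eq_iff of_real_of_int_eq)
  have "T \<le> (\<Sum>t\<in>unit_residues N. (c ^ 2) ^ k)" unfolding T_def
    by (intro sum_mono power_mono small) auto
  also have "\<dots> \<le> real N * (c ^ 2) ^ k"
  proof -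
    have "card (unit_residues N) \<le> card {..<N}" by (intro card_mono) auto
    then show ?thesis by (auto intro!: mult_right_mono)
  qed
  also have "\<dots> < 1" using k z(2) by (simp add: field_simps)
  finally have "T < 1" .
  moreover have "T \<ge> 0" unfolding T_def by (intro sum_nonneg) auto
  ultimately have "T = 0" using m by auto
  then have "\<forall>t\<in>unit_residues N. (norm (f (z ^ t)) ^ 2) ^ k = 0"
    unfolding T_def by (subst (asm) sum_nonneg_eq_0_iff) auto
  moreover have "1 mod N \<in> unit_residues N" using z(2) by simp
  ultimately have "f (z ^ (1 mod N)) = 0" by (metis norm_eq_zero power_not_zero)
  then show ?thesis using root_of_unity_power_mod[OF z(1), of 1] by simp
qed

text \<open>Half of an odd number is not an algebraic integer: all conjugates of
  \<open>w + inverse w\<close> would equal \<open>k / 2\<close>, so with n conjugates the trace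
  \<open>n * (k / 2) ^ j\<close> of the j-th power would be an integer for every j, and
  \<open>2 ^ j\<close> would divide n.\<close>

lemma root_of_unity_plus_inverse_not_half_odd:
  fixes w :: complex and k :: int
  assumes w: "w ^ N = 1" "N > 0" and k: "odd k"
  shows "2 * (w + inverse w) \<noteq> of_int k"
proof
  assume eq: "2 * (w + inverse w) = of_int k"
  have "w \<noteq> 0" using w by (metis power_eq_0_iff zero_neq_one)
  then have inv: "inverse w = w ^ (N - 1)" using w
    by (metis Suc_diff_1 inverse_unique power_Suc)
  define n where "n = card (unit_residues N)"
  obtain j where j: "2 ^ j > n" using less_exp by blast
  let ?g = "\<lambda>x::complex. x + x ^ (N - 1)"
  have "2 * ?g (w ^ t) = of_int k" if "coprime t N" for t
  proof -
    have "2 * ?g w - of_int k = 0" using eq inv by simp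
    then have "2 * ?g (w ^ t) - of_int k = 0"
      by (intro int_poly_fun_galois[OF _ w _ that, of "\<lambda>x. 2 * ?g x - of_int k"] int_poly_intros)
    then show ?thesis by simp
  qed
  then have g: "?g (w ^ t) = of_int k / 2" if "coprime t N" for t using that by (simp add: field_simps)
  have "(\<Sum>t\<in>unit_residues N. ?g (w ^ t) ^ j) \<in> \<int>"
    by (rule int_poly_fun_trace_Ints[OF _ w, of "\<lambda>x. ?g x ^ j"]) (intro int_poly_intros)
  also have "(\<Sum>t\<in>unit_residues N. ?g (w ^ t) ^ j) = (\<Sum>t\<in>unit_residues N. (of_int k / 2) ^ j)"
    by (intro sum.cong refl) (metis (mono_tags, lifting) g mem_Collect_eq)
  finally have "of_nat n * (of_int k / 2) ^ j \<in> (\<int> :: complex set)" unfolding n_def by simp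
  then obtain m where "of_nat n * (of_int k / 2) ^ j = (of_int m :: complex)" by (auto elim: Ints_cases)
  then have "of_int (int n * k ^ j) = (of_int (m * 2 ^ j) :: complex)" by (simp add: power_divide field_simps)
  then have "int n * k ^ j = m * 2 ^ j" using of_int_eq_iff by blast
  then have "2 ^ j dvd int n * k ^ j" by simp
  moreover have "coprime (2 ^ j) (k ^ j)" using k by simp
  ultimately have "2 ^ j dvd int n" by (simp add: coprime_dvd_mult_left_iff)
  then have "2 ^ j dvd n" by (metis int_dvd_int_iff of_nat_numeral of_nat_power)
  moreover have "n > 0" unfolding n_def using unit_residues_pos[OF w(2)] .
  ultimately show False using j by (auto dest: dvd_imp_le)
qed

section \<open>Powers of a primitive root of unity and the excluded cross ratio\<close>

abbreviation primitive_root :: "nat \<Rightarrow> complex" where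
  "primitive_root N \<equiv> cis (2 * pi / real N)"

lemma primitive_root_power_eq_1_iff:
  assumes "N > 0" shows "primitive_root N ^ k = 1 \<longleftrightarrow> N dvd k"
proof
  assume "primitive_root N ^ k = 1"
  then have "Re (cis (real k * (2 * pi / real N))) = Re 1" unfolding Complex.DeMoivre by (rule arg_cong)
  then have "cos (real k * (2 * pi / real N)) = 1" by (simp only: cis.sel one_complex.sel)
  then obtain m :: int where m: "real k * (2 * pi / real N) = of_int m * 2 * pi"
    using cos_one_2pi_int by blast
  then have "real k = of_int m * real N" using assms by (simp add: field_simps)
  then have "int k = m * int N" by (metis of_int_eq_iff of_int_mult of_int_of_nat_eq)
  then show "N dvd k" by (metis dvd_triv_right int_dvd_int_iff)
next
  assume "N dvd k"
  then obtain j where "k = N * j" by (elim dvdE)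
  moreover have "primitive_root N ^ N = 1" unfolding Complex.DeMoivre using assms by simp
  ultimately show "primitive_root N ^ k = 1" by (simp only: power_mult power_one)
qed

lemma root_of_unity_eq_primitive_root_power:
  assumes z: "z ^ N = 1" and N: "N > 0"
  shows "\<exists>k<N. z = primitive_root N ^ k"
proof -
  have "(\<lambda>k. cis (2 * pi * real k / real N)) ` {..<N} = {z. z ^ N = 1}"
    by (rule bij_betw_imp_surj_on[OF Complex.bij_betw_roots_unity[OF N]])
  then obtain k where k: "k < N" "z = cis (2 * pi * real k / real N)" using z by blast
  have "primitive_root N ^ k = z" unfolding k(2) Complex.DeMoivre by (simp add: mult.commute)
  then show ?thesis using k(1) by metis
qed

text \<open>The left-hand side has all conjugates of modulus at most 4, so all conjugates of the
  second product would have modulus at most 4/5.\<close>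

lemma no_cross_ratio_five:
  fixes a b c d :: complex
  assumes N: "N > 0" and roots: "a ^ N = 1" "b ^ N = 1" "c ^ N = 1" "d ^ N = 1"
    and eq: "(a - c) * (b - d) = 5 * ((a - d) * (b - c))"
  shows "a = d \<or> b = c"
proof -
  define z where "z = primitive_root N"
  have z: "z ^ N = 1" using primitive_root_power_eq_1_iff[OF N] by (simp add: z_def)
  have norm_z: "norm z = 1" by (simp add: z_def)
  obtain i j k l :: nat where p: "a = z ^ i" "b = z ^ j" "c = z ^ k" "d = z ^ l"
    using root_of_unity_eq_primitive_root_power[OF _ N] roots unfolding z_def by metis
  let ?f = "\<lambda>z. (z ^ i - z ^ l) * (z ^ j - z ^ k)"
  let ?F = "\<lambda>z. (z ^ i - z ^ k) * (z ^ j - z ^ l) - 5 * ?f z"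
  have "?f z = 0"
  proof (rule int_poly_fun_conjugates_small[OF _ z N, of _ "4/5"])
    fix t assume t: "coprime t N"
    have "?F z = 0" using eq unfolding p by (simp only: right_minus_eq)
    then have "?F (z ^ t) = 0"
      by (intro int_poly_fun_galois[OF _ z N _ t, of ?F] int_poly_intros)
    then have "5 * ?f (z ^ t) = ((z ^ t) ^ i - (z ^ t) ^ k) * ((z ^ t) ^ j - (z ^ t) ^ l)"
      by (simp only: right_minus_eq)
    then have "norm (5 * ?f (z ^ t)) = norm (((z ^ t) ^ i - (z ^ t) ^ k) * ((z ^ t) ^ j - (z ^ t) ^ l))" by (rule arg_cong)
    also have "\<dots> \<le> 2 * 2"
    proof -
      have "norm ((z ^ t) ^ i - (z ^ t) ^ j) \<le> 2" for i j
        by (rule order_trans[OF norm_triangle_ineq4]) (simp add: norm_power norm_z)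
      then show ?thesis unfolding norm_mult by (intro mult_mono) auto
    qed
    finally have "norm (5 * ?f (z ^ t)) \<le> 4" by linarith
    moreover have "norm (5 * ?f (z ^ t)) = 5 * norm (?f (z ^ t))" by (simp only: norm_mult norm_numeral)
    ultimately show "norm (?f (z ^ t)) \<le> 4 / 5" by linarith
  next
    show "int_poly_fun ?f" by (intro int_poly_intros)
  qed simp
  then show ?thesis unfolding p mult_eq_0_iff right_minus_eq by blast
qed

section \<open>Cross ratios of roots of unity\<close>

text \<open>Discrete Fourier inversion: when all frequencies but 0 vanish, every residue class
  modulo p carries the same share of the total.\<close>

lemma exponent_class_sum:
  fixes c :: "'i \<Rightarrow> complex" and e :: "'i \<Rightarrow> nat"
  assumes I: "finite I" and p: "p > 0" and w: "\<And>k. w ^ k = 1 \<longleftrightarrow> p dvd k"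
    and zero: "\<And>k. k \<in> {1..<p} \<Longrightarrow> (\<Sum>i\<in>I. c i * w ^ (k * e i)) = 0"
  shows "of_nat p * (\<Sum>i\<in>I. if [e i = s] (mod p) then c i else 0) = (\<Sum>i\<in>I. c i)"
proof -
  \<comment> \<open>A natural number representing \<open>- s\<close> modulo p.\<close>
  define t where "t = p - s mod p"
  have dv: "p dvd e i + t \<longleftrightarrow> [e i = s] (mod p)" for i
  proof -
    have "p dvd e i + t \<longleftrightarrow> [e i + t = s + t] (mod p)"
    proof -
      have "s + t = p * (s div p) + p"
        using p unfolding t_def by (simp add: minus_mod_eq_mult_div[symmetric] less_imp_le_nat)
      then have "p dvd s + t" by simp
      then show ?thesis by (metis cong_dvd_iff cong_0_iff cong_trans cong_sym)
    qed
    then show ?thesis by (simp add: cong_add_rcancel_nat)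
  qed
  have pw: "(\<Sum>k<p. w ^ (k * m)) = (if p dvd m then of_nat p else 0)" for m
  proof -
    have "(\<Sum>k<p. w ^ (k * m)) = (\<Sum>k<p. (w ^ m) ^ k)"
      by (intro sum.cong refl) (simp add: power_mult[symmetric] mult.commute)
    also have "\<dots> = (if w ^ m = 1 then of_nat p else 0)"
      by (rule sum_powers_root_of_unity) (simp add: power_mult[symmetric] w)
    finally show ?thesis by (simp add: w)
  qed
  have "(\<Sum>k<p. w ^ (k * t) * (\<Sum>i\<in>I. c i * w ^ (k * e i))) = (\<Sum>i\<in>I. c i)"
  proof -
    have "(\<Sum>k<p. w ^ (k * t) * (\<Sum>i\<in>I. c i * w ^ (k * e i))) =
        (\<Sum>k\<in>{0}. w ^ (k * t) * (\<Sum>i\<in>I. c i * w ^ (k * e i)))"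
      by (rule sum.mono_neutral_right) (use p zero in auto)
    then show ?thesis by simp
  qed
  also have "(\<Sum>k<p. w ^ (k * t) * (\<Sum>i\<in>I. c i * w ^ (k * e i)))
      = (\<Sum>i\<in>I. c i * (\<Sum>k<p. w ^ (k * (e i + t))))"
    unfolding sum_distrib_left by (subst sum.swap) (simp add: power_add algebra_simps)
  also have "\<dots> = (\<Sum>i\<in>I. of_nat p * (if [e i = s] (mod p) then c i else 0))"
    unfolding pw dv by (intro sum.cong refl) auto
  finally show ?thesis by (simp add: sum_distrib_left)
qed

abbreviation cross_relation :: "complex \<Rightarrow> complex \<Rightarrow> complex \<Rightarrow> complex \<Rightarrow> complex \<Rightarrow> bool" where
  "cross_relation l a b c d \<equiv> (a - c) * (b - d) = l * ((a - d) * (b - c))"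

text \<open>The cross ratio relation, expanded into its six monomials and sorted by residue classes
  of exponents modulo \<open>p\<close>.\<close>

lemma cross_ratio_class_sum:
  fixes y1 y2 y3 y4 l :: complex and a1 a2 a3 a4 :: nat
  assumes p: "p > 0" and w: "\<And>k. w ^ k = 1 \<longleftrightarrow> p dvd k"
    and rel: "\<And>k. k \<in> {1..<p} \<Longrightarrow>
      cross_relation l (y1 * w ^ (k * a1)) (y2 * w ^ (k * a2)) (y3 * w ^ (k * a3)) (y4 * w ^ (k * a4))"
  shows "of_nat p * ((if [a1 + a2 = s] (mod p) then (1 - l) * y1 * y2 else 0)
      + (if [a3 + a4 = s] (mod p) then (1 - l) * y3 * y4 else 0)
      + (if [a1 + a3 = s] (mod p) then l * y1 * y3 else 0)
      + (if [a2 + a4 = s] (mod p) then l * y2 * y4 else 0)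
      + (if [a1 + a4 = s] (mod p) then - (y1 * y4) else 0)
      + (if [a2 + a3 = s] (mod p) then - (y2 * y3) else 0))
    = (1 - l) * y1 * y2 + (1 - l) * y3 * y4 + l * y1 * y3 + l * y2 * y4 - y1 * y4 - y2 * y3"
proof -
  define c where "c = (!) [(1 - l) * y1 * y2, (1 - l) * y3 * y4, l * y1 * y3, l * y2 * y4,
    - (y1 * y4), - (y2 * y3)]"
  define e where "e = (!) [a1 + a2, a3 + a4, a1 + a3, a2 + a4, a1 + a4, a2 + a3]"
  have expand: "(\<Sum>i<6. g i) = g 0 + g 1 + g 2 + g 3 + g 4 + g 5" for g :: "nat \<Rightarrow> complex"
    by (simp add: eval_nat_numeral)
  have c: "c 0 = (1 - l) * y1 * y2" "c 1 = (1 - l) * y3 * y4" "c 2 = l * y1 * y3" "c 3 = l * y2 * y4"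
    "c 4 = - (y1 * y4)" "c 5 = - (y2 * y3)"
    by (simp_all add: c_def)
  have e: "e 0 = a1 + a2" "e 1 = a3 + a4" "e 2 = a1 + a3" "e 3 = a2 + a4" "e 4 = a1 + a4" "e 5 = a2 + a3"
    by (simp_all add: e_def)
  have "(\<Sum>i<6. c i * w ^ (k * e i)) = 0" if "k \<in> {1..<p}" for k
  proof -
    have id: "(1 - l) * A1 * A2 + (1 - l) * A3 * A4 + l * A1 * A3 + l * A2 * A4 - A1 * A4 - A2 * A3
      = (A1 - A3) * (A2 - A4) - l * ((A1 - A4) * (A2 - A3))" for A1 A2 A3 A4 :: complex
      by (simp add: algebra_simps)
    have "(\<Sum>i<6. c i * w ^ (k * e i)) = (1 - l) * (y1 * w ^ (k * a1)) * (y2 * w ^ (k * a2))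
      + (1 - l) * (y3 * w ^ (k * a3)) * (y4 * w ^ (k * a4)) + l * (y1 * w ^ (k * a1)) * (y3 * w ^ (k * a3))
      + l * (y2 * w ^ (k * a2)) * (y4 * w ^ (k * a4)) - (y1 * w ^ (k * a1)) * (y4 * w ^ (k * a4))
      - (y2 * w ^ (k * a2)) * (y3 * w ^ (k * a3))"
      unfolding expand c e by (simp add: power_add distrib_left ac_simps)
    also have "\<dots> = 0" unfolding id rel[OF that] by simp
    finally show ?thesis .
  qed
  then have "of_nat p * (\<Sum>i<6. if [e i = s] (mod p) then c i else 0) = (\<Sum>i<6. c i)"
    by (intro exponent_class_sum[OF _ p w]) auto
  then show ?thesis unfolding expand c e by simp
qed

text \<open>Only the classes of \<open>a1 + a1\<close> and \<open>a1 + a4\<close> are occupied. Both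
  class sums vanish as soon as the total does, and together they give
  \<open>(y1 - y2) * (y1 - y3) = 0\<close>. For p at least 3 an empty class makes the total vanish.
  For \<open>p = 2\<close> there is none, and the relation at \<open>k = 0\<close> is used instead,
  whence the form of the condition on k.\<close>

lemma three_and_one_residues:
  fixes y1 y2 y3 y4 l :: complex and a1 a2 a3 a4 :: nat
  assumes p: "prime p" and w: "\<And>k. w ^ k = 1 \<longleftrightarrow> p dvd k"
    and rel: "\<And>k. k \<in> {1..<p} \<or> p = 2 \<Longrightarrow>
      cross_relation l (y1 * w ^ (k * a1)) (y2 * w ^ (k * a2)) (y3 * w ^ (k * a3)) (y4 * w ^ (k * a4))"
    and a: "[a1 = a2] (mod p)" "[a1 = a3] (mod p)" "\<not> [a1 = a4] (mod p)" and y4: "y4 \<noteq> 0"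
  shows "y1 = y2 \<or> y1 = y3"
proof -
  define C where "C s = (if [a1 + a2 = s] (mod p) then (1 - l) * y1 * y2 else 0)
      + (if [a3 + a4 = s] (mod p) then (1 - l) * y3 * y4 else 0)
      + (if [a1 + a3 = s] (mod p) then l * y1 * y3 else 0)
      + (if [a2 + a4 = s] (mod p) then l * y2 * y4 else 0)
      + (if [a1 + a4 = s] (mod p) then - (y1 * y4) else 0)
      + (if [a2 + a3 = s] (mod p) then - (y2 * y3) else 0)" for s
  define T where "T = (1 - l) * y1 * y2 + (1 - l) * y3 * y4 + l * y1 * y3 + l * y2 * y4 - y1 * y4 - y2 * y3"
  have p0: "p > 0" using p by (simp add: prime_gt_0_nat)
  have CT: "of_nat p * C s = T" for s
    unfolding C_def T_def by (rule cross_ratio_class_sum[OF p0 w rel[OF disjI1]])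
  have same: "[a1 + a2 = a1 + a1] (mod p)" "[a1 + a3 = a1 + a1] (mod p)" "[a2 + a3 = a1 + a1] (mod p)"
    "[a3 + a4 = a1 + a4] (mod p)" "[a2 + a4 = a1 + a4] (mod p)"
    using cong_add[OF cong_refl a(1)] cong_add[OF cong_refl a(2)] cong_add[OF a(1) a(2)]
      cong_add[OF a(1) cong_refl] cong_add[OF a(2) cong_refl] by (blast intro: cong_sym)+
  have ne: "\<not> [a1 + a1 = a1 + a4] (mod p)" using a(3) by (simp add: cong_add_lcancel_nat)
  have ifc: "[x = s] (mod p) \<longleftrightarrow> [x' = s] (mod p)" if "[x = x'] (mod p)" for x x' s
    using that by (meson cong_sym cong_trans)
  have Cs: "C s = (if [a1 + a1 = s] (mod p) then (1 - l) * y1 * y2 + l * y1 * y3 - y2 * y3 else 0)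
     + (if [a1 + a4 = s] (mod p) then y4 * ((1 - l) * y3 + l * y2 - y1) else 0)" for s
    unfolding C_def ifc[OF same(1)] ifc[OF same(2)] ifc[OF same(3)] ifc[OF same(4)] ifc[OF same(5)]
    by (auto simp: algebra_simps)
  have T0: "T = 0"
  proof (cases "p = 2")
    case True
    then show ?thesis using rel[of 0] unfolding T_def by (simp add: algebra_simps)
  next
    case False
    then have p3: "p \<ge> 3" using prime_ge_2_nat[OF p] by simp
    obtain s where s: "s < p" "s \<noteq> (a1 + a1) mod p" "s \<noteq> (a1 + a4) mod p"
    proof -
      have "\<not> {..<p} \<subseteq> {(a1 + a1) mod p, (a1 + a4) mod p}"
      proof
        assume "{..<p} \<subseteq> {(a1 + a1) mod p, (a1 + a4) mod p}"
        then have "card {..<p} \<le> card {(a1 + a1) mod p, (a1 + a4) mod p}" by (intro card_mono) auto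
        also have "\<dots> \<le> 2" by (rule order_trans[OF card_insert_le_m1]) auto
        finally show False using p3 by simp
      qed
      then show thesis using that by blast
    qed
    have "C s = 0" unfolding Cs using s by (auto simp: cong_def)
    then show ?thesis using CT[of s] by simp
  qed
  then have C0: "C s = 0" for s using CT[of s] p0 by simp
  have E1: "(1 - l) * y1 * y2 + l * y1 * y3 - y2 * y3 = 0"
    using C0[of "a1 + a1"] ne cong_sym_eq[of "a1 + a4" "a1 + a1" p] unfolding Cs by simp
  have E2: "(1 - l) * y3 + l * y2 - y1 = 0"
    using C0[of "a1 + a4"] ne y4 unfolding Cs by simp
  have "(y1 - y2) * (y1 - y3) = - ((1 - l) * y1 * y2 + l * y1 * y3 - y2 * y3) - y1 * ((1 - l) * y3 + l * y2 - y1)"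
    by (simp add: algebra_simps)
  then have "(y1 - y2) * (y1 - y3) = 0" unfolding E1 E2 by simp
  then show ?thesis by simp
qed

text \<open>Pair sums sharing an index are incongruent and \<open>nc\<close> separates two of the
  three complementary pairs, so four of the six monomials are alone in their classes and equal
  \<open>T / p\<close>. Comparing them gives \<open>y1 = y2\<close> or \<open>y1 = - y2\<close>. The
  latter leads to \<open>l = 1\<close>, the former to \<open>l = - 1\<close> and to
  \<open>2 * (q + inverse q) = 4 - p\<close> for a root of unity q, which is impossible for odd
  p.\<close>

lemma four_residues_aux:
  fixes y1 y2 y3 y4 l :: complex and a1 a2 a3 a4 :: nat
  assumes p: "prime p" "p \<ge> 5" and w: "\<And>k. w ^ k = 1 \<longleftrightarrow> p dvd k"
    and rel: "\<And>k. k \<in> {1..<p} \<Longrightarrow>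
      cross_relation l (y1 * w ^ (k * a1)) (y2 * w ^ (k * a2)) (y3 * w ^ (k * a3)) (y4 * w ^ (k * a4))"
    and a: "\<not> [a1 = a2] (mod p)" "\<not> [a1 = a3] (mod p)" "\<not> [a1 = a4] (mod p)"
      "\<not> [a2 = a3] (mod p)" "\<not> [a2 = a4] (mod p)" "\<not> [a3 = a4] (mod p)"
    and nc: "\<not> [a1 + a3 = a2 + a4] (mod p)" "\<not> [a1 + a4 = a2 + a3] (mod p)"
    and y: "y1 ^ N = 1" "y2 ^ N = 1" "y3 ^ N = 1" "y4 ^ N = 1" "N > 0"
    and l: "l \<noteq> 0" "l \<noteq> 1"
  shows False
proof -
  define T where "T = (1 - l) * y1 * y2 + (1 - l) * y3 * y4 + l * y1 * y3 + l * y2 * y4 - y1 * y4 - y2 * y3"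
  have p0: "p > 0" using p by simp
  note CT = cross_ratio_class_sum[OF p0 w rel, folded T_def]
  have canc: "[x + z = y + z] (mod p) \<longleftrightarrow> [x = y] (mod p)" "[z + x = z + y] (mod p) \<longleftrightarrow> [x = y] (mod p)"
    "[x + z = z + y] (mod p) \<longleftrightarrow> [x = y] (mod p)" "[z + x = y + z] (mod p) \<longleftrightarrow> [x = y] (mod p)" for x y z
    by (simp_all add: cong_add_lcancel_nat cong_add_rcancel_nat add.commute[of z])
  have a': "\<not> [a2 = a1] (mod p)" "\<not> [a3 = a1] (mod p)" "\<not> [a4 = a1] (mod p)"
      "\<not> [a3 = a2] (mod p)" "\<not> [a4 = a2] (mod p)" "\<not> [a4 = a3] (mod p)"
    using a by (blast dest: cong_sym)+
  have nc': "\<not> [a2 + a4 = a1 + a3] (mod p)" "\<not> [a2 + a3 = a1 + a4] (mod p)"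
    using nc by (blast dest: cong_sym)+
  have E: "of_nat p * (l * y1 * y3) = T" "of_nat p * (l * y2 * y4) = T"
    "of_nat p * (- (y1 * y4)) = T" "of_nat p * (- (y2 * y3)) = T"
    using CT[of "a1 + a3"] CT[of "a2 + a4"] CT[of "a1 + a4"] CT[of "a2 + a3"] a a' nc nc'
    by (simp_all add: canc)
  have pc: "(of_nat p :: complex) \<noteq> 0" using p0 by simp
  have nz: "y1 \<noteq> 0" "y2 \<noteq> 0" "y3 \<noteq> 0" "y4 \<noteq> 0" using y by (auto simp: power_0_left)
  have e1: "y1 * y3 = y2 * y4" using E(1,2) pc l(1) by (metis (no_types, lifting) mult.assoc mult_cancel_left)
  have e2: "y1 * y4 = y2 * y3" using E(3,4) pc by (metis (no_types, lifting) minus_equation_iff mult_cancel_left)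
  have e3: "l * y3 = - y4" using E(1,3) pc nz(1)
    by (metis (no_types, lifting) mult.assoc mult.left_commute mult_cancel_left mult_minus_right)
  have "(y1 - y2) * (y1 + y2) * (y3 * y4) = (y1 * y3) * (y1 * y4) - (y2 * y4) * (y2 * y3)"
    by (simp add: algebra_simps)
  also have "\<dots> = 0" unfolding e1 e2 by simp
  finally have "y1 - y2 = 0 \<or> y1 + y2 = 0" using nz by simp
  then consider "y1 = y2" | "y1 = - y2" unfolding eq_neg_iff_add_eq_0 right_minus_eq by blast
  then show False
  proof cases
    case 2
    then have "y2 * (- y3) = y2 * y4" using e1 by simp
    then have h: "- y3 = y4" using nz(2) by (simp only: mult_cancel_left) simp
    have "l * y3 = 1 * y3" using e3 unfolding h[symmetric] by simp
    then show False using l(2) nz(3) by (simp only: mult_cancel_right) simp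
  next
    case 1
    then have y34: "y3 = y4" using e1 nz by simp
    then have "l * y4 = (- 1) * y4" using e3 by simp
    then have l1: "l = - 1" using nz(4) by (simp only: mult_cancel_right) simp
    define q where "q = y1 / y3"
    have q: "y1 = q * y3" "q \<noteq> 0" using nz by (simp_all add: q_def)
    have "T = 2 * (y1 * y1) + 2 * (y3 * y3) - 4 * (y1 * y3)"
      unfolding T_def l1 by (simp add: flip: 1 y34)
    moreover have "of_nat p * (- (y1 * y3)) = T" using E(1) unfolding l1 by simp
    ultimately have "of_nat p * (- (y1 * y3)) = 2 * (y1 * y1) + 2 * (y3 * y3) - 4 * (y1 * y3)" by (rule trans[rotated])
    then have "2 * (y1 * y1) + 2 * (y3 * y3) = (4 - of_nat p) * (y1 * y3)" by (simp add: algebra_simps)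
    then have "(2 * (q * q + 1)) * (y3 * y3) = ((4 - of_nat p) * q) * (y3 * y3)"
      unfolding q(1) by (simp add: algebra_simps)
    then have "2 * (q * q + 1) = (4 - of_nat p) * q" using nz(3) by (simp only: mult_cancel_right mult_eq_0_iff) simp
    moreover have "2 * (q + inverse q) * q = 2 * (q * q + 1)" using q(2) by (simp add: distrib_right)
    ultimately have "2 * (q + inverse q) * q = (4 - of_nat p) * q" by simp
    then have "2 * (q + inverse q) = 4 - of_nat p" using q(2) by (simp only: mult_cancel_right) simp
    then have "2 * (q + inverse q) = of_int (4 - int p)" by simp
    moreover have "odd (4 - int p)" using prime_odd_nat[OF p(1)] p(2) by simp
    moreover have "q ^ N = 1" unfolding q_def using y by (simp add: power_divide)
    ultimately show False using root_of_unity_plus_inverse_not_half_odd y(5) by blast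
  qed
qed

text \<open>The field generated by z over the rationals, presented so that clearing denominators
  turns a relation over it into an integer polynomial relation in z.\<close>

definition int_poly_quotients :: "complex \<Rightarrow> complex set" where
  "int_poly_quotients z = {f z / g z | f g. int_poly_fun f \<and> int_poly_fun g \<and> g z \<noteq> 0}"

definition cross_ratio :: "complex \<Rightarrow> complex \<Rightarrow> complex \<Rightarrow> complex \<Rightarrow> complex" where
  "cross_ratio a b c d = ((a - c) * (b - d)) / ((a - d) * (b - c))"

text \<open>At most one of the three complementary pairs of sums can coincide, since two
  coincidences would force two of the residues to agree, p being odd. Relabelling moves it to the
  pair \<open>a1 + a2\<close>, \<open>a3 + a4\<close>, which \<open>four_residues_aux\<close>
  tolerates.\<close>

lemma four_residues_impossible:
  fixes V :: "complex set" and a :: "complex \<Rightarrow> nat" and y :: "complex \<Rightarrow> complex"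
  assumes p: "prime p" "p \<ge> 5" and w: "\<And>k. w ^ k = 1 \<longleftrightarrow> p dvd k"
    and rel: "\<And>x1 x2 x3 x4. x1 \<in> V \<Longrightarrow> x2 \<in> V \<Longrightarrow> x3 \<in> V \<Longrightarrow> x4 \<in> V \<Longrightarrow> distinct [x1, x2, x3, x4] \<Longrightarrow>
      \<exists>l. l \<noteq> 0 \<and> l \<noteq> 1 \<and> (\<forall>k. k \<in> {1..<p} \<or> p = 2 \<longrightarrow>
      cross_relation l (y x1 * w ^ (k * a x1)) (y x2 * w ^ (k * a x2)) (y x3 * w ^ (k * a x3)) (y x4 * w ^ (k * a x4)))"
    and y: "\<And>x. x \<in> V \<Longrightarrow> y x ^ N = 1" "N > 0"
    and x: "x1 \<in> V" "x2 \<in> V" "x3 \<in> V" "x4 \<in> V"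
    and a: "\<not> [a x1 = a x2] (mod p)" "\<not> [a x1 = a x3] (mod p)" "\<not> [a x1 = a x4] (mod p)"
      "\<not> [a x2 = a x3] (mod p)" "\<not> [a x2 = a x4] (mod p)" "\<not> [a x3 = a x4] (mod p)"
  shows False
proof -
  have *: False if x: "x1 \<in> V" "x2 \<in> V" "x3 \<in> V" "x4 \<in> V"
    and a: "\<not> [a x1 = a x2] (mod p)" "\<not> [a x1 = a x3] (mod p)" "\<not> [a x1 = a x4] (mod p)"
      "\<not> [a x2 = a x3] (mod p)" "\<not> [a x2 = a x4] (mod p)" "\<not> [a x3 = a x4] (mod p)"
    and nc: "\<not> [a x1 + a x3 = a x2 + a x4] (mod p)" "\<not> [a x1 + a x4 = a x2 + a x3] (mod p)" for x1 x2 x3 x4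
  proof -
    have "distinct [x1, x2, x3, x4]" using a by auto
    from rel[OF x this] obtain l where l: "l \<noteq> 0" "l \<noteq> 1" "\<And>k. k \<in> {1..<p} \<Longrightarrow>
      cross_relation l (y x1 * w ^ (k * a x1)) (y x2 * w ^ (k * a x2)) (y x3 * w ^ (k * a x3)) (y x4 * w ^ (k * a x4))"
      by blast
    show False by (rule four_residues_aux[OF p w l(3) a nc y(1)[OF x(1)] y(1)[OF x(2)] y(1)[OF x(3)]
      y(1)[OF x(4)] y(2) l(1,2)])
  qed
  have odd_p: "odd p" using p prime_odd_nat[of p] by auto
  have no_two: "\<not> ([u + v = s + t] (mod p) \<and> [u + s = v + t] (mod p))" if "\<not> [v = s] (mod p)" for u v s t
  proof
    assume h: "[u + v = s + t] (mod p) \<and> [u + s = v + t] (mod p)"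
    have "[(u + v) + (v + t) = (s + t) + (u + s)] (mod p)"
      by (rule cong_add[OF conjunct1[OF h] cong_sym[OF conjunct2[OF h]]])
    moreover have "(u + v) + (v + t) = 2 * v + (u + t)" "(s + t) + (u + s) = 2 * s + (u + t)" by simp_all
    ultimately have "[2 * v + (u + t) = 2 * s + (u + t)] (mod p)" by simp
    then have "[2 * v = 2 * s] (mod p)" by (simp add: cong_add_rcancel_nat)
    then have "[v = s] (mod p)" using odd_p by (subst (asm) cong_mult_lcancel_nat) auto
    then show False using that by simp
  qed
  have sym: "\<not> [v = u] (mod p)" if "\<not> [u = v] (mod p)" for u v
    using that by (blast dest: cong_sym)
  show False
  proof (cases "[a x1 + a x3 = a x2 + a x4] (mod p)")
    case True
    show False
    proof (rule *[of x1 x3 x2 x4])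
      show "\<not> [a x1 + a x2 = a x3 + a x4] (mod p)"
        using True no_two[OF a(4), of "a x1" "a x4"] by blast
      show "\<not> [a x1 + a x4 = a x3 + a x2] (mod p)"
      proof
        assume "[a x1 + a x4 = a x3 + a x2] (mod p)"
        then have "[a x1 + a x4 = a x3 + a x2] (mod p) \<and> [a x1 + a x3 = a x4 + a x2] (mod p)"
          using True by (simp add: add.commute)
        then show False using no_two[OF sym[OF a(6)], of "a x1" "a x2"] by blast
      qed
    qed (use x a sym in auto)
  next
    case F: False
    show False
    proof (cases "[a x1 + a x4 = a x2 + a x3] (mod p)")
      case True
      show False
      proof (rule *[of x1 x4 x3 x2])
        show "\<not> [a x1 + a x3 = a x4 + a x2] (mod p)" using F by (simp add: add.commute)
        show "\<not> [a x1 + a x2 = a x4 + a x3] (mod p)"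
        proof
          assume "[a x1 + a x2 = a x4 + a x3] (mod p)"
          then have "[a x1 + a x2 = a x4 + a x3] (mod p) \<and> [a x1 + a x4 = a x2 + a x3] (mod p)"
            using True by (simp add: add.commute)
          then show False using no_two[OF a(5), of "a x1" "a x3"] by blast
        qed
      qed (use x a sym in auto)
    next
      case False
      then show False using *[OF x a F] by blast
    qed
  qed
qed

lemma card_le_card_image:
  assumes "finite V" "\<And>r. r \<in> f ` V \<Longrightarrow> card {x \<in> V. f x = r} \<le> b"
  shows "card V \<le> b * card (f ` V)"
proof -
  have "card V = (\<Sum>r\<in>f ` V. card {x \<in> V. f x = r})"
    using sum.image_gen[OF assms(1), of "\<lambda>_. 1::nat" f] by simp
  also have "\<dots> \<le> (\<Sum>r\<in>f ` V. b)" by (intro sum_mono assms(2))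
  finally show ?thesis by (simp add: mult.commute)
qed

lemma obtain_three:
  assumes "card S \<ge> 3"
  obtains x1 x2 x3 where "x1 \<in> S" "x2 \<in> S" "x3 \<in> S" "x1 \<noteq> x2" "x1 \<noteq> x3" "x2 \<noteq> x3"
proof -
  obtain T where "T \<subseteq> S" "card T = 3" using assms by (metis obtain_subset_with_card_n)
  then show thesis using that by (auto simp: card_3_iff)
qed

lemma obtain_four:
  assumes "card S \<ge> 4"
  obtains x1 x2 x3 x4 where "x1 \<in> S" "x2 \<in> S" "x3 \<in> S" "x4 \<in> S" "distinct [x1, x2, x3, x4]"
proof -
  obtain T where T: "T \<subseteq> S" "card T = 4" using assms by (metis obtain_subset_with_card_n)
  then obtain xs where "set xs = T" "distinct xs" using finite_distinct_list[of T] card_gt_0_iff[of T] by auto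
  moreover from this have "length xs = Suc (Suc (Suc (Suc 0)))" using T distinct_card[of xs] by simp
  then obtain x1 x2 x3 x4 where "xs = [x1, x2, x3, x4]" by (auto simp: length_Suc_conv)
  ultimately show thesis using that[of x1 x2 x3 x4] T by auto
qed

text \<open>If p divides Q, every \<open>1 + j * Q\<close> is coprime to N. Otherwise exactly one
  class of j modulo p fails, and k0 is taken in that class, so that \<open>k0 + k\<close> avoids it
  whenever p does not divide k. As Q is even, \<open>p = 2\<close> belongs to the first
  case.\<close>

lemma coprime_translates:
  fixes N Q p :: nat
  assumes N: "N = Q * p" "Q > 0" and p: "prime p" and Q: "even Q"
  obtains k0 where "\<And>k. k \<in> {1..<p} \<or> p = 2 \<Longrightarrow> coprime (1 + (k0 + k) * Q) N"
proof -
  have cQ: "coprime (1 + j * Q) Q" for j by (rule coprimeI) (metis dvd_add_left_iff dvd_mult)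
  show thesis
  proof (cases "p dvd Q")
    case True
    have "coprime (1 + j * Q) p" for j by (rule coprime_divisors[OF dvd_refl True cQ])
    then show thesis using that[of 0] cQ unfolding N by (simp only: coprime_mult_right_iff add_0)
  next
    case False
    then have "coprime Q p" using p prime_imp_coprime coprime_commute by blast
    then obtain i where i: "[Q * i = 1] (mod p)" using cong_solve_coprime_nat[of Q p] by auto
    \<comment> \<open>Minus the inverse of Q modulo p.\<close>
    define k0 where "k0 = i * (p - 1)"
    have "[1 + k0 * Q = 1 + 1 * (p - 1)] (mod p)" unfolding k0_def
      using cong_mult[OF i cong_refl[of "p - 1"]] by (intro cong_add) (auto simp: algebra_simps)
    also have "1 + 1 * (p - 1) = p" using prime_gt_0_nat[OF p] by simp
    finally have k0: "p dvd 1 + k0 * Q" by (simp add: cong_0_iff[symmetric] cong_def)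
    have "coprime (1 + (k0 + k) * Q) N" if "k \<in> {1..<p} \<or> p = 2" for k
    proof -
      have "k \<in> {1..<p}" using that False Q by auto
      then have "\<not> p dvd k" by (auto dest: dvd_imp_le)
      then have "\<not> p dvd k * Q" using False p by (simp add: prime_dvd_mult_iff)
      then have "\<not> p dvd (1 + k0 * Q) + k * Q" using k0 dvd_add_right_iff by blast
      then have "\<not> p dvd 1 + (k0 + k) * Q" by (simp add: algebra_simps)
      then have "coprime (1 + (k0 + k) * Q) p" using p prime_imp_coprime coprime_commute by blast
      then show ?thesis using cQ unfolding N by (simp only: coprime_mult_right_iff)
    qed
    then show thesis using that by blast
  qed
qed

lemma finite_roots_of_unity_card:
  assumes "N > 0" "\<And>x. x \<in> V \<Longrightarrow> x ^ N = (1::complex)"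
  shows "finite V" "card V \<le> N"
proof -
  have fin: "finite {z::complex. z ^ N = 1}" and c: "card {z::complex. z ^ N = 1} = N"
    using card_roots_unity_eq[OF assms(1)] assms(1) card_gt_0_iff by force+
  have sub: "V \<subseteq> {z. z ^ N = 1}" using assms(2) by blast
  show "finite V" by (rule finite_subset[OF sub fin])
  show "card V \<le> N" using card_mono[OF fin sub] c by simp
qed

text \<open>With \<open>N = Q * p\<close> minimal and \<open>n dvd Q\<close>, the conjugations \<open>z \<mapsto> z ^ (1 + j * Q)\<close> fix
  the cross ratios and multiply \<open>x = z ^ a x\<close> by powers of \<open>w ^ a x\<close>, where \<open>w\<close> is a
  primitive \<open>p\<close>-th root of unity; \<open>k0\<close> shifts \<open>j\<close> away from the one value excluded when
  \<open>p\<close> does not divide \<open>Q\<close>.\<close>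

lemma card_cross_ratio_set_aux:
  fixes V :: "complex set"
  assumes n: "even n" "n > 0" and M: "M > 0" "\<And>x. x \<in> V \<Longrightarrow> x ^ M = 1" and one: "1 \<in> V"
    and cr: "\<And>x1 x2 x3 x4. x1 \<in> V \<Longrightarrow> x2 \<in> V \<Longrightarrow> x3 \<in> V \<Longrightarrow> x4 \<in> V \<Longrightarrow> distinct [x1, x2, x3, x4] \<Longrightarrow>
      cross_ratio x1 x2 x3 x4 \<in> int_poly_quotients (primitive_root n)"
    and big: "card V > n"
  shows "card V \<le> 6"
proof -
  define P where "P = (\<lambda>N. N > 0 \<and> n dvd N \<and> (\<forall>x\<in>V. x ^ N = 1))"
  define N where "N = (LEAST N. P N)"
  have "P (M * n)" using M n unfolding P_def by (auto simp: power_mult)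
  then have PN: "P N" unfolding N_def by (rule LeastI)
  have min: "\<not> P k" if "k < N" for k using not_less_Least that unfolding N_def by blast
  have N0: "N > 0" and nN: "n dvd N" and VN: "\<And>x. x \<in> V \<Longrightarrow> x ^ N = 1" using PN unfolding P_def by auto
  have finV: "finite V" and cV: "card V \<le> N" using finite_roots_of_unity_card[OF N0 VN] by auto
  obtain r where r: "N = n * r" using nN by (elim dvdE)
  have "r \<noteq> 1" using cV big r by auto
  then obtain p where p: "prime p" "p dvd r" using prime_factor_nat by blast
  then obtain r' where r': "r = p * r'" by (elim dvdE)
  define Q where "Q = n * r'"
  have NQ: "N = Q * p" unfolding Q_def r r' by simp
  have Q0: "Q > 0" using N0 NQ by simp
  have p1: "p > 1" by (rule prime_gt_1_nat[OF p(1)])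
  have QN: "Q < N" using Q0 p1 unfolding NQ by simp
  have evQ: "even Q" using n unfolding Q_def by simp
  define z where "z = primitive_root N"
  have z1: "z ^ k = 1 \<longleftrightarrow> N dvd k" for k unfolding z_def by (rule primitive_root_power_eq_1_iff[OF N0])
  have zN: "z ^ N = 1" using z1 by simp
  define w where "w = z ^ Q"
  have w: "w ^ k = 1 \<longleftrightarrow> p dvd k" for k
    unfolding w_def power_mult[symmetric] z1 NQ using Q0 by simp
  have w_cong: "w ^ (k * a) = w ^ (k * b)" if "[a = b] (mod p)" for a b k
  proof -
    have "k * a mod p = k * b mod p" using that unfolding cong_def by (rule mod_mult_cong[OF refl])
    moreover have "w ^ p = 1" using w by simp
    ultimately show ?thesis using root_of_unity_power_mod[of w p] by metis
  qed
  have "\<forall>x. \<exists>i. x \<in> V \<longrightarrow> i < N \<and> x = z ^ i"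
    using root_of_unity_eq_primitive_root_power[OF VN N0] unfolding z_def by blast
  then obtain a where a: "\<And>x. x \<in> V \<Longrightarrow> a x < N \<and> x = z ^ a x" by metis
  have a1: "a 1 = 0"
  proof -
    have "z ^ a 1 = 1" using a[OF one] by metis
    then have "N dvd a 1" using z1 by blast
    then show ?thesis using a[OF one] by (auto dest: dvd_imp_le)
  qed
  \<comment> \<open>By minimality of N the elements of V are not all Q-th roots of unity, so some
    exponent is not divisible by p. As \<open>a 1 = 0\<close>, at least two residue classes
    occur.\<close>
  obtain x0 where x0: "x0 \<in> V" "\<not> [a x0 = a 1] (mod p)"
  proof -
    have "\<not> P Q" by (rule min[OF QN])
    moreover have "n dvd Q" unfolding Q_def by simp
    ultimately obtain x where x: "x \<in> V" "x ^ Q \<noteq> 1" using Q0 unfolding P_def by blast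
    have "x ^ Q = w ^ a x" unfolding w_def using a[OF x(1)] by (metis mult.commute power_mult)
    then have "\<not> p dvd a x" using x(2) w by metis
    then show thesis using that[OF x(1)] unfolding a1 cong_0_iff by blast
  qed
  obtain k0 where k0: "\<And>k. k \<in> {1..<p} \<or> p = 2 \<Longrightarrow> coprime (1 + (k0 + k) * Q) N"
    using coprime_translates[OF NQ Q0 p(1) evQ] by metis
  \<comment> \<open>The shift by k0 is put into the base point, so that the remaining factor has the
    exponent \<open>k * a x\<close> that the residue lemmas expect.\<close>
  define y where "y = (\<lambda>x. x * w ^ (k0 * a x))"
  have yN: "y x ^ N = 1" if "x \<in> V" for x
  proof -
    have "w ^ N = 1" using w NQ by simp
    then have "(w ^ (k0 * a x)) ^ N = 1" by (metis mult.commute power_mult power_one)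
    then show ?thesis unfolding y_def using VN[OF that] by (simp add: power_mult_distrib)
  qed
  have conj: "(z ^ (1 + (k0 + k) * Q)) ^ a x = y x * w ^ (k * a x)" if "x \<in> V" for x k
  proof -
    have "(z ^ (1 + (k0 + k) * Q)) ^ a x = z ^ (a x + Q * (k0 * a x) + Q * (k * a x))"
      unfolding power_mult[symmetric] by (rule arg_cong[of _ _ "power z"]) (simp add: algebra_simps)
    also have "\<dots> = y x * w ^ (k * a x)"
      unfolding y_def w_def power_add power_mult using a[OF that] by (metis power_mult)
    finally show ?thesis .
  qed
  have rel: "\<exists>l. l \<noteq> 0 \<and> l \<noteq> 1 \<and> (\<forall>k. k \<in> {1..<p} \<or> p = 2 \<longrightarrow>
      cross_relation l (y x1 * w ^ (k * a x1)) (y x2 * w ^ (k * a x2)) (y x3 * w ^ (k * a x3)) (y x4 * w ^ (k * a x4)))"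
    if x: "x1 \<in> V" "x2 \<in> V" "x3 \<in> V" "x4 \<in> V" and d: "distinct [x1, x2, x3, x4]" for x1 x2 x3 x4
  proof -
    define l where "l = cross_ratio x1 x2 x3 x4"
    have dd: "x1 - x3 \<noteq> 0" "x2 - x4 \<noteq> 0" "x1 - x4 \<noteq> 0" "x2 - x3 \<noteq> 0" "x1 - x2 \<noteq> 0" "x3 - x4 \<noteq> 0"
      using d by simp_all
    have l0: "l \<noteq> 0" unfolding l_def cross_ratio_def using dd by simp
    have leq: "(x1 - x3) * (x2 - x4) = l * ((x1 - x4) * (x2 - x3))"
      unfolding l_def cross_ratio_def using dd by simp
    have l1: "l \<noteq> 1"
    proof
      assume "l = 1"
      moreover have "(x1 - x3) * (x2 - x4) - (x1 - x4) * (x2 - x3) = (x1 - x2) * (x3 - x4)"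
        by (simp add: algebra_simps)
      ultimately show False using leq dd by simp
    qed
    obtain f g where fg: "int_poly_fun f" "int_poly_fun g" "g (primitive_root n) \<noteq> 0"
      "l = f (primitive_root n) / g (primitive_root n)"
      using cr[OF x d] unfolding l_def[symmetric] int_poly_quotients_def by blast
    have "real N = real n * real r" using r by simp
    then have "real r * (2 * pi / real N) = 2 * pi / real n" using N0 n(2) r by (simp add: field_simps)
    then have zr: "z ^ r = primitive_root n" unfolding z_def Complex.DeMoivre by (rule arg_cong)
    \<comment> \<open>The cross ratio relation with denominators cleared. Passing from z to
      \<open>z ^ t\<close> leaves the r-th power unchanged and with it the value of the cross
      ratio.\<close>
    define F where "F = (\<lambda>u. (u ^ a x1 - u ^ a x3) * (u ^ a x2 - u ^ a x4) * g (u ^ r)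
        - f (u ^ r) * ((u ^ a x1 - u ^ a x4) * (u ^ a x2 - u ^ a x3)))"
    have F: "int_poly_fun F" unfolding F_def
      by (intro int_poly_intros int_poly_fun_comp[OF fg(1)] int_poly_fun_comp[OF fg(2)])
    have gl: "f (primitive_root n) = l * g (primitive_root n)" using fg(3,4) by simp
    have za: "z ^ a x1 = x1" "z ^ a x2 = x2" "z ^ a x3 = x3" "z ^ a x4 = x4" using a x by simp_all
    have Fz: "F z = 0" unfolding F_def za zr gl leq by (simp add: mult.assoc mult.left_commute)
    have "cross_relation l (y x1 * w ^ (k * a x1)) (y x2 * w ^ (k * a x2)) (y x3 * w ^ (k * a x3)) (y x4 * w ^ (k * a x4))"
      if k: "k \<in> {1..<p} \<or> p = 2" for k
    proof -
      define t where "t = 1 + (k0 + k) * Q"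
      have Ft: "F (z ^ t) = 0" by (rule int_poly_fun_galois[OF F zN N0 Fz k0[OF k, folded t_def]])
      have zt: "(z ^ t) ^ r = primitive_root n"
      proof -
        have "t * r = r + N * ((k0 + k) * r')" unfolding t_def Q_def r r' by (simp add: algebra_simps)
        then have "(z ^ t) ^ r = z ^ (r + N * ((k0 + k) * r'))" unfolding power_mult[symmetric] by simp
        also have "\<dots> = z ^ r" unfolding power_add power_mult zN by simp
        finally show ?thesis using zr by simp
      qed
      note conj' = conj[of _ k, folded t_def]
      define A B G where "A = (y x1 * w ^ (k * a x1) - y x3 * w ^ (k * a x3)) * (y x2 * w ^ (k * a x2) - y x4 * w ^ (k * a x4))"
        and "B = (y x1 * w ^ (k * a x1) - y x4 * w ^ (k * a x4)) * (y x2 * w ^ (k * a x2) - y x3 * w ^ (k * a x3))"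
        and "G = g (primitive_root n)"
      have "A * G - l * G * B = 0"
        using Ft unfolding F_def zt gl conj'[OF x(1)] conj'[OF x(2)] conj'[OF x(3)] conj'[OF x(4)] A_def B_def G_def .
      then have "(A - l * B) * G = 0" by (simp add: algebra_simps)
      then show ?thesis using fg(3) unfolding A_def B_def G_def by simp
    qed
    then show ?thesis using l0 l1 by blast
  qed
  \<comment> \<open>Three roots in one class and a fourth from another class would contradict
    \<open>three_and_one_residues\<close>: for exponents congruent modulo p,
    \<open>y x1 = y x2\<close> means \<open>x1 = x2\<close>.\<close>
  have fibre: "card {x \<in> V. a x mod p = s} \<le> 2" for s
  proof (rule ccontr)
    assume "\<not> ?thesis"
    then have "card {x \<in> V. a x mod p = s} \<ge> 3" by simp
    then obtain x1 x2 x3 where x: "x1 \<in> V" "x2 \<in> V" "x3 \<in> V" "x1 \<noteq> x2" "x1 \<noteq> x3" "x2 \<noteq> x3"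
      and m: "a x1 mod p = s" "a x2 mod p = s" "a x3 mod p = s"
      by (elim obtain_three) blast
    have c: "[a x1 = a x2] (mod p)" "[a x1 = a x3] (mod p)" using m by (simp_all add: cong_def)
    obtain x4 where x4: "x4 \<in> V" "\<not> [a x1 = a x4] (mod p)"
    proof (cases "[a x1 = a 1] (mod p)")
      case True
      then have "\<not> [a x1 = a x0] (mod p)" using x0(2) by (meson cong_sym cong_trans)
      then show thesis using that x0 by blast
    next
      case False then show thesis using that one by blast
    qed
    have d: "distinct [x1, x2, x3, x4]" using x x4 c m by (auto simp: cong_def)
    from rel[OF x(1-3) x4(1) d] obtain l where l: "\<And>k. k \<in> {1..<p} \<or> p = 2 \<Longrightarrow>
      cross_relation l (y x1 * w ^ (k * a x1)) (y x2 * w ^ (k * a x2)) (y x3 * w ^ (k * a x3)) (y x4 * w ^ (k * a x4))"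
      by blast
    have wnz: "w \<noteq> 0" using w[of p] p1 by (metis dvd_refl power_0_left not_one_less_zero zero_neq_one)
    have "y x4 \<noteq> 0" using yN[OF x4(1)] N0 by (metis power_0_left not_gr_zero zero_neq_one)
    then have "y x1 = y x2 \<or> y x1 = y x3"
      using three_and_one_residues[OF p(1) w l c x4(2)] by blast
    moreover have "w ^ (k0 * a x1) = w ^ (k0 * a x2)" "w ^ (k0 * a x1) = w ^ (k0 * a x3)"
      using w_cong c by blast+
    ultimately show False using x(4,5) wnz unfolding y_def by auto
  qed
  have cV2: "card V \<le> 2 * card ((\<lambda>x. a x mod p) ` V)"
    by (rule card_le_card_image[OF finV fibre])
  show ?thesis
  proof (rule ccontr)
    assume "\<not> card V \<le> 6"
    \<comment> \<open>More than six roots in classes of at most two fill at least four classes,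
      which in turn excludes \<open>p = 2\<close> and \<open>p = 3\<close>.\<close>
    then have c4: "card ((\<lambda>x. a x mod p) ` V) \<ge> 4" using cV2 by linarith
    also have "card ((\<lambda>x. a x mod p) ` V) \<le> card {..<p}" using p1 by (intro card_mono) auto
    finally have "p \<ge> 4" by simp
    moreover have "p \<noteq> 4"
    proof
      assume "p = 4"
      then have "even p" by simp
      then show False using p(1) \<open>p = 4\<close> primes_dvd_imp_eq two_is_prime_nat by force
    qed
    ultimately have p5: "p \<ge> 5" by simp
    obtain s1 s2 s3 s4 where s: "s1 \<in> (\<lambda>x. a x mod p) ` V" "s2 \<in> (\<lambda>x. a x mod p) ` V"
      "s3 \<in> (\<lambda>x. a x mod p) ` V" "s4 \<in> (\<lambda>x. a x mod p) ` V" "distinct [s1, s2, s3, s4]"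
      using obtain_four[OF c4] by metis
    then obtain x1 x2 x3 x4 where x: "x1 \<in> V" "x2 \<in> V" "x3 \<in> V" "x4 \<in> V"
      "s1 = a x1 mod p" "s2 = a x2 mod p" "s3 = a x3 mod p" "s4 = a x4 mod p" by blast
    show False
      by (rule four_residues_impossible[OF p(1) p5 w rel yN N0 x(1-4)]) (use s(5) x(5-8) in \<open>auto simp: cong_def\<close>)
  qed
qed

lemma cross_ratio_divide:
  assumes "c \<noteq> 0"
  shows "cross_ratio (x1 / c) (x2 / c) (x3 / c) (x4 / c) = cross_ratio x1 x2 x3 x4"
  unfolding cross_ratio_def diff_divide_distrib[symmetric] using assms by simp

theorem card_cross_ratio_set:
  fixes V :: "complex set"
  assumes n: "even n" "n > 0" and M: "M > 0" "\<And>x. x \<in> V \<Longrightarrow> x ^ M = 1"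
    and cr: "\<And>x1 x2 x3 x4. x1 \<in> V \<Longrightarrow> x2 \<in> V \<Longrightarrow> x3 \<in> V \<Longrightarrow> x4 \<in> V \<Longrightarrow> distinct [x1, x2, x3, x4] \<Longrightarrow>
      cross_ratio x1 x2 x3 x4 \<in> int_poly_quotients (primitive_root n)"
  shows "card V \<le> max 6 n"
proof (cases "V = {}")
  case False
  then obtain c where c: "c \<in> V" by blast
  have c0: "c \<noteq> 0" using M(2)[OF c] M(1) by (metis power_0_left not_gr_zero zero_neq_one)
  let ?V = "(\<lambda>x. x / c) ` V"
  have card: "card ?V = card V" using c0 by (intro card_image) (auto simp: inj_on_def)
  have "card ?V \<le> 6" if "card ?V > n"
  proof (rule card_cross_ratio_set_aux[OF n M(1) _ _ _ that])
    show "x ^ M = 1" if "x \<in> ?V" for x using that M(2) M(2)[OF c] by (auto simp: power_divide)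
    show "1 \<in> ?V" using c c0 by force
    show "cross_ratio x1 x2 x3 x4 \<in> int_poly_quotients (primitive_root n)"
      if "x1 \<in> ?V" "x2 \<in> ?V" "x3 \<in> ?V" "x4 \<in> ?V" "distinct [x1, x2, x3, x4]" for x1 x2 x3 x4
    proof -
      obtain y1 y2 y3 y4 where y: "y1 \<in> V" "y2 \<in> V" "y3 \<in> V" "y4 \<in> V"
        "x1 = y1 / c" "x2 = y2 / c" "x3 = y3 / c" "x4 = y4 / c" using \<open>x1 \<in> ?V\<close> \<open>x2 \<in> ?V\<close> \<open>x3 \<in> ?V\<close> \<open>x4 \<in> ?V\<close> by blast
      have "distinct [y1, y2, y3, y4]" using \<open>distinct [x1, x2, x3, x4]\<close> y(5-8) by auto
      then show ?thesis unfolding y(5-8) cross_ratio_divide[OF c0] using cr[OF y(1-4)] by blast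
    qed
  qed
  then show ?thesis unfolding card by linarith
qed simp

section \<open>Labels of alternating colourings\<close>

text \<open>\<open>L\<close> numbers the runs of a linear order from 0 to R. The relation
  \<open>lt\<close> enters for points of opposite colour only, so orders that differ on points of
  equal colour still share their labels.\<close>

definition chain_labels :: "'a set \<Rightarrow> ('a \<Rightarrow> bool) \<Rightarrow> ('a \<Rightarrow> 'a \<Rightarrow> bool) \<Rightarrow> nat \<Rightarrow> ('a \<Rightarrow> nat) \<Rightarrow> bool" where
  "chain_labels D s lt R L \<longleftrightarrow> L ` D = {..R} \<and>
     (\<forall>p\<in>D. \<forall>q\<in>D. s p = s q \<longleftrightarrow> even (L p + L q)) \<and>
     (\<forall>p\<in>D. \<forall>q\<in>D. s p \<noteq> s q \<longrightarrow> (lt p q \<longleftrightarrow> L p < L q))"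

lemma chain_labels_range: "chain_labels D s lt R L \<Longrightarrow> L ` D = {..R}"
  and chain_labels_parity: "chain_labels D s lt R L \<Longrightarrow> p \<in> D \<Longrightarrow> q \<in> D \<Longrightarrow> s p = s q \<longleftrightarrow> even (L p + L q)"
  and chain_labels_order: "chain_labels D s lt R L \<Longrightarrow> p \<in> D \<Longrightarrow> q \<in> D \<Longrightarrow> s p \<noteq> s q \<Longrightarrow> lt p q \<longleftrightarrow> L p < L q"
  unfolding chain_labels_def by blast+

lemma chain_labels_le: "chain_labels D s lt R L \<Longrightarrow> p \<in> D \<Longrightarrow> L p \<le> R"
  using chain_labels_range by blast

lemma chain_labels_obtain:
  assumes "chain_labels D s lt R L" "i \<le> R"
  obtains p where "p \<in> D" "L p = i"
  using chain_labels_range[OF assms(1)] assms(2) by (metis atMost_iff imageE)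

text \<open>Points are added by increasing f: a new one joins the last run if it has the colour of
  that run and opens another run otherwise.\<close>

lemma chain_labels_exists:
  fixes f :: "'a \<Rightarrow> real"
  assumes "finite D" "D \<noteq> {}" "\<And>p q. p \<in> D \<Longrightarrow> q \<in> D \<Longrightarrow> f p = f q \<Longrightarrow> s p = s q"
  shows "\<exists>R L. chain_labels D s (\<lambda>p q. f p < f q) R L"
  using assms
proof (induction D rule: finite_ranking_induct[where f = f])
  case empty then show ?case by simp
next
  case (insert x S)
  show ?case
  proof (cases "S = {}")
    case True
    then show ?thesis
      by (intro exI[of _ 0] exI[of _ "\<lambda>_. 0"]) (auto simp: chain_labels_def)
  next
    case False
    then obtain R L where L: "chain_labels S s (\<lambda>p q. f p < f q) R L" using insert by blast
    show ?thesis
    proof (cases "x \<in> S")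
      case True then show ?thesis using L by (metis insert_absorb)
    next
      case x: False
      obtain t where t: "t \<in> S" "L t = R" using chain_labels_obtain[OF L order_refl] .
      define r where "r = (if s x = s t then R else Suc R)"
      define L' where "L' = L(x := r)"
      have L'x: "L' x = r" and L'S: "\<And>p. p \<in> S \<Longrightarrow> L' p = L p" using x unfolding L'_def by auto
      have img: "L' ` insert x S = {..if s x = s t then R else Suc R}"
      proof -
        have "L' ` S = {..R}" using L'S chain_labels_range[OF L] by (metis image_cong)
        then have "L' ` insert x S = insert r {..R}" using L'x by simp
        then show ?thesis unfolding r_def by auto
      qed
      have par: "s x = s q \<longleftrightarrow> even (r + L q)" if q: "q \<in> S" for q
        using chain_labels_parity[OF L q t(1)] t(2) unfolding r_def by (cases "s x = s t") auto
      have ordx: "f q < f x \<and> L q < r" if q: "q \<in> S" "s x \<noteq> s q" for q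
      proof
        have "f q \<noteq> f x" using q insert.prems(2)[of q x] by auto
        then show "f q < f x" using insert.hyps(2)[OF q(1)] by linarith
        have "L q \<le> R" by (rule chain_labels_le[OF L q(1)])
        moreover have "odd (r + L q)" using par[OF q(1)] q(2) by blast
        ultimately show "L q < r" unfolding r_def by (cases "s x = s t") (auto simp: order_less_le)
      qed
      have "chain_labels (insert x S) s (\<lambda>p q. f p < f q) (if s x = s t then R else Suc R) L'"
        unfolding chain_labels_def
      proof (intro conjI ballI impI img)
        fix p q assume pq: "p \<in> insert x S" "q \<in> insert x S"
        show "s p = s q \<longleftrightarrow> even (L' p + L' q)"
          using pq par[of p] par[of q] chain_labels_parity[OF L, of p q] L'x L'S
          by (auto simp: add.commute)
        show "f p < f q \<longleftrightarrow> L' p < L' q" if "s p \<noteq> s q"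
          using pq ordx[of p] ordx[of q] chain_labels_order[OF L, of p q] L'x L'S that by force
      qed
      then show ?thesis by blast
    qed
  qed
qed

text \<open>A point of positive label has some point of label one less before it, necessarily of
  opposite colour, so any other labelling increases strictly along such a chain.\<close>

lemma chain_labels_unique_le:
  assumes L: "chain_labels D s lt R L" and L': "chain_labels D s lt R' L'"
  shows "p \<in> D \<Longrightarrow> L p \<le> L' p"
proof (induction "L p" arbitrary: p)
  case (Suc n)
  then have "n \<le> R" using chain_labels_le[OF L, of p] by simp
  then obtain r where r: "r \<in> D" "L r = n" using chain_labels_obtain[OF L] by blast
  have s: "s r \<noteq> s p" using chain_labels_parity[OF L r(1) Suc.prems] r(2) Suc.hyps(2)[symmetric] by simp
  have "lt r p" using chain_labels_order[OF L r(1) Suc.prems s] r(2) Suc.hyps(2) by simp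
  then have "L' r < L' p" using chain_labels_order[OF L' r(1) Suc.prems s] by simp
  moreover have "n \<le> L' r" using Suc.hyps(1)[OF r(2)[symmetric] r(1)] r(2) by simp
  ultimately show ?case using Suc.hyps(2) by simp
qed simp

text \<open>The label of a point is the length of the longest alternating chain ending in it.\<close>

lemma chain_labels_unique:
  assumes "chain_labels D s lt R L" "chain_labels D s lt R' L'" "p \<in> D"
  shows "L p = L' p"
  using chain_labels_unique_le[OF assms] chain_labels_unique_le[OF assms(2,1,3)] by simp

text \<open>Two points of equal colour and different labels are separated by a point of the opposite
  colour carrying the label after the smaller one.\<close>

lemma chain_labels_strict:
  fixes f :: "'a \<Rightarrow> real"
  assumes L: "chain_labels D s (\<lambda>p q. f p < f q) R L" and pq: "p \<in> D" "q \<in> D" "L p < L q"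
  shows "f p < f q"
proof (cases "s p = s q")
  case False then show ?thesis using chain_labels_order[OF L pq(1,2)] pq(3) by simp
next
  case True
  have "Suc (L p) \<le> R" using chain_labels_le[OF L pq(2)] pq(3) by simp
  then obtain r where r: "r \<in> D" "L r = Suc (L p)" using chain_labels_obtain[OF L] by blast
  have "even (L p + L q)" using True chain_labels_parity[OF L pq(1,2)] by simp
  then have "L q \<noteq> Suc (L p)" by auto
  then have "L r < L q" using r pq(3) by simp
  have s: "s p \<noteq> s r" using chain_labels_parity[OF L pq(1) r(1)] r(2) by simp
  have "f p < f r" using chain_labels_order[OF L pq(1) r(1) s] r(2) by simp
  moreover have "f r < f q" using chain_labels_order[OF L r(1) pq(2)] s True \<open>L r < L q\<close> by simp
  ultimately show ?thesis by simp
qed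

text \<open>A circular order is cut at another place, V moving from the beginning to the end. The
  circle has N runs, an even number because colours alternate; \<open>R = N\<close> says that the
  cut lies inside a run, whose two pieces carry the labels 0 and N. Modulo N the labels are merely
  shifted.\<close>

lemma chain_labels_rotate:
  assumes L: "chain_labels D s lt R L" and N: "even N" "N > 0" "R = N - 1 \<or> R = N"
    and V: "V \<subseteq> D"
    and same: "\<And>p q. p \<in> D \<Longrightarrow> q \<in> D \<Longrightarrow> s p \<noteq> s q \<Longrightarrow> p \<in> V \<longleftrightarrow> q \<in> V \<Longrightarrow> lt p q \<longleftrightarrow> lt' p q"
    and cross: "\<And>p q. p \<in> V \<Longrightarrow> q \<in> D - V \<Longrightarrow> s p \<noteq> s q \<Longrightarrow> lt p q \<and> \<not> lt q p \<and> lt' q p \<and> \<not> lt' p q"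
  shows "\<exists>R' L' k. chain_labels D s lt' R' L' \<and> (R' = N - 1 \<or> R' = N) \<and>
           (\<forall>p\<in>D. (L' p + k) mod N = L p mod N)"
proof (cases "V = D")
  case True
  have "chain_labels D s lt' R L"
    unfolding chain_labels_def
  proof (intro conjI ballI impI)
    show "L ` D = {..R}" by (rule chain_labels_range[OF L])
    fix p q assume pq: "p \<in> D" "q \<in> D"
    show "s p = s q \<longleftrightarrow> even (L p + L q)" by (rule chain_labels_parity[OF L pq])
    show "lt' p q \<longleftrightarrow> L p < L q" if "s p \<noteq> s q"
      using chain_labels_order[OF L pq that] same[OF pq that] pq True by blast
  qed
  then show ?thesis using N(3) by (intro exI[of _ R] exI[of _ L] exI[of _ 0]) simp
next
  case False
  define W where "W = D - V"
  have Wne: "L ` W \<noteq> {}" using V False unfolding W_def by auto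
  \<comment> \<open>The label at the new cut: smaller labels occur in V only, larger ones outside V
    only.\<close>
  define k where "k = (LEAST i. i \<in> L ` W)"
  have kW: "k \<in> L ` W" unfolding k_def using Wne by (metis LeastI ex_in_conv)
  have kle: "k \<le> L q" if "q \<in> W" for q unfolding k_def using that by (intro Least_le) simp
  obtain q0 where q0: "q0 \<in> W" "L q0 = k" using kW by blast
  have D: "q \<in> D" if "q \<in> W" for q using that unfolding W_def by blast
  have step: "q' \<in> W" if "q \<in> W" "q' \<in> D" "s q' \<noteq> s q" "L q < L q'" for q q'
  proof (rule ccontr)
    assume "q' \<notin> W"
    then have "q' \<in> V" using that unfolding W_def by blast
    then have "lt q' q" using cross[of q' q] that unfolding W_def by blast
    then show False using chain_labels_order[OF L that(2) D[OF that(1)] that(3)] that(4) by simp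
  qed
  have up: "q \<in> W" if "q \<in> D" "k < L q" for q
    using that
  proof (induction "L q" arbitrary: q rule: less_induct)
    case less
    show ?case
    proof (cases "L q = Suc k")
      case True
      then have "s q \<noteq> s q0" using chain_labels_parity[OF L less.prems(1) D[OF q0(1)]] q0(2) by simp
      then show ?thesis using step[OF q0(1) less.prems(1)] q0(2) less.prems(2) by simp
    next
      case False
      then have "L q - 1 \<le> R" using chain_labels_le[OF L less.prems(1)] by simp
      then obtain r where r: "r \<in> D" "L r = L q - 1" using chain_labels_obtain[OF L] by blast
      have rl: "L r < L q" "k < L r" "L q = Suc (L r)" using r False less.prems(2) by auto
      have "r \<in> W" by (rule less.hyps[OF rl(1) r(1) rl(2)])
      moreover have "s q \<noteq> s r" using chain_labels_parity[OF L less.prems(1) r(1)] rl(3) by simp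
      ultimately show ?thesis using step[of r q] less.prems(1) rl(1) by blast
    qed
  qed
  have Vle: "L p \<le> k" if "p \<in> V" for p
    using up[of p] that V unfolding W_def by (metis Diff_iff not_le_imp_less subsetD)
  have low: "p \<in> V" if "p \<in> D" "L p < k" for p using that kle[of p] unfolding W_def by force
  have kR: "k \<le> R" using chain_labels_le[OF L D[OF q0(1)]] q0(2) by simp
  have RN: "R \<le> N" "N \<le> R + 1" using N by auto
  define L' where "L' = (\<lambda>p. if p \<in> V then L p + N - k else L p - k)"
  have L'V: "L' p + k = L p + N" if "p \<in> V" for p using that kR RN unfolding L'_def by simp
  have L'W: "L' p + k = L p" if "p \<in> W" for p using that kle[OF that] unfolding L'_def W_def by simp
  have DVW: "p \<in> V \<or> p \<in> W" if "p \<in> D" for p using that unfolding W_def by blast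
  \<comment> \<open>The new cut splits a run if label k occurs on both sides of it, or if V is empty
    and the old cut already split one.\<close>
  define R' where "R' = (if k \<in> L ` V \<or> k = 0 \<and> R = N then N else N - 1)"
  have bnd: "L' p \<le> R'" if "p \<in> D" for p
  proof (cases "p \<in> V")
    case True
    show ?thesis
    proof (cases "L p = k")
      case True
      then have "k \<in> L ` V" using \<open>p \<in> V\<close> by blast
      then show ?thesis using True L'V[OF \<open>p \<in> V\<close>] unfolding R'_def by simp
    next
      case False
      then show ?thesis using Vle[OF True] L'V[OF True] unfolding R'_def by auto
    qed
  next
    case False
    then have "p \<in> W" using DVW[OF that] by blast
    then show ?thesis using L'W[of p] chain_labels_le[OF L that] RN unfolding R'_def by auto
  qed
  have surj: "i \<in> L' ` D" if "i \<le> R'" for i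
  proof (cases "i + k \<le> R")
    case True
    show ?thesis
    proof (cases "i = 0")
      case True
      then have "L' q0 = i" using L'W[OF q0(1)] q0(2) by simp
      then show ?thesis using D[OF q0(1)] by blast
    next
      case False
      obtain p where p: "p \<in> D" "L p = i + k" using chain_labels_obtain[OF L] True by blast
      then have "p \<in> W" using up False by simp
      then have "L' p = i" using L'W p by fastforce
      then show ?thesis using p by blast
    qed
  next
    case False
    have iN: "i \<le> N" using that unfolding R'_def by (simp split: if_splits)
    have ik: "i + k \<ge> N" using False RN by simp
    define j where "j = i + k - N"
    have j: "j + N = i + k" using ik unfolding j_def by simp
    show ?thesis
    proof (cases "j < k")
      case True
      then obtain p where p: "p \<in> D" "L p = j" using chain_labels_obtain[OF L, of j] kR by auto
      then have "p \<in> V" using low True by blast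
      then have "L' p = i" using L'V[of p] p(2) j by simp
      then show ?thesis using p by blast
    next
      case F: False
      then have iN': "i = N" "j = k" using iN j by auto
      then have "R' = N" using that N(2) bnd unfolding R'_def by (auto split: if_splits)
      then have "k \<in> L ` V \<or> k = 0 \<and> R = N" unfolding R'_def using N(2) by (auto split: if_splits)
      then show ?thesis
      proof
        assume "k \<in> L ` V"
        then obtain p where p: "p \<in> V" "L p = k" by blast
        then have "L' p = i" using L'V[of p] iN' by simp
        then show ?thesis using p V by blast
      next
        assume "k = 0 \<and> R = N"
        then show ?thesis using False iN' by simp
      qed
    qed
  qed
  have "chain_labels D s lt' R' L'"
    unfolding chain_labels_def
  proof (intro conjI ballI impI)
    show "L' ` D = {..R'}" using bnd surj by auto
  next
    fix p q assume pq: "p \<in> D" "q \<in> D"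
    have ev: "even (L' r + k) \<longleftrightarrow> even (L r)" if "r \<in> D" for r
      using DVW[OF that] L'V[of r] L'W[of r] N(1) by (elim disjE) simp_all
    have "even ((L' p + k) + (L' q + k)) \<longleftrightarrow> even (L p + L q)"
      unfolding even_add[of "L' p + k"] even_add[of "L p"] ev[OF pq(1)] ev[OF pq(2)] ..
    moreover have "(L' p + k) + (L' q + k) = (L' p + L' q) + 2 * k" by simp
    ultimately have "even (L' p + L' q) \<longleftrightarrow> even (L p + L q)" by simp
    then show par: "s p = s q \<longleftrightarrow> even (L' p + L' q)" using chain_labels_parity[OF L pq] by simp
    assume s: "s p \<noteq> s q"
    then have odd: "odd (L' p + L' q)" using par by blast
    show "lt' p q \<longleftrightarrow> L' p < L' q"
    proof (cases "p \<in> V \<longleftrightarrow> q \<in> V")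
      case True
      have "L' p < L' q \<longleftrightarrow> L' p + k < L' q + k" by simp
      also have "\<dots> \<longleftrightarrow> L p < L q"
        using True DVW[OF pq(1)] DVW[OF pq(2)] L'V[of p] L'V[of q] L'W[of p] L'W[of q] by auto
      also have "\<dots> \<longleftrightarrow> lt p q" using chain_labels_order[OF L pq s] by simp
      also have "\<dots> \<longleftrightarrow> lt' p q" by (rule same[OF pq s True])
      finally show ?thesis by simp
    next
      case False
      have WV: "L' a < L' b" if ab: "a \<in> W" "b \<in> V" "odd (L' a + L' b)" for a b
      proof -
        have "L' a + k \<le> R" using L'W[OF ab(1)] chain_labels_le[OF L D[OF ab(1)]] by simp
        then have "L' a + k \<le> L' b + k" using L'V[OF ab(2)] RN by simp
        moreover have "L' a \<noteq> L' b" using ab(3) by auto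
        ultimately show ?thesis by simp
      qed
      from False consider "p \<in> V" "q \<in> W" | "p \<in> W" "q \<in> V" using pq unfolding W_def by blast
      then show ?thesis
      proof cases
        case 1
        then show ?thesis using cross[of p q] s WV[of q p] odd unfolding W_def by (auto simp: add.commute)
      next
        case 2
        then show ?thesis using cross[of q p] s WV[of p q] odd unfolding W_def by auto
      qed
    qed
  qed
  moreover have "R' = N - 1 \<or> R' = N" unfolding R'_def by simp
  moreover have "(L' p + k) mod N = L p mod N" if "p \<in> D" for p
    using DVW[OF that] L'V[of p] L'W[of p] by auto
  ultimately show ?thesis by blast
qed

section \<open>Switching pairs of point sets\<close>

lemma fibrewise_bijection:
  assumes fin: "finite P" "finite Q" and card: "\<And>t. card {p \<in> P. f p = t} = card {q \<in> Q. f q = t}"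
  shows "\<exists>g. bij_betw g P Q \<and> (\<forall>p\<in>P. f (g p) = f p)"
proof -
  have "\<exists>g. bij_betw g {p \<in> P. f p = t} {q \<in> Q. f q = t}" for t
    using card[of t] fin by (intro finite_same_card_bij) auto
  then obtain g where g: "\<And>t. bij_betw (g t) {p \<in> P. f p = t} {q \<in> Q. f q = t}" by metis
  define h where "h = (\<lambda>p. g (f p) p)"
  have h: "h p \<in> Q \<and> f (h p) = f p" if "p \<in> P" for p
    using bij_betwE[OF g[of "f p"]] that unfolding h_def by blast
  have "inj_on h P"
  proof (rule inj_onI)
    fix p p' assume p: "p \<in> P" "p' \<in> P" "h p = h p'"
    then have "f p = f p'" using h by metis
    then show "p = p'" using p bij_betw_imp_inj_on[OF g[of "f p"]] unfolding h_def inj_on_def by simp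
  qed
  moreover have "Q \<subseteq> h ` P"
  proof
    fix q assume "q \<in> Q"
    then have "q \<in> g (f q) ` {p \<in> P. f p = f q}" using bij_betw_imp_surj_on[OF g[of "f q"]] by blast
    then show "q \<in> h ` P" unfolding h_def by force
  qed
  ultimately show ?thesis using h unfolding bij_betw_def by blast
qed

text \<open>Multiplication by \<open>cnj u\<close> turns u into the positive real axis, so imaginary
  and real part are, up to the factor \<open>norm u\<close>, the coordinates across u and along
  u.\<close>

abbreviation transversal :: "complex \<Rightarrow> complex \<Rightarrow> real" where
  "transversal u p \<equiv> Im (cnj u * p)"

abbreviation height :: "complex \<Rightarrow> complex \<Rightarrow> real" where
  "height u p \<equiv> Re (cnj u * p)"

lemma convex_line_between:
  assumes "convex H" "a \<in> H" "b \<in> H" "u \<noteq> 0"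
    and "transversal u a = transversal u c" "transversal u b = transversal u c"
    and "height u a \<le> height u c" "height u c \<le> height u b"
  shows "c \<in> H"
proof -
  have eqI: "x = y" if "transversal u x = transversal u y" "height u x = height u y" for x y
  proof -
    have "cnj u * x = cnj u * y" using that by (simp only: complex_eq_iff)
    then show ?thesis using assms(4) by simp
  qed
  show ?thesis
  proof (cases "height u a = height u b")
    case True
    then have "c = a" using assms by (intro eqI) auto
    then show ?thesis using assms by simp
  next
    case False
    define t where "t = (height u c - height u a) / (height u b - height u a)"
    have lt: "height u b - height u a > 0" using False assms by simp
    have t: "0 \<le> t" "t \<le> 1" using assms lt unfolding t_def by simp_all
    have th: "t * (height u b - height u a) = height u c - height u a" using lt unfolding t_def by simp
    define d where "d = (1 - t) *\<^sub>R a + t *\<^sub>R b"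
    have dH: "d \<in> H" unfolding d_def using assms t by (intro convexD) auto
    have cd: "cnj u * d = (1 - t) *\<^sub>R (cnj u * a) + t *\<^sub>R (cnj u * b)"
      unfolding d_def by (simp add: distrib_left)
    have "height u d = height u a + t * (height u b - height u a)"
      unfolding cd plus_complex.sel scaleR_complex.sel by (simp add: algebra_simps)
    then have h: "height u d = height u c" using th by simp
    have "transversal u d = (1 - t) * transversal u a + t * transversal u b"
      unfolding cd plus_complex.sel scaleR_complex.sel ..
    also have "\<dots> = transversal u c" unfolding assms(5,6) by (simp add: algebra_simps)
    finally show ?thesis using eqI[OF _ h] dH by simp
  qed
qed

lemma Arg2pi_less_iff:
  assumes "w \<noteq> 0" "w' \<noteq> 0" "\<bar>Arg2pi w - Arg2pi w'\<bar> < pi"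
  shows "Arg2pi w < Arg2pi w' \<longleftrightarrow> Im (w' * cnj w) > 0"
proof -
  have sgn: "Im (a / b) > 0 \<longleftrightarrow> Im (a * cnj b) > 0" if "b \<noteq> 0" for a b
  proof -
    have "a * cnj b = (a / b) * (b * cnj b)" using that by simp
    also have "b * cnj b = of_real ((norm b)\<^sup>2)" by (simp only: complex_norm_square)
    finally have "Im (a * cnj b) = Im (of_real ((norm b)\<^sup>2) * (a / b))" by (simp only: mult.commute)
    also have "\<dots> = (norm b)\<^sup>2 * Im (a / b)" by (simp only: times_complex.sel Re_complex_of_real Im_complex_of_real mult_zero_left add_0_right)
    finally have "Im (a * cnj b) = (norm b)\<^sup>2 * Im (a / b)" .
    then show ?thesis using that by (simp add: zero_less_mult_iff)
  qed
  have pos: "Im (b * cnj a) > 0" if "a \<noteq> 0" "b \<noteq> 0" "Arg2pi a < Arg2pi b" "Arg2pi b < Arg2pi a + pi" for a b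
  proof -
    have "Arg2pi (b / a) = Arg2pi b - Arg2pi a" using that by (intro Arg2pi_divide) auto
    then have "0 < Arg2pi (b / a)" "Arg2pi (b / a) < pi" using that by auto
    then show ?thesis using Arg2pi_lt_pi[of "b / a"] sgn[OF that(1)] by blast
  qed
  have swap: "Im (w * cnj w') = - Im (w' * cnj w)" by (simp add: algebra_simps)
  show ?thesis
  proof (cases "Arg2pi w" "Arg2pi w'" rule: linorder_cases)
    case less
    then show ?thesis using pos[of w w'] assms by auto
  next
    case greater
    then have "Im (w * cnj w') > 0" using pos[of w' w] assms by auto
    then show ?thesis using greater unfolding swap by linarith
  next
    case equal
    then obtain r where r: "r > 0" "w = of_real r * w'" using Arg2pi_eq_iff[OF assms(1,2)] by blast
    have "w' * cnj w = of_real r * (w' * cnj w')" unfolding r(2) by (simp del: complex_mult_cnj)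
    also have "\<dots> = of_real (r * (norm w')\<^sup>2)" unfolding complex_norm_square[symmetric] of_real_mult ..
    finally show ?thesis using equal by simp
  qed
qed

text \<open>To be applied with P and Q the two halves of the symmetric difference of two convex
  subsets and A and B their convex hulls, all translated so that the common centroid becomes
  0.\<close>

locale switching_pair =
  fixes P Q A B :: "complex set"
  assumes finite_P: "finite P" and finite_Q: "finite Q"
    and convex_A: "convex A" and convex_B: "convex B" and zero_A: "0 \<in> A" and zero_B: "0 \<in> B"
    and P_sub: "P \<subseteq> A - B" and Q_sub: "Q \<subseteq> B - A" and nonempty: "P \<union> Q \<noteq> {}"
begin

definition D :: "complex set" where "D = P \<union> Q"

definition in_P :: "complex \<Rightarrow> bool" where "in_P p \<longleftrightarrow> p \<in> P"

definition side :: "complex \<Rightarrow> complex set" where "side p = (if p \<in> P then A else B)"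

definition balanced :: "complex \<Rightarrow> bool" where
  "balanced u \<longleftrightarrow> u \<noteq> 0 \<and> (\<forall>t. card {p \<in> P. transversal u p = t} = card {q \<in> Q. transversal u q = t})"

lemma finite_D: "finite D"
  unfolding D_def using finite_P finite_Q by simp

lemma side_convex: "convex (side p)" and side_zero: "0 \<in> side p"
  unfolding side_def using convex_A convex_B zero_A zero_B by auto

lemma mem_side: "p \<in> D \<Longrightarrow> p \<in> side p"
  unfolding side_def D_def using P_sub Q_sub by auto

lemma not_mem_side: "p \<in> D \<Longrightarrow> q \<in> D \<Longrightarrow> in_P p \<noteq> in_P q \<Longrightarrow> p \<notin> side q"
  unfolding side_def D_def in_P_def using P_sub Q_sub by auto

lemma side_cong: "in_P p = in_P q \<Longrightarrow> side p = side q"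
  unfolding side_def in_P_def by simp

lemma D_nonzero: "p \<in> D \<Longrightarrow> p \<noteq> 0"
  unfolding D_def using P_sub Q_sub zero_A zero_B by auto

text \<open>On a ray from the origin the nearer point lies between 0 and the farther one, hence in a
  convex set that contains no point of the opposite colour.\<close>

lemma same_angle:
  assumes "p \<in> D" "q \<in> D" "Arg2pi p = Arg2pi q"
  shows "in_P p = in_P q"
proof (rule ccontr)
  assume opp: "in_P p \<noteq> in_P q"
  have *: False if pq: "p \<in> D" "q \<in> D" "in_P p \<noteq> in_P q" "p = of_real r * q" "0 < r" "r \<le> 1" for p q r
  proof -
    have "(1 - r) *\<^sub>R 0 + r *\<^sub>R q \<in> side q"
      using side_convex side_zero mem_side[OF pq(2)] pq(5,6) by (intro convexD) auto
    then have "p \<in> side q" using pq(4) by (simp add: scaleR_conv_of_real)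
    then show False using not_mem_side[OF pq(1-3)] by blast
  qed
  obtain r where r: "r > 0" "p = of_real r * q"
    using Arg2pi_eq_iff[OF D_nonzero[OF assms(1)] D_nonzero[OF assms(2)]] assms(3) by blast
  show False
  proof (cases "r \<le> 1")
    case True then show False using *[OF assms(1,2) opp r(2,1)] by blast
  next
    case False
    have "q = of_real (1 / r) * p" using r by simp
    then show False using *[OF assms(2,1) opp[symmetric], of "1 / r"] r False by simp
  qed
qed

lemma balanced_pairing:
  assumes "balanced u"
  obtains \<pi> where "\<And>p. p \<in> D \<Longrightarrow> \<pi> p \<in> D" "\<And>p. p \<in> D \<Longrightarrow> \<pi> (\<pi> p) = p"
    "\<And>p. p \<in> D \<Longrightarrow> transversal u (\<pi> p) = transversal u p" "\<And>p. p \<in> D \<Longrightarrow> in_P (\<pi> p) \<noteq> in_P p"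
proof -
  obtain g where g: "bij_betw g P Q" "\<And>p. p \<in> P \<Longrightarrow> transversal u (g p) = transversal u p"
    using fibrewise_bijection[OF finite_P finite_Q, of "transversal u"] assms unfolding balanced_def by blast
  define \<pi> where "\<pi> = (\<lambda>p. if p \<in> P then g p else inv_into P g p)"
  have disj: "q \<notin> P" if "q \<in> Q" for q using that P_sub Q_sub by blast
  have PQ: "g p \<in> Q" if "p \<in> P" for p using g(1) that bij_betwE by blast
  have QP: "inv_into P g q \<in> P" "g (inv_into P g q) = q" if "q \<in> Q" for q
    using g(1) that by (auto simp: bij_betw_def inv_into_into f_inv_into_f)
  have inv: "inv_into P g (g p) = p" if "p \<in> P" for p
    using g(1) that by (auto simp: bij_betw_def)
  show thesis
  proof (rule that[of \<pi>])
    fix p assume "p \<in> D"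
    then consider "p \<in> P" "p \<notin> Q" | "p \<in> Q" "p \<notin> P" unfolding D_def using disj by blast
    note cases = this
    show "\<pi> p \<in> D" using cases by cases (auto simp: \<pi>_def D_def PQ QP)
    show "\<pi> (\<pi> p) = p" using cases by cases (auto simp: \<pi>_def PQ QP disj inv)
    show "transversal u (\<pi> p) = transversal u p" using cases
    proof cases
      case 1 then show ?thesis using g(2) by (simp add: \<pi>_def)
    next
      case 2 then show ?thesis using g(2)[OF QP(1)[OF 2(1)]] QP(2)[OF 2(1)] by (simp add: \<pi>_def)
    qed
    show "in_P (\<pi> p) \<noteq> in_P p" using cases by cases (auto simp: \<pi>_def in_P_def PQ QP disj)
  qed
qed

end

section \<open>Pairs of opposite colour on the lines of one direction\<close>

locale balanced_direction = switching_pair +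
  fixes u :: complex and \<pi> :: "complex \<Rightarrow> complex"
  assumes u: "u \<noteq> 0"
    and pi_D: "p \<in> D \<Longrightarrow> \<pi> p \<in> D" and pi_pi: "p \<in> D \<Longrightarrow> \<pi> (\<pi> p) = p"
    and pi_line: "p \<in> D \<Longrightarrow> transversal u (\<pi> p) = transversal u p"
    and pi_opp: "p \<in> D \<Longrightarrow> in_P (\<pi> p) \<noteq> in_P p"
begin

text \<open>The pairing involves choices, but this notion does not: by
  \<open>line_separation\<close> all points of opposite colour on the line of p lie on the same side
  of p.\<close>

definition upper :: "complex \<Rightarrow> bool" where "upper p \<longleftrightarrow> height u (\<pi> p) < height u p"

lemma pi_side: "p \<in> D \<Longrightarrow> q \<in> D \<Longrightarrow> in_P p \<noteq> in_P q \<Longrightarrow> \<pi> p \<in> side q"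
  using mem_side[OF pi_D, of p] side_cong[of "\<pi> p" q] pi_opp[of p] by auto

text \<open>Otherwise \<open>p\<close> would lie between \<open>r\<close> and \<open>\<pi> p\<close>, which both belong to the
  convex set \<open>side q\<close>.\<close>

lemma line_separation:
  assumes p: "p \<in> D" and q: "q \<in> D" "in_P p \<noteq> in_P q" and r: "r \<in> side q" "transversal u r = transversal u p"
  shows "if upper p then height u r < height u p else height u p < height u r"
proof (rule ccontr)
  assume neg: "\<not> ?thesis"
  have "p \<in> side q"
  proof (cases "upper p")
    case True
    then show ?thesis using neg pi_line[OF p] r pi_side[OF p q] u
      by (intro convex_line_between[OF side_convex, of "\<pi> p" q r u p]) (auto simp: upper_def)
  next
    case False
    then show ?thesis using neg pi_line[OF p] r pi_side[OF p q] u
      by (intro convex_line_between[OF side_convex, of r q "\<pi> p" u p]) (auto simp: upper_def)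
  qed
  then show False using not_mem_side[OF p q] by blast
qed

lemma upper_pi: "p \<in> D \<Longrightarrow> upper (\<pi> p) \<longleftrightarrow> \<not> upper p"
  using line_separation[of p "\<pi> p" "\<pi> p"] pi_opp[of p] pi_D[of p] mem_side[OF pi_D, of p] pi_line[of p] pi_pi[of p]
  unfolding upper_def by (auto split: if_splits)

text \<open>The ray from 0 through q meets the line of p in a point not beyond q, which lies in
  \<open>side q\<close> by convexity, so \<open>line_separation\<close> applies to it.\<close>

lemma ray_separation:
  assumes p: "p \<in> D" and q: "q \<in> D" "in_P p \<noteq> in_P q"
    and t: "transversal u p * transversal u q > 0" "\<bar>transversal u p\<bar> \<le> \<bar>transversal u q\<bar>"
  shows "if upper p then transversal u p / transversal u q * height u q < height u p
         else height u p < transversal u p / transversal u q * height u q"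
proof -
  let ?m = "transversal u p / transversal u q"
  have q0: "transversal u q \<noteq> 0" using t by auto
  have m: "0 \<le> ?m" "?m \<le> 1" using t
    by (auto simp: zero_le_divide_iff divide_le_eq_1 zero_less_mult_iff abs_if split: if_splits)
  have "(1 - ?m) *\<^sub>R 0 + ?m *\<^sub>R q \<in> side q"
    using side_convex side_zero mem_side[OF q(1)] m by (intro convexD) auto
  then have "?m *\<^sub>R q \<in> side q" by simp
  moreover have cm: "cnj u * (?m *\<^sub>R q) = ?m *\<^sub>R (cnj u * q)" by simp
  moreover have "transversal u (?m *\<^sub>R q) = transversal u p"
    unfolding cm scaleR_complex.sel using q0 by simp
  ultimately show ?thesis
    using line_separation[OF p q, of "?m *\<^sub>R q"] unfolding cm scaleR_complex.sel by simp
qed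

lemma central_line:
  assumes p: "p \<in> D" and t: "transversal u p = 0"
  shows "if upper p then 0 < height u p else height u p < 0"
  using line_separation[OF p pi_D[OF p] pi_opp[OF p, symmetric] side_zero] t
  unfolding mult_zero_right zero_complex.sel by (simp only: if_split) auto

lemma opposite_on_line:
  assumes p: "p \<in> D" and q: "q \<in> D" "in_P p \<noteq> in_P q" and t: "transversal u q = transversal u p"
  shows "upper p \<noteq> upper q"
  using line_separation[OF p q mem_side[OF q(1)] t] line_separation[OF q(1) p q(2)[symmetric] mem_side[OF p] t[symmetric]]
  by (auto split: if_splits)

abbreviation angle :: "complex \<Rightarrow> real" where "angle p \<equiv> Arg2pi (- (cnj u * p))"

lemma angle_less_iff:
  assumes "p \<in> D" "q \<in> D" "transversal u p * transversal u q > 0"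
  shows "angle p < angle q \<longleftrightarrow> height u q * transversal u p < transversal u q * height u p"
proof -
  have nz: "- (cnj u * p) \<noteq> 0" "- (cnj u * q) \<noteq> 0" using D_nonzero assms u by auto
  have "0 < angle p \<and> angle p < pi \<and> 0 < angle q \<and> angle q < pi \<or>
    pi < angle p \<and> angle p < 2 * pi \<and> pi < angle q \<and> angle q < 2 * pi"
  proof (cases "transversal u p < 0")
    case True
    then have "transversal u q < 0" using assms(3) by (simp add: zero_less_mult_iff)
    then show ?thesis using True Arg2pi_lt_pi[of "- (cnj u * p)"] Arg2pi_lt_pi[of "- (cnj u * q)"] by simp
  next
    case False
    then have "0 < transversal u p" "0 < transversal u q" using assms(3) by (auto simp: zero_less_mult_iff)
    then show ?thesis
      using Arg2pi_le_pi[of "- (cnj u * p)"] Arg2pi_le_pi[of "- (cnj u * q)"]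
        Arg2pi_lt_2pi[of "- (cnj u * p)"] Arg2pi_lt_2pi[of "- (cnj u * q)"] by simp
  qed
  then have "\<bar>angle p - angle q\<bar> < pi" by auto
  then have "angle p < angle q \<longleftrightarrow> Im (- (cnj u * q) * cnj (- (cnj u * p))) > 0"
    by (rule Arg2pi_less_iff[OF nz])
  also have "Im (- (cnj u * q) * cnj (- (cnj u * p))) = transversal u q * height u p - height u q * transversal u p"
  proof -
    have "Im (- z * cnj (- z')) = Im z * Re z' - Re z * Im z'" for z z' by simp
    then show ?thesis .
  qed
  finally show ?thesis by linarith
qed

end

section \<open>From the angular order to the order along the boundary\<close>

context balanced_direction
begin

text \<open>Large enough that shifting by it in either direction moves the lower points past all
  upper ones in the keys below.\<close>

definition extent :: real where "extent = 2 * Max ((\<lambda>p. \<bar>transversal u p\<bar>) ` D) + 1"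

lemma extent_bound: "p \<in> D \<Longrightarrow> 2 * \<bar>transversal u p\<bar> < extent"
proof -
  assume "p \<in> D"
  then have "\<bar>transversal u p\<bar> \<le> Max ((\<lambda>p. \<bar>transversal u p\<bar>) ` D)"
    using finite_D by (intro Max_ge) auto
  then show ?thesis unfolding extent_def by simp
qed

text \<open>\<open>angle_key\<close> reproduces the order of points of opposite colour by their angle around the
  origin, counted from the direction \<open>- u\<close>; \<open>boundary_key\<close> runs along the upper points and
  back along the lower ones, so that \<open>\<pi>\<close> reverses it.\<close>

definition angle_key :: "complex \<Rightarrow> real" where
  "angle_key p = (if upper p then transversal u p
     else if transversal u p \<le> 0 then - transversal u p - extent else extent - transversal u p)"

definition boundary_key :: "complex \<Rightarrow> real" where
  "boundary_key p = (if upper p then transversal u p else extent - transversal u p)"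

abbreviation boundary_labels :: "nat \<Rightarrow> (complex \<Rightarrow> nat) \<Rightarrow> bool" where
  "boundary_labels \<equiv> chain_labels D in_P (\<lambda>p q. boundary_key p < boundary_key q)"

lemma angle_neg: "transversal u p < 0 \<Longrightarrow> 0 < angle p \<and> angle p < pi"
  using Arg2pi_lt_pi[of "- (cnj u * p)"] by simp

lemma angle_pos: "transversal u p > 0 \<Longrightarrow> pi < angle p"
  using Arg2pi_le_pi[of "- (cnj u * p)"] by simp

lemma angle_zero:
  assumes "p \<in> D" "transversal u p = 0"
  shows "angle p = (if upper p then pi else 0)"
proof -
  have "Im (- (cnj u * p)) = 0" using assms(2) by (simp only: uminus_complex.sel)
  then have "- (cnj u * p) \<in> \<real>" by (simp only: complex_is_Real_iff)
  then show ?thesis using Arg2pi_eq_pi[of "- (cnj u * p)"] Arg2pi_eq_0[of "- (cnj u * p)"]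
      central_line[OF assms] by (auto simp del: times_complex.sel)
qed

text \<open>For two points on the same side of the axis along u the one nearer to the axis decides:
  \<open>ray_separation\<close> tells on which side of the ray through the other point it
  lies.\<close>

lemma angle_less_by_first:
  assumes p: "p \<in> D" and q: "q \<in> D" "in_P p \<noteq> in_P q"
    and t: "transversal u p * transversal u q > 0" "\<bar>transversal u p\<bar> \<le> \<bar>transversal u q\<bar>"
  shows "angle p < angle q \<longleftrightarrow> (upper p \<longleftrightarrow> transversal u p > 0)"
    and "angle q < angle p \<longleftrightarrow> (upper p \<longleftrightarrow> transversal u p < 0)"
proof -
  define a b where "a = transversal u p" and "b = transversal u q"
  have ab: "a * b > 0" using t unfolding a_def b_def by simp
  have sgn: "a > 0 \<and> b > 0 \<or> a < 0 \<and> b < 0" using ab by (auto simp: zero_less_mult_iff)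
  have ray: "if upper p then a / b * height u q < height u p else height u p < a / b * height u q"
    using ray_separation[OF p q t] unfolding a_def b_def .
  have 1: "angle p < angle q \<longleftrightarrow> height u q * a < b * height u p"
    using angle_less_iff[OF p q(1) t(1)] unfolding a_def b_def .
  have t': "transversal u q * transversal u p > 0" using t(1) by (simp only: mult.commute)
  have 2: "angle q < angle p \<longleftrightarrow> height u p * b < a * height u q"
    using angle_less_iff[OF q(1) p t'] unfolding a_def b_def .
  have "(angle p < angle q \<longleftrightarrow> (upper p \<longleftrightarrow> a > 0)) \<and> (angle q < angle p \<longleftrightarrow> (upper p \<longleftrightarrow> a < 0))"
    using sgn
  proof
    assume s: "a > 0 \<and> b > 0"
    then have "a / b * height u q < height u p \<longleftrightarrow> height u q * a < b * height u p"
      "height u p < a / b * height u q \<longleftrightarrow> height u p * b < a * height u q"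
      by (simp_all add: field_simps del: times_complex.sel)
    then show ?thesis unfolding 1 2 using ray s by (auto simp: mult.commute split: if_splits simp del: times_complex.sel)
  next
    assume s: "a < 0 \<and> b < 0"
    then have "a / b * height u q < height u p \<longleftrightarrow> height u p * b < a * height u q"
      "height u p < a / b * height u q \<longleftrightarrow> height u q * a < b * height u p"
      by (simp_all add: field_simps del: times_complex.sel)
    then show ?thesis unfolding 1 2 using ray s by (auto simp: mult.commute split: if_splits simp del: times_complex.sel)
  qed
  then show "angle p < angle q \<longleftrightarrow> (upper p \<longleftrightarrow> transversal u p > 0)"
    and "angle q < angle p \<longleftrightarrow> (upper p \<longleftrightarrow> transversal u p < 0)" unfolding a_def by blast+
qed

lemma angle_key_neq:
  assumes "p \<in> D" "q \<in> D" "in_P p \<noteq> in_P q"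
  shows "angle_key p \<noteq> angle_key q"
  using opposite_on_line[OF assms] extent_bound[OF assms(1)] extent_bound[OF assms(2)]
  unfolding angle_key_def by (auto simp del: times_complex.sel split: if_splits)

text \<open>The signs of the transversal coordinates, with \<open>angle_zero\<close> for the axis,
  settle all pairs not strictly on one side of the axis. For the others the keys reveal whether the
  point nearer to the axis is upper, and \<open>angle_less_by_first\<close> concludes.\<close>

lemma angle_key_less_imp:
  assumes p: "p \<in> D" and q: "q \<in> D" and opp: "in_P p \<noteq> in_P q" and less: "angle_key p < angle_key q"
  shows "angle p < angle q"
proof -
  define a b where "a = transversal u p" and "b = transversal u q"
  have ext: "2 * \<bar>a\<bar> < extent" "2 * \<bar>b\<bar> < extent"
    using extent_bound[OF p] extent_bound[OF q] unfolding a_def b_def by simp_all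
  have line: "a = b \<longrightarrow> upper p \<noteq> upper q" using opposite_on_line[OF p q opp] unfolding a_def b_def by auto
  have key: "(if upper p then a else if a \<le> 0 then - a - extent else extent - a)
     < (if upper q then b else if b \<le> 0 then - b - extent else extent - b)"
    using less unfolding angle_key_def a_def b_def .
  have F: "angle p < angle q \<longleftrightarrow> (upper p \<longleftrightarrow> a > 0)" if "a * b > 0" "\<bar>a\<bar> \<le> \<bar>b\<bar>"
    using angle_less_by_first(1)[OF p q opp] that unfolding a_def b_def by simp
  have G: "angle p < angle q \<longleftrightarrow> (upper q \<longleftrightarrow> b < 0)" if "a * b > 0" "\<bar>b\<bar> \<le> \<bar>a\<bar>"
    using angle_less_by_first(2)[OF q p opp[symmetric]] that unfolding a_def b_def by (simp add: mult.commute)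
  have Np: "a < 0 \<Longrightarrow> 0 < angle p \<and> angle p < pi" "a > 0 \<Longrightarrow> pi < angle p"
    "a = 0 \<Longrightarrow> angle p = (if upper p then pi else 0)"
    using angle_neg[of p] angle_pos[of p] angle_zero[OF p] unfolding a_def by blast+
  have Nq: "b < 0 \<Longrightarrow> 0 < angle q \<and> angle q < pi" "b > 0 \<Longrightarrow> pi < angle q"
    "b = 0 \<Longrightarrow> angle q = (if upper q then pi else 0)"
    using angle_neg[of q] angle_pos[of q] angle_zero[OF q] unfolding b_def by blast+
  consider "a < 0" "b < 0" | "a > 0" "b > 0" | "a < 0" "b > 0" | "a > 0" "b < 0" | "a = 0" | "a \<noteq> 0" "b = 0"
    by linarith
  then show ?thesis
  proof cases
    case 1
    then have ab: "a * b > 0" by (simp add: mult_neg_neg)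
    show ?thesis
    proof (cases "\<bar>a\<bar> \<le> \<bar>b\<bar>")
      case True
      then have "\<not> upper p" using key line ext 1 by (auto split: if_splits)
      then show ?thesis using F[OF ab True] 1 by simp
    next
      case False
      then have "upper q" using key line ext 1 by (auto split: if_splits)
      then show ?thesis using G[OF ab] False 1 by simp
    qed
  next
    case 2
    then have ab: "a * b > 0" by simp
    show ?thesis
    proof (cases "\<bar>a\<bar> \<le> \<bar>b\<bar>")
      case True
      then have "upper p" using key line ext 2 by (auto split: if_splits)
      then show ?thesis using F[OF ab True] 2 by simp
    next
      case False
      then have "\<not> upper q" using key line ext 2 by (auto split: if_splits)
      then show ?thesis using G[OF ab] False 2 by simp
    qed
  next
    case 3
    then show ?thesis using Np(1) Nq(2) by linarith
  next
    case 4
    then have False using key ext by (auto split: if_splits)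
    then show ?thesis ..
  next
    case 5
    show ?thesis
    proof (cases "upper p")
      case True
      then have "b > 0" using key ext 5 by (auto split: if_splits)
      then show ?thesis using Nq(2) Np(3) 5 True by simp
    next
      case False
      have "b = 0 \<longrightarrow> upper q" using line 5 False by simp
      then have "0 < angle q"
        using Nq(1,3) less_trans[OF pi_gt_zero Nq(2)] pi_gt_zero by (metis linorder_neqE_linordered_idom)
      then show ?thesis using Np(3) 5 False by simp
    qed
  next
    case 6
    then have "upper q" "a < 0" using key ext by (auto split: if_splits)
    then show ?thesis using Np(1) Nq(3) 6 by simp
  qed
qed

lemma angle_key_less_iff:
  assumes "p \<in> D" "q \<in> D" "in_P p \<noteq> in_P q"
  shows "angle p < angle q \<longleftrightarrow> angle_key p < angle_key q"
  using angle_key_less_imp[OF assms] angle_key_less_imp[OF assms(2,1) assms(3)[symmetric]]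
    angle_key_neq[OF assms] by (meson linorder_neqE_linordered_idom not_less_iff_gr_or_eq)

lemma boundary_key_pi:
  assumes "p \<in> D" shows "boundary_key (\<pi> p) = extent - boundary_key p"
  unfolding boundary_key_def using upper_pi[OF assms] pi_line[OF assms] by simp

text \<open>The pairing exchanges the colours and reverses the boundary key, so
  \<open>R - L (\<pi> p)\<close> is a labelling for the same order, and labellings are
  unique.\<close>

lemma boundary_labels_reflect:
  assumes L: "boundary_labels R L" and p: "p \<in> D"
  shows "L p + L (\<pi> p) = R"
proof -
  define L' where "L' = (\<lambda>p. R - L (\<pi> p))"
  have L'R: "L' p + L (\<pi> p) = R" if "p \<in> D" for p
    using chain_labels_le[OF L pi_D[OF that]] unfolding L'_def by simp
  have "boundary_labels R L'"
    unfolding chain_labels_def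
  proof (intro conjI ballI impI)
    show "L' ` D = {..R}"
    proof (intro equalityI subsetI)
      fix i assume "i \<in> {..R}"
      then have "R - i \<le> R" "i \<le> R" by auto
      then obtain p where p: "p \<in> D" "L p = R - i" using chain_labels_obtain[OF L] by metis
      then have "L' (\<pi> p) = i" using \<open>i \<le> R\<close> unfolding L'_def pi_pi[OF p(1)] by simp
      then show "i \<in> L' ` D" using pi_D[OF p(1)] by blast
    qed (auto simp: L'_def)
  next
    fix p q assume pq: "p \<in> D" "q \<in> D"
    have "in_P p = in_P q \<longleftrightarrow> in_P (\<pi> p) = in_P (\<pi> q)" using pi_opp pq by auto
    also have "\<dots> \<longleftrightarrow> even (L (\<pi> p) + L (\<pi> q))" using chain_labels_parity[OF L pi_D[OF pq(1)] pi_D[OF pq(2)]] .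
    also have "\<dots> \<longleftrightarrow> even (L' p + L' q)"
    proof -
      have "(L' p + L' q) + (L (\<pi> p) + L (\<pi> q)) = 2 * R" using L'R[OF pq(1)] L'R[OF pq(2)] by simp
      then have "even ((L' p + L' q) + (L (\<pi> p) + L (\<pi> q)))" by simp
      then show ?thesis by (simp only: even_add)
    qed
    finally show "in_P p = in_P q \<longleftrightarrow> even (L' p + L' q)" .
    assume opp: "in_P p \<noteq> in_P q"
    then have opp': "in_P (\<pi> q) \<noteq> in_P (\<pi> p)" using pi_opp pq by auto
    have "boundary_key p < boundary_key q \<longleftrightarrow> boundary_key (\<pi> q) < boundary_key (\<pi> p)"
      unfolding boundary_key_pi[OF pq(1)] boundary_key_pi[OF pq(2)] by simp
    also have "\<dots> \<longleftrightarrow> L (\<pi> q) < L (\<pi> p)"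
      using chain_labels_order[OF L pi_D[OF pq(2)] pi_D[OF pq(1)] opp'] .
    also have "\<dots> \<longleftrightarrow> L' p < L' q" using L'R[OF pq(1)] L'R[OF pq(2)] by linarith
    finally show "boundary_key p < boundary_key q \<longleftrightarrow> L' p < L' q" .
  qed
  then have "L p = L' p" using chain_labels_unique[OF L _ p] by blast
  then show ?thesis using L'R[OF p] by simp
qed

text \<open>The starting point changes twice: first to the direction \<open>- u\<close>, then past
  the lower points of nonpositive transversal coordinate, which begin the angular order and end the
  boundary order.\<close>

lemma boundary_labels_exist:
  assumes J: "chain_labels D in_P (\<lambda>p q. Arg2pi p < Arg2pi q) R J" and N: "even N" "N > 0" "R = N - 1 \<or> R = N"
  shows "\<exists>L k. boundary_labels (N - 1) L \<and>
           (\<forall>p\<in>D. (L p + k) mod N = J p mod N)"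
proof -
  define c where "c = - cnj u"
  have c0: "c \<noteq> 0" using u unfolding c_def by simp
  have cp: "- (cnj u * p) = c * p" for p unfolding c_def by simp
  have ang: "angle p = (if Arg2pi c + Arg2pi p < 2 * pi then Arg2pi c + Arg2pi p else Arg2pi c + Arg2pi p - 2 * pi)"
    if "p \<in> D" for p
    unfolding cp by (rule Arg2pi_times[OF c0 D_nonzero[OF that]])
  define V where "V = {p \<in> D. Arg2pi c + Arg2pi p < 2 * pi}"
  have VD: "V \<subseteq> D" unfolding V_def by blast
  have "\<exists>R' L' k. chain_labels D in_P (\<lambda>p q. angle p < angle q) R' L' \<and> (R' = N - 1 \<or> R' = N) \<and>
           (\<forall>p\<in>D. (L' p + k) mod N = J p mod N)"
  proof (rule chain_labels_rotate[OF J N VD])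
    fix p q assume "p \<in> D" "q \<in> D" "p \<in> V \<longleftrightarrow> q \<in> V"
    then show "Arg2pi p < Arg2pi q \<longleftrightarrow> angle p < angle q" using ang unfolding V_def by auto
  next
    fix p q assume "p \<in> V" "q \<in> D - V"
    then show "Arg2pi p < Arg2pi q \<and> \<not> Arg2pi q < Arg2pi p \<and> angle q < angle p \<and> \<not> angle p < angle q"
      using ang[of p] ang[of q] Arg2pi_lt_2pi[of q] Arg2pi_ge_0[of p] unfolding V_def by auto
  qed
  then obtain R1 L1 k1 where L1: "chain_labels D in_P (\<lambda>p q. angle p < angle q) R1 L1"
    "R1 = N - 1 \<or> R1 = N" "\<And>p. p \<in> D \<Longrightarrow> (L1 p + k1) mod N = J p mod N" by blast
  define W where "W = {p \<in> D. \<not> upper p \<and> transversal u p \<le> 0}"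
  have WD: "W \<subseteq> D" unfolding W_def by blast
  have "\<exists>R' L' k. boundary_labels R' L' \<and> (R' = N - 1 \<or> R' = N) \<and>
           (\<forall>p\<in>D. (L' p + k) mod N = L1 p mod N)"
  proof (rule chain_labels_rotate[OF L1(1) N(1,2) L1(2) WD])
    fix p q assume pq: "p \<in> D" "q \<in> D" "in_P p \<noteq> in_P q" "p \<in> W \<longleftrightarrow> q \<in> W"
    then show "angle p < angle q \<longleftrightarrow> boundary_key p < boundary_key q"
      unfolding angle_key_less_iff[OF pq(1-3)] unfolding angle_key_def boundary_key_def W_def
      by (auto simp del: times_complex.sel)
  next
    fix p q assume pq: "p \<in> W" "q \<in> D - W" "in_P p \<noteq> in_P q"
    have p: "p \<in> D" and q: "q \<in> D" using pq WD by auto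
    have "angle_key p < angle_key q" "boundary_key q < boundary_key p"
      using pq extent_bound[OF p] extent_bound[OF q] unfolding angle_key_def boundary_key_def W_def
      by (auto simp del: times_complex.sel split: if_splits)
    moreover from this(1) have "angle p < angle q" using angle_key_less_iff[OF p q pq(3)] by blast
    ultimately show "angle p < angle q \<and> \<not> angle q < angle p \<and> boundary_key q < boundary_key p \<and> \<not> boundary_key p < boundary_key q"
      by simp
  qed
  then obtain R2 L2 k2 where L2: "boundary_labels R2 L2"
    "R2 = N - 1 \<or> R2 = N" "\<And>p. p \<in> D \<Longrightarrow> (L2 p + k2) mod N = L1 p mod N" by blast
  obtain p where p: "p \<in> D" using nonempty unfolding D_def by blast
  \<comment> \<open>Partners have opposite colours and their labels add up to R2, so R2 is odd and
    cannot be the even number N.\<close>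
  have "odd (L2 p + L2 (\<pi> p))" using chain_labels_parity[OF L2(1) p pi_D[OF p]] pi_opp[OF p] by auto
  then have "odd R2" using boundary_labels_reflect[OF L2(1) p] by simp
  then have R2: "R2 = N - 1" using L2(2) N(1) by auto
  have "(L2 p + (k2 + k1)) mod N = J p mod N" if "p \<in> D" for p
    using L2(3)[OF that] L1(3)[OF that] by (metis add.assoc mod_add_left_eq)
  then show ?thesis using L2(1) unfolding R2 by blast
qed

end

lemma cos_centred_less:
  assumes "l < l'" "2 * l' \<le> m" "N = m + 1"
  shows "cos (pi * (2 * real l - real m) / real N) < cos (pi * (2 * real l' - real m) / real N)"
proof (rule cos_monotone_minus_pi_0)
  have N: "real N > 0" "real m < real N" using assms by simp_all
  have "- real N \<le> 2 * real l - real m" using N by simp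
  then have "(- real N) * pi \<le> (2 * real l - real m) * pi" by (intro mult_right_mono) auto
  then show "- pi \<le> pi * (2 * real l - real m) / real N" using N by (simp add: field_simps)
  show "pi * (2 * real l - real m) / real N < pi * (2 * real l' - real m) / real N"
    using N assms(1) by (intro divide_strict_right_mono mult_strict_left_mono) auto
  have "2 * real l' \<le> real m" using assms(2) by linarith
  then show "pi * (2 * real l' - real m) / real N \<le> 0" using N
    by (intro divide_nonpos_pos mult_nonneg_nonpos) auto
qed

text \<open>The double sum of \<open>(f p - f q) * (g p - g q)\<close> has nonnegative terms and a
  positive one at a and b. As the values of g add up to 0, it is \<open>2 * card D\<close> times the
  sum in question.\<close>

lemma chebyshev_sum_pos:
  fixes f g :: "'a \<Rightarrow> real"
  assumes D: "finite D" and mono: "\<And>p q. p \<in> D \<Longrightarrow> q \<in> D \<Longrightarrow> g p < g q \<Longrightarrow> f p < f q"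
    and ex: "a \<in> D" "b \<in> D" "g a < g b" and zero: "(\<Sum>p\<in>D. g p) = 0"
  shows "(\<Sum>p\<in>D. f p * g p) > 0"
proof -
  have nonneg: "0 \<le> (f p - f q) * (g p - g q)" if "p \<in> D" "q \<in> D" for p q
    using mono[OF that] mono[OF that(2,1)]
    by (cases "g p" "g q" rule: linorder_cases) (auto intro: mult_nonneg_nonneg mult_nonpos_nonpos)
  have "0 < (\<Sum>p\<in>D. \<Sum>q\<in>D. (f p - f q) * (g p - g q))"
  proof (rule sum_pos2[OF D ex(1)])
    show "0 < (\<Sum>q\<in>D. (f a - f q) * (g a - g q))"
      by (rule sum_pos2[OF D ex(2)]) (use mono[OF ex] ex nonneg in \<open>auto intro: mult_neg_neg\<close>)
    show "0 \<le> (\<Sum>q\<in>D. (f p - f q) * (g p - g q))" if "p \<in> D" for p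
      using nonneg that by (intro sum_nonneg) auto
  qed
  also have "(\<Sum>p\<in>D. \<Sum>q\<in>D. (f p - f q) * (g p - g q)) =
      (\<Sum>p\<in>D. \<Sum>q\<in>D. f p * g p) - (\<Sum>p\<in>D. \<Sum>q\<in>D. f p * g q) - (\<Sum>p\<in>D. \<Sum>q\<in>D. f q * g p) + (\<Sum>p\<in>D. \<Sum>q\<in>D. f q * g q)"
    by (simp add: algebra_simps sum.distrib sum_subtractf)
  also have "(\<Sum>p\<in>D. \<Sum>q\<in>D. f p * g q) = 0" using zero by (simp add: sum_distrib_left[symmetric])
  also have "(\<Sum>p\<in>D. \<Sum>q\<in>D. f q * g p) = 0"
    using zero by (subst sum.swap) (simp add: sum_distrib_left[symmetric])
  also have "(\<Sum>p\<in>D. \<Sum>q\<in>D. f p * g p) = real (card D) * (\<Sum>p\<in>D. f p * g p)"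
    by (simp add: sum_distrib_left)
  also have "(\<Sum>p\<in>D. \<Sum>q\<in>D. f q * g q) = real (card D) * (\<Sum>p\<in>D. f p * g p)" by simp
  finally show ?thesis by (simp add: zero_less_mult_iff)
qed

context balanced_direction
begin

lemma boundary_less_pi_iff: "p \<in> D \<Longrightarrow> boundary_key p < boundary_key (\<pi> p) \<longleftrightarrow> upper p"
  unfolding boundary_key_pi using extent_bound[of p] unfolding boundary_key_def
  by (auto simp del: times_complex.sel)

text \<open>In the last clause the transversal coordinate and the real part of the suitably rotated
  phases are similarly ordered on \<open>D\<close>, so Chebyshev's sum inequality excludes the value 0.\<close>

lemma direction_phase:
  assumes J: "chain_labels D in_P (\<lambda>p q. Arg2pi p < Arg2pi q) R J" and N: "even N" "N > 0" "R = N - 1 \<or> R = N"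
  defines "\<omega> \<equiv> \<lambda>p. primitive_root N ^ J p"
  obtains x where "x ^ N = 1" "\<And>p. p \<in> D \<Longrightarrow> \<omega> p * \<omega> (\<pi> p) = x"
    "\<And>v. v \<in> \<omega> ` D \<Longrightarrow> \<exists>c. c \<noteq> 0 \<and>
       (\<Sum>p | p \<in> D \<and> \<omega> p = v. p) - (\<Sum>p | p \<in> D \<and> \<omega> p = x * cnj v. p) = complex_of_real c * u"
    "N \<noteq> 2 \<Longrightarrow> (\<Sum>p\<in>D. \<omega> p) = 0 \<Longrightarrow> (\<Sum>p\<in>D. of_real (transversal u p) * \<omega> p) \<noteq> 0"
proof -
  obtain L k where L: "boundary_labels (N - 1) L"
    and Lk: "\<And>p. p \<in> D \<Longrightarrow> (L p + k) mod N = J p mod N"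
    using boundary_labels_exist[OF J N] by blast
  define z where "z = primitive_root N"
  have z1: "z ^ i = 1 \<longleftrightarrow> N dvd i" for i unfolding z_def by (rule primitive_root_power_eq_1_iff[OF N(2)])
  have zN: "z ^ N = 1" using z1 by simp
  have z0: "z \<noteq> 0" using zN N(2) by (auto simp: power_0_left)
  have zn: "norm z = 1" unfolding z_def by simp
  have L_refl: "L p + L (\<pi> p) = N - 1" if "p \<in> D" for p using boundary_labels_reflect[OF L that] .
  have LN: "L p < N" if "p \<in> D" for p using chain_labels_le[OF L that] N(2) by simp
  have chi: "\<omega> p = z ^ L p * z ^ k" if "p \<in> D" for p
    unfolding \<omega>_def z_def[symmetric] power_add[symmetric]
    using Lk[OF that] root_of_unity_power_mod[OF zN] by metis
  have chi_norm: "norm (\<omega> p) = 1" for p unfolding \<omega>_def by (simp add: norm_power)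
  have chi_cnj: "\<omega> p * cnj (\<omega> p) = 1" for p using chi_norm[of p] by (simp add: complex_norm_square[symmetric])
  define x where "x = z ^ (N - 1 + 2 * k)"
  have xN: "x ^ N = 1" unfolding x_def by (metis power_mult mult.commute zN power_one)
  have pair: "\<omega> p * \<omega> (\<pi> p) = x" if "p \<in> D" for p
  proof -
    have "\<omega> p * \<omega> (\<pi> p) = z ^ ((L p + L (\<pi> p)) + 2 * k)"
      unfolding chi[OF that] chi[OF pi_D[OF that]] power_add by (simp add: power2_eq_square power_mult mult.commute)
    then show ?thesis unfolding L_refl[OF that] x_def .
  qed
  have chi_pi: "\<omega> (\<pi> p) = x * cnj (\<omega> p)" if "p \<in> D" for p
  proof -
    have "x * cnj (\<omega> p) = (\<omega> p * cnj (\<omega> p)) * \<omega> (\<pi> p)" unfolding pair[OF that, symmetric] by simp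
    then show ?thesis unfolding chi_cnj by simp
  qed
  have up: "upper p \<longleftrightarrow> L p < L (\<pi> p)" if "p \<in> D" for p
    using chain_labels_order[OF L that pi_D[OF that]] pi_opp[OF that] boundary_less_pi_iff[OF that] by auto
  have same_L: "L p = L q" if "p \<in> D" "q \<in> D" "\<omega> p = \<omega> q" for p q
  proof -
    have *: "L q \<le> L p" if pq: "p \<in> D" "q \<in> D" "\<omega> p = \<omega> q" for p q
    proof (rule ccontr)
      assume "\<not> L q \<le> L p"
      then have l: "L p < L q" by simp
      have "z ^ L p = z ^ L q" using pq(3) z0 unfolding chi[OF pq(1)] chi[OF pq(2)] by simp
      also have "\<dots> = z ^ L p * z ^ (L q - L p)" using l by (simp add: power_add[symmetric])
      finally have "z ^ (L q - L p) = 1" using z0 by simp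
      then have "N dvd L q - L p" using z1 by blast
      then show False using l LN[OF pq(2)] by (auto dest: dvd_imp_le)
    qed
    show ?thesis using *[OF that] *[OF that(2,1) that(3)[symmetric]] by simp
  qed
  have diff: "p - \<pi> p = complex_of_real ((height u p - height u (\<pi> p)) / (norm u)\<^sup>2) * u" if "p \<in> D" for p
  proof -
    have "cnj u * p - cnj u * \<pi> p = of_real (height u p - height u (\<pi> p))"
      using pi_line[OF that] by (simp only: complex_eq_iff minus_complex.sel Re_complex_of_real Im_complex_of_real) simp
    moreover have "(u * cnj u) * (p - \<pi> p) = u * (cnj u * p - cnj u * \<pi> p)"
      by (simp only: right_diff_distrib mult.assoc)
    ultimately have "(u * cnj u) * (p - \<pi> p) = u * of_real (height u p - height u (\<pi> p))" by (simp only:)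
    then have *: "of_real ((norm u)\<^sup>2) * (p - \<pi> p) = u * of_real (height u p - height u (\<pi> p))"
      by (simp only: complex_norm_square)
    have gen: "d = of_real (c / n) * u" if "of_real n * d = u * of_real c" "n \<noteq> 0" for n c :: real and d :: complex
      using that by (simp add: field_simps)
    show ?thesis by (rule gen[OF *]) (use u in simp)
  qed
  \<comment> \<open>Within a run the points are all upper or all lower, so the vectors
    \<open>p - \<pi> p\<close> are multiples of u of equal sign and cannot cancel. This recovers the
    line of u from x.\<close>
  have sums: "\<exists>c. c \<noteq> 0 \<and>
       (\<Sum>p | p \<in> D \<and> \<omega> p = v. p) - (\<Sum>p | p \<in> D \<and> \<omega> p = x * cnj v. p) = complex_of_real c * u" if v: "v \<in> \<omega> ` D" for v
  proof -
    define E where "E = {p. p \<in> D \<and> \<omega> p = v}"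
    obtain p0 where p0: "p0 \<in> D" "\<omega> p0 = v" using v by blast
    have finE: "finite E" and p0E: "p0 \<in> E" using finite_D p0 unfolding E_def by auto
    have piE: "{p. p \<in> D \<and> \<omega> p = x * cnj v} = \<pi> ` E"
    proof (intro equalityI subsetI)
      fix p assume "p \<in> {p. p \<in> D \<and> \<omega> p = x * cnj v}"
      then have p: "p \<in> D" "\<omega> p = x * cnj v" by auto
      have "\<omega> (\<pi> p) = x * cnj x * v" unfolding chi_pi[OF p(1)] p(2) by simp
      also have "x * cnj x = 1" using root_of_unity_norm[OF xN N(2)] by (simp add: complex_norm_square[symmetric])
      finally have "\<pi> p \<in> E" using pi_D[OF p(1)] unfolding E_def by simp
      then show "p \<in> \<pi> ` E" using pi_pi[OF p(1)] by force
    qed (auto simp: E_def pi_D chi_pi)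
    have inj: "inj_on \<pi> E" by (rule inj_on_inverseI[of _ \<pi>]) (auto simp: E_def pi_pi)
    have "(\<Sum>p\<in>E. p) - (\<Sum>p\<in>\<pi> ` E. p) = (\<Sum>p\<in>E. p - \<pi> p)"
      unfolding sum.reindex[OF inj] by (simp add: sum_subtractf)
    also have "\<dots> = (\<Sum>p\<in>E. complex_of_real ((height u p - height u (\<pi> p)) / (norm u)\<^sup>2) * u)"
      by (rule sum.cong[OF refl], rule diff) (simp add: E_def)
    also have "\<dots> = complex_of_real (\<Sum>p\<in>E. (height u p - height u (\<pi> p)) / (norm u)\<^sup>2) * u"
      unfolding of_real_sum sum_distrib_right ..
    finally have eq: "(\<Sum>p\<in>E. p) - (\<Sum>p\<in>\<pi> ` E. p) = complex_of_real (\<Sum>p\<in>E. (height u p - height u (\<pi> p)) / (norm u)\<^sup>2) * u" .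
    have all: "upper p \<longleftrightarrow> upper p0" if "p \<in> E" for p
    proof -
      have p: "p \<in> D" "\<omega> p = \<omega> p0" using that p0 unfolding E_def by auto
      have "L p = L p0" by (rule same_L[OF p(1) p0(1) p(2)])
      moreover have "L (\<pi> p) = L (\<pi> p0)" using L_refl[OF p(1)] L_refl[OF p0(1)] \<open>L p = L p0\<close> by simp
      ultimately show ?thesis using up[OF p(1)] up[OF p0(1)] by simp
    qed
    have n2: "(norm u)\<^sup>2 > 0" using u by simp
    have ne: "height u p \<noteq> height u (\<pi> p)" if "p \<in> E" for p
      using line_separation[of p "\<pi> p" "\<pi> p"] that pi_D[of p] pi_opp[of p] mem_side[OF pi_D, of p] pi_line[of p]
      unfolding E_def by (auto simp del: times_complex.sel split: if_splits)
    have "(\<Sum>p\<in>E. (height u p - height u (\<pi> p)) / (norm u)\<^sup>2) \<noteq> 0"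
    proof (cases "upper p0")
      case True
      have "0 < (\<Sum>p\<in>E. (height u p - height u (\<pi> p)) / (norm u)\<^sup>2)"
        using finE p0E all True n2 unfolding upper_def
        by (intro sum_pos) (auto simp del: times_complex.sel)
      then show ?thesis by linarith
    next
      case False
      have "0 < (\<Sum>p\<in>E. - ((height u p - height u (\<pi> p)) / (norm u)\<^sup>2))"
      proof (rule sum_pos[OF finE])
        show "E \<noteq> {}" using p0E by blast
        fix p assume p: "p \<in> E"
        then have "height u p - height u (\<pi> p) < 0" using all[OF p] False ne[OF p] unfolding upper_def by simp
        then show "0 < - ((height u p - height u (\<pi> p)) / (norm u)\<^sup>2)" using n2 by (simp only: divide_neg_pos neg_0_less_iff_less)
      qed
      then show ?thesis unfolding sum_negf by linarith
    qed
    then show ?thesis unfolding piE E_def[symmetric] eq by blast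
  qed
  have nonzero: "(\<Sum>p\<in>D. of_real (transversal u p) * \<omega> p) \<noteq> 0" if N2: "N \<noteq> 2" and sum0: "(\<Sum>p\<in>D. \<omega> p) = 0"
  proof
    assume zero: "(\<Sum>p\<in>D. of_real (transversal u p) * \<omega> p) = 0"
    \<comment> \<open>Rotates the phases so that the reflection by \<open>\<pi>\<close> becomes
      complex conjugation; partners then have the same real part \<open>h\<close>.\<close>
    define ph where "ph = cis (- (pi * real (N - 1) / real N)) * cnj (z ^ k)"
    define h where "h = (\<lambda>l. cos (pi * (2 * real l - real (N - 1)) / real N))"
    have Hp: "Re (ph * \<omega> p) = h (L p)" if "p \<in> D" for p
    proof -
      have "norm (z ^ k) = 1" using zn by (simp add: norm_power)
      then have kk: "cnj (z ^ k) * z ^ k = 1" using complex_norm_square[of "z ^ k"] by (simp only: mult.commute of_real_1 power_one)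
      have "ph * \<omega> p = cis (- (pi * real (N - 1) / real N)) * z ^ L p * (cnj (z ^ k) * z ^ k)"
        unfolding ph_def chi[OF that] by (simp only: ac_simps)
      also have "\<dots> = cis (- (pi * real (N - 1) / real N) + real (L p) * (2 * pi / real N))"
        unfolding kk unfolding z_def Complex.DeMoivre by (simp only: cis_mult mult_1_right)
      also have "- (pi * real (N - 1) / real N) + real (L p) * (2 * pi / real N) = pi * (2 * real (L p) - real (N - 1)) / real N"
        using N(2) by (simp add: field_simps)
      finally show ?thesis unfolding h_def by simp
    qed
    have h_refl: "h (L (\<pi> p)) = h (L p)" if "p \<in> D" for p
    proof -
      have "real (L p) + real (L (\<pi> p)) = real (N - 1)" using L_refl[OF that] by (metis of_nat_add)
      then have "2 * real (L (\<pi> p)) - real (N - 1) = - (2 * real (L p) - real (N - 1))" by linarith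
      then have "pi * (2 * real (L (\<pi> p)) - real (N - 1)) / real N = - (pi * (2 * real (L p) - real (N - 1)) / real N)"
        by (simp only: mult_minus_right minus_divide_left)
      then show ?thesis unfolding h_def by (metis cos_minus)
    qed
    \<comment> \<open>The upper partner has the same \<open>h\<close> and the same transversal
      coordinate. It suffices to compare upper points: there the boundary key is that coordinate,
      and the cosine is taken on [-pi, 0], where it increases.\<close>
    define top where "top = (\<lambda>p. if upper p then p else \<pi> p)"
    have top: "top p \<in> D" "upper (top p)" "2 * L (top p) \<le> N - 1" "h (L (top p)) = h (L p)"
      "transversal u (top p) = transversal u p" if "p \<in> D" for p
    proof -
      have t: "top p \<in> D \<and> upper (top p) \<and> h (L (top p)) = h (L p) \<and> transversal u (top p) = transversal u p"
      proof (cases "upper p")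
        case True
        then have e: "top p = p" unfolding top_def by simp
        show ?thesis unfolding e using that True by blast
      next
        case False
        then have e: "top p = \<pi> p" unfolding top_def by simp
        show ?thesis unfolding e using False pi_D[OF that] upper_pi[OF that] h_refl[OF that] pi_line[OF that] by blast
      qed
      then show "top p \<in> D" "upper (top p)" "h (L (top p)) = h (L p)" "transversal u (top p) = transversal u p"
        by blast+
      show "2 * L (top p) \<le> N - 1" using up[of "top p"] t L_refl[of "top p"] by linarith
    qed
    have mono: "transversal u p < transversal u q" if pq: "p \<in> D" "q \<in> D" "h (L p) < h (L q)" for p q
    proof -
      have "L (top p) < L (top q)"
      proof (rule ccontr)
        assume "\<not> ?thesis"
        then consider "L (top p) = L (top q)" | "L (top q) < L (top p)" by linarith
        then have "h (L (top q)) \<le> h (L (top p))"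
        proof cases
          case 2
          then have "h (L (top q)) < h (L (top p))" unfolding h_def
            by (rule cos_centred_less[OF _ top(3)[OF pq(1)]]) (use N(2) in simp)
          then show ?thesis by simp
        qed simp
        then show False using pq(3) top(4)[OF pq(1)] top(4)[OF pq(2)] by simp
      qed
      then have "boundary_key (top p) < boundary_key (top q)"
        by (rule chain_labels_strict[OF L top(1)[OF pq(1)] top(1)[OF pq(2)]])
      then show ?thesis using top(2,5)[OF pq(1)] top(2,5)[OF pq(2)] unfolding boundary_key_def by (simp del: times_complex.sel)
    qed
    \<comment> \<open>With at least four runs the labels 0 and 1 both lie in the first half, so
      \<open>h\<close> is not constant.\<close>
    have N4: "N \<ge> 4" using N(1,2) N2 by presburger
    obtain p0 where p0: "p0 \<in> D" "L p0 = 0" by (rule chain_labels_obtain[OF L, of 0]) auto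
    obtain p1 where p1: "p1 \<in> D" "L p1 = 1" by (rule chain_labels_obtain[OF L, of 1]) (use N4 in auto)
    have "h 0 < h 1" unfolding h_def by (rule cos_centred_less) (use N4 in auto)
    then have lt: "h (L p0) < h (L p1)" using p0 p1 by simp
    have "(\<Sum>p\<in>D. h (L p)) = Re (ph * (\<Sum>p\<in>D. \<omega> p))"
      unfolding sum_distrib_left Re_sum by (rule sum.cong[OF refl], rule Hp[symmetric])
    then have "(\<Sum>p\<in>D. h (L p)) = 0" unfolding sum0 by simp
    then have "0 < (\<Sum>p\<in>D. transversal u p * h (L p))"
      using chebyshev_sum_pos[OF finite_D mono p0(1) p1(1) lt] by simp
    also have "\<dots> = Re (ph * (\<Sum>p\<in>D. of_real (transversal u p) * \<omega> p))"
      unfolding sum_distrib_left Re_sum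
    proof (rule sum.cong[OF refl])
      fix p assume "p \<in> D"
      have "ph * (of_real (transversal u p) * \<omega> p) = of_real (transversal u p) * (ph * \<omega> p)" by (simp only: ac_simps)
      moreover have "Re (of_real t * w) = t * Re w" for t w by simp
      ultimately show "transversal u p * h (L p) = Re (ph * (of_real (transversal u p) * \<omega> p))"
        unfolding Hp[OF \<open>p \<in> D\<close>, symmetric] by (simp only:)
    qed
    finally show False unfolding zero by simp
  qed
  show thesis using that[OF xN pair sums nonzero] .
qed

end

section \<open>Cross ratios of directions\<close>

context switching_pair
begin

text \<open>The pairing for u keeps transversal coordinates and reflects phases,
  \<open>\<omega> (\<pi> p) = x u * cnj (\<omega> p)\<close>, so the weighted sum S satisfies
  \<open>S = x u * cnj S\<close>. The coefficients \<alpha> and \<beta> serve all u at once because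
  the phases do not depend on u and the transversal coordinate is real linear in u.\<close>

theorem balanced_directions_roots_of_unity:
  assumes bal: "\<And>u. u \<in> U \<Longrightarrow> balanced u" and par: "pairwise (\<lambda>u v. \<not> parallel u v) U"
    and two: "u1 \<in> U" "u2 \<in> U" "u1 \<noteq> u2"
  shows "\<exists>N x \<alpha> \<beta>. N > 0 \<and> inj_on x U \<and> (\<forall>u\<in>U. x u ^ N = 1 \<and> \<alpha> * u + \<beta> * cnj u \<noteq> 0 \<and>
    \<alpha> * u + \<beta> * cnj u = x u * cnj (\<alpha> * u + \<beta> * cnj u))"
proof -
  have bd: "\<exists>\<pi>. balanced_direction P Q A B u \<pi>" if u: "u \<in> U" for u
  proof -
    obtain \<pi> where "\<And>p. p \<in> D \<Longrightarrow> \<pi> p \<in> D" "\<And>p. p \<in> D \<Longrightarrow> \<pi> (\<pi> p) = p"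
      "\<And>p. p \<in> D \<Longrightarrow> transversal u (\<pi> p) = transversal u p" "\<And>p. p \<in> D \<Longrightarrow> in_P (\<pi> p) \<noteq> in_P p"
      using balanced_pairing[OF bal[OF u]] by blast
    then have "balanced_direction P Q A B u \<pi>"
      using bal[OF u] by unfold_locales (auto simp: balanced_def)
    then show ?thesis by blast
  qed
  have Dne: "D \<noteq> {}" using nonempty unfolding D_def by blast
  have "\<exists>R J. chain_labels D in_P (\<lambda>p q. Arg2pi p < Arg2pi q) R J"
    using chain_labels_exists[OF finite_D Dne, of Arg2pi in_P] same_angle by blast
  then obtain R J where J: "chain_labels D in_P (\<lambda>p q. Arg2pi p < Arg2pi q) R J" by blast
  obtain p0 where p0: "p0 \<in> D" using Dne by blast
  have R0: "R > 0"
  proof (rule ccontr)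
    assume "\<not> R > 0"
    then have z: "J p = 0" if "p \<in> D" for p using chain_labels_le[OF J that] by simp
    obtain \<pi> where "balanced_direction P Q A B u1 \<pi>" using bd[OF two(1)] by blast
    then interpret balanced_direction P Q A B u1 \<pi> .
    have "in_P (\<pi> p0) = in_P p0" using chain_labels_parity[OF J pi_D[OF p0] p0] z[OF p0] z[OF pi_D[OF p0]] by simp
    then show False using pi_opp[OF p0] by blast
  qed
  \<comment> \<open>The number of runs on the circle: for even R the first and the last of the
    \<open>R + 1\<close> linear runs have the same colour and merge.\<close>
  define N where "N = (if odd R then R + 1 else R)"
  have N: "even N" "N > 0" "R = N - 1 \<or> R = N" using R0 unfolding N_def by auto
  define \<omega> where "\<omega> = (\<lambda>p. primitive_root N ^ J p)"
  have zN: "primitive_root N ^ N = 1" by (simp only: primitive_root_power_eq_1_iff[OF N(2)] dvd_refl)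
  have w_norm: "norm (\<omega> p) = 1" for p unfolding \<omega>_def by (simp add: norm_power)
  have w_cnj: "\<omega> p * cnj (\<omega> p) = 1" for p
    unfolding complex_norm_square[symmetric] w_norm by simp
  define good where "good = (\<lambda>u x. x ^ N = 1 \<and>
       (\<exists>\<pi>. balanced_direction P Q A B u \<pi> \<and> (\<forall>p\<in>D. \<omega> p * \<omega> (\<pi> p) = x)) \<and>
       (\<forall>v\<in>\<omega> ` D. \<exists>c. c \<noteq> 0 \<and>
         (\<Sum>p | p \<in> D \<and> \<omega> p = v. p) - (\<Sum>p | p \<in> D \<and> \<omega> p = x * cnj v. p) = complex_of_real c * u) \<and>
       (N \<noteq> 2 \<longrightarrow> (\<Sum>p\<in>D. \<omega> p) = 0 \<longrightarrow> (\<Sum>p\<in>D. of_real (transversal u p) * \<omega> p) \<noteq> 0))"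
  have "\<exists>x. good u x" if u: "u \<in> U" for u
  proof -
    obtain \<pi> where bd': "balanced_direction P Q A B u \<pi>" using bd[OF u] by blast
    then interpret balanced_direction P Q A B u \<pi> .
    obtain x where "x ^ N = 1" "\<And>p. p \<in> D \<Longrightarrow> \<omega> p * \<omega> (\<pi> p) = x"
      "\<And>v. v \<in> \<omega> ` D \<Longrightarrow> \<exists>c. c \<noteq> 0 \<and>
         (\<Sum>p | p \<in> D \<and> \<omega> p = v. p) - (\<Sum>p | p \<in> D \<and> \<omega> p = x * cnj v. p) = complex_of_real c * u"
      "N \<noteq> 2 \<Longrightarrow> (\<Sum>p\<in>D. \<omega> p) = 0 \<Longrightarrow> (\<Sum>p\<in>D. of_real (transversal u p) * \<omega> p) \<noteq> 0"
      unfolding \<omega>_def by (rule direction_phase[OF J N]) blast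
    then have "good u x" unfolding good_def using bd' by blast
    then show ?thesis by blast
  qed
  then obtain x where good: "\<And>u. u \<in> U \<Longrightarrow> good u (x u)" by metis
  have xN: "x u ^ N = 1" if "u \<in> U" for u using good[OF that] unfolding good_def by blast
  \<comment> \<open>For equal x the same two runs are compared, and the difference of their sums
    would be a nonzero multiple of both directions.\<close>
  have inj: "inj_on x U"
  proof (rule inj_onI, rule ccontr)
    fix u u' assume u: "u \<in> U" "u' \<in> U" "x u = x u'" "u \<noteq> u'"
    have v: "\<omega> p0 \<in> \<omega> ` D" using p0 by blast
    obtain c where c: "c \<noteq> 0" "(\<Sum>p | p \<in> D \<and> \<omega> p = \<omega> p0. p) - (\<Sum>p | p \<in> D \<and> \<omega> p = x u * cnj (\<omega> p0). p) = complex_of_real c * u"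
      using good[OF u(1)] v unfolding good_def by blast
    obtain c' where c': "c' \<noteq> 0" "(\<Sum>p | p \<in> D \<and> \<omega> p = \<omega> p0. p) - (\<Sum>p | p \<in> D \<and> \<omega> p = x u' * cnj (\<omega> p0). p) = complex_of_real c' * u'"
      using good[OF u(2)] v unfolding good_def by blast
    have "complex_of_real c * u = complex_of_real c' * u'" using c(2) c'(2) u(3) by simp
    then have "u' = complex_of_real (c / c') * u" using c'(1) by (simp add: field_simps)
    then have "parallel u u'" unfolding parallel_def using c(1) c'(1) by (intro exI[of _ "c / c'"]) simp
    then show False using par u unfolding pairwise_def by blast
  qed
  have reindex: "(\<Sum>p\<in>D. f (\<pi> p)) = (\<Sum>p\<in>D. f p)" if "balanced_direction P Q A B u \<pi>" for u \<pi> and f :: "complex \<Rightarrow> complex"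
  proof -
    from that interpret balanced_direction P Q A B u \<pi> .
    show ?thesis by (rule sum.reindex_bij_witness[of _ \<pi> \<pi>]) (auto simp: pi_D pi_pi)
  qed
  have flip: "\<omega> (\<pi> p) = x u * cnj (\<omega> p)" if "\<omega> p * \<omega> (\<pi> p) = x u" for u \<pi> p
  proof -
    have "x u * cnj (\<omega> p) = (\<omega> p * cnj (\<omega> p)) * \<omega> (\<pi> p)" unfolding that[symmetric] by (simp only: ac_simps)
    then show ?thesis unfolding w_cnj by simp
  qed
  have sum_x: "(\<Sum>p\<in>D. \<omega> p) = x u * cnj (\<Sum>p\<in>D. \<omega> p)" if u: "u \<in> U" for u
  proof -
    obtain \<pi> where \<pi>: "balanced_direction P Q A B u \<pi>" "\<And>p. p \<in> D \<Longrightarrow> \<omega> p * \<omega> (\<pi> p) = x u"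
      using good[OF u] unfolding good_def by blast
    have "(\<Sum>p\<in>D. \<omega> p) = (\<Sum>p\<in>D. \<omega> (\<pi> p))" using reindex[OF \<pi>(1), of \<omega>] by simp
    also have "\<dots> = (\<Sum>p\<in>D. x u * cnj (\<omega> p))" by (rule sum.cong[OF refl]) (rule flip[OF \<pi>(2)])
    finally show ?thesis unfolding cnj_sum sum_distrib_left .
  qed
  \<comment> \<open>The sum equals \<open>x u\<close> times its conjugate for two different values
    of \<open>x u\<close>.\<close>
  have sum0: "(\<Sum>p\<in>D. \<omega> p) = 0"
  proof -
    have "x u1 * cnj (\<Sum>p\<in>D. \<omega> p) = x u2 * cnj (\<Sum>p\<in>D. \<omega> p)"
      by (rule trans[OF sym[OF sum_x[OF two(1)]] sum_x[OF two(2)]])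
    moreover have "x u1 \<noteq> x u2" using inj two unfolding inj_on_def by blast
    ultimately have "cnj (\<Sum>p\<in>D. \<omega> p) = 0" by (simp only: mult_cancel_right) blast
    then show ?thesis by (simp only: complex_cnj_zero_iff)
  qed
  \<comment> \<open>With two runs partners have the phases 1 and -1, which would make every
    \<open>x u\<close> equal to -1.\<close>
  have N2: "N \<noteq> 2"
  proof
    assume N2: "N = 2"
    have r: "primitive_root N = -1" unfolding N2 by (simp add: complex_eq_iff)
    have "x u = -1" if u: "u \<in> U" for u
    proof -
      obtain \<pi> where \<pi>: "balanced_direction P Q A B u \<pi>" "\<And>p. p \<in> D \<Longrightarrow> \<omega> p * \<omega> (\<pi> p) = x u"
        using good[OF u] unfolding good_def by blast
      from \<pi>(1) interpret balanced_direction P Q A B u \<pi> .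
      have "odd (J p0 + J (\<pi> p0))" using chain_labels_parity[OF J p0 pi_D[OF p0]] pi_opp[OF p0] by auto
      then have "(-1 :: complex) ^ (J p0 + J (\<pi> p0)) = -1" by simp
      then show ?thesis using \<pi>(2)[OF p0] unfolding \<omega>_def r power_add by simp
    qed
    then have "x u1 = x u2" using two by simp
    then show False using inj two unfolding inj_on_def by blast
  qed
  define \<alpha> \<beta> where "\<alpha> = - (\<Sum>p\<in>D. cnj p * \<omega> p) / (2 * \<i>)" and "\<beta> = (\<Sum>p\<in>D. p * \<omega> p) / (2 * \<i>)"
  have lin: "\<alpha> * u + \<beta> * cnj u = (\<Sum>p\<in>D. of_real (transversal u p) * \<omega> p)" for u
  proof -
    have im: "complex_of_real (Im w) = (w - cnj w) / (2 * \<i>)" for w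
      by (simp add: complex_diff_cnj field_simps)
    have "(\<Sum>p\<in>D. of_real (transversal u p) * \<omega> p) = (\<Sum>p\<in>D. (cnj u * (p * \<omega> p) - u * (cnj p * \<omega> p)) / (2 * \<i>))"
      unfolding im by (rule sum.cong[OF refl]) (simp add: field_simps)
    also have "\<dots> = (cnj u * (\<Sum>p\<in>D. p * \<omega> p) - u * (\<Sum>p\<in>D. cnj p * \<omega> p)) / (2 * \<i>)"
      unfolding sum_divide_distrib[symmetric] sum_subtractf sum_distrib_left ..
    also have "\<dots> = \<alpha> * u + \<beta> * cnj u" unfolding \<alpha>_def \<beta>_def by (simp add: field_simps)
    finally show ?thesis by simp
  qed
  show ?thesis
  proof (rule exI[of _ N], rule exI[of _ x], rule exI[of _ \<alpha>], rule exI[of _ \<beta>], intro conjI ballI N(2) inj)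
    fix u assume u: "u \<in> U"
    show "x u ^ N = 1" by (rule xN[OF u])
    show "\<alpha> * u + \<beta> * cnj u \<noteq> 0" unfolding lin using good[OF u] N2 sum0 unfolding good_def by blast
    obtain \<pi> where \<pi>: "balanced_direction P Q A B u \<pi>" "\<And>p. p \<in> D \<Longrightarrow> \<omega> p * \<omega> (\<pi> p) = x u"
      using good[OF u] unfolding good_def by blast
    from \<pi>(1) interpret balanced_direction P Q A B u \<pi> .
    have "(\<Sum>p\<in>D. of_real (transversal u p) * \<omega> p) = (\<Sum>p\<in>D. of_real (transversal u (\<pi> p)) * \<omega> (\<pi> p))"
      using reindex[OF \<pi>(1), of "\<lambda>p. of_real (transversal u p) * \<omega> p"] by simp
    also have "\<dots> = (\<Sum>p\<in>D. x u * cnj (of_real (transversal u p) * \<omega> p))"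
    proof (rule sum.cong[OF refl])
      fix p assume p: "p \<in> D"
      have "cnj (of_real (transversal u p) * \<omega> p) = of_real (transversal u p) * cnj (\<omega> p)"
        by (simp only: complex_cnj_mult complex_cnj_complex_of_real)
      then show "of_real (transversal u (\<pi> p)) * \<omega> (\<pi> p) = x u * cnj (of_real (transversal u p) * \<omega> p)"
        unfolding pi_line[OF p] flip[where u = u and \<pi> = \<pi>, OF \<pi>(2)[OF p]] by (simp only: ac_simps)
    qed
    also have "\<dots> = x u * cnj (\<Sum>p\<in>D. of_real (transversal u p) * \<omega> p)"
      unfolding sum_distrib_left cnj_sum ..
    finally show "\<alpha> * u + \<beta> * cnj u = x u * cnj (\<alpha> * u + \<beta> * cnj u)" unfolding lin .
  qed
qed

end

text \<open>Up to the factor \<open>2 * \<i>\<close> this is the determinant of two vectors of the plane.\<close>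

definition bracket :: "complex \<Rightarrow> complex \<Rightarrow> complex" where
  "bracket u v = cnj u * v - u * cnj v"

lemma bracket_linear_image:
  "bracket (\<alpha> * u + \<beta> * cnj u) (\<alpha> * v + \<beta> * cnj v) = (\<alpha> * cnj \<alpha> - \<beta> * cnj \<beta>) * bracket u v"
  unfolding bracket_def by (simp add: algebra_simps)

lemma bracket_on_rays:
  assumes "y = x * cnj y" "y' = x' * cnj y'"
  shows "bracket y y' = (x' - x) * (cnj y * cnj y')"
proof -
  have "bracket y y' = cnj y * (x' * cnj y') - (x * cnj y) * cnj y'"
    unfolding bracket_def using assms by simp
  then show ?thesis by (simp add: algebra_simps)
qed

text \<open>The cross ratio of slopes in homogeneous form: each vector enters numerator and
  denominator once, so only its line matters.\<close>

definition direction_ratio :: "complex \<Rightarrow> complex \<Rightarrow> complex \<Rightarrow> complex \<Rightarrow> complex" where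
  "direction_ratio u1 u2 u3 u4 = (bracket u1 u3 * bracket u2 u4) / (bracket u1 u4 * bracket u2 u3)"

text \<open>The linear map multiplies every bracket by its determinant, and
  \<open>bracket_on_rays\<close> makes the brackets differences of the \<open>x i\<close> up to
  factors \<open>cnj (y i)\<close>. All these factors cancel. The determinant is nonzero because
  \<open>x 0\<close> and \<open>x 3\<close> differ.\<close>

lemma direction_ratio_eq_cross_ratio:
  fixes u x :: "nat \<Rightarrow> complex"
  assumes "\<And>i. i < 4 \<Longrightarrow> \<alpha> * u i + \<beta> * cnj (u i) \<noteq> 0"
    and "\<And>i. i < 4 \<Longrightarrow> \<alpha> * u i + \<beta> * cnj (u i) = x i * cnj (\<alpha> * u i + \<beta> * cnj (u i))"
    and "x 0 \<noteq> x 3" "x 1 \<noteq> x 2"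
  shows "direction_ratio (u 0) (u 1) (u 2) (u 3) = cross_ratio (x 0) (x 1) (x 2) (x 3)"
proof -
  define y where "y = (\<lambda>i::nat. \<alpha> * u i + \<beta> * cnj (u i))"
  define d where "d = \<alpha> * cnj \<alpha> - \<beta> * cnj \<beta>"
  have yb: "(x j - x i) * (cnj (y i) * cnj (y j)) = d * bracket (u i) (u j)" if "i < 4" "j < 4" for i j
    using bracket_on_rays[OF assms(2)[OF that(1)] assms(2)[OF that(2)]]
    unfolding bracket_linear_image y_def d_def by simp
  have y0: "cnj (y i) \<noteq> 0" if "i < 4" for i using assms(1)[OF that] unfolding y_def by (simp only: complex_cnj_zero_iff) simp
  have d0: "d \<noteq> 0"
    using yb[of 0 3] y0[of 0] y0[of 3] assms(3) by auto
  have "direction_ratio (u 0) (u 1) (u 2) (u 3) =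
      ((d * bracket (u 0) (u 2)) * (d * bracket (u 1) (u 3))) / ((d * bracket (u 0) (u 3)) * (d * bracket (u 1) (u 2)))"
    unfolding direction_ratio_def using d0 by simp
  also have "\<dots> = (((x 2 - x 0) * (cnj (y 0) * cnj (y 2))) * ((x 3 - x 1) * (cnj (y 1) * cnj (y 3)))) /
      (((x 3 - x 0) * (cnj (y 0) * cnj (y 3))) * ((x 2 - x 1) * (cnj (y 1) * cnj (y 2))))"
    using yb by simp
  also have "\<dots> = ((x 2 - x 0) * (x 3 - x 1)) / ((x 3 - x 0) * (x 2 - x 1))"
    using y0[of 0] y0[of 1] y0[of 2] y0[of 3] by simp
  also have "\<dots> = cross_ratio (x 0) (x 1) (x 2) (x 3)"
  proof -
    have "(x 2 - x 0) * (x 3 - x 1) = (x 0 - x 2) * (x 1 - x 3)" "(x 3 - x 0) * (x 2 - x 1) = (x 0 - x 3) * (x 1 - x 2)"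
      by (simp_all add: algebra_simps)
    then show ?thesis unfolding cross_ratio_def by simp
  qed
  finally show ?thesis .
qed

section \<open>X-rays of convex subsets\<close>

lemma finite_convex_subset:
  assumes "uniform_discrete \<Lambda>" "C \<in> convex_subsets \<Lambda>"
  shows "finite C"
proof -
  have C: "C \<subseteq> \<Lambda>" "bounded C" using assms(2) unfolding convex_subsets_def by auto
  have ud: "uniform_discrete C" using assms(1) C(1) by (rule uniform_discrete_subset)
  have "compact C" using uniform_discrete_imp_closed[OF ud] C(2) by (simp add: compact_eq_bounded_closed)
  then show ?thesis using discrete_compact_finite_iff[of C] uniform_discrete_imp_discrete[OF ud] by blast
qed

lemma transversal_line:
  assumes "norm u = 1"
  shows "{z. transversal u z = t} = {\<i> * of_real t * u + of_real s * u | s. True}"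
proof -
  have uu': "u * cnj u = 1" unfolding complex_norm_square[symmetric] assms by simp
  have uu: "cnj u * u = 1" using uu' by (simp only: mult.commute)
  show ?thesis
  proof (intro equalityI subsetI)
    fix z assume z: "z \<in> {z. transversal u z = t}"
    have "cnj u * z = of_real (height u z) + \<i> * of_real (transversal u z)"
      by (rule complex_eq)
    then have "u * (cnj u * z) = u * (of_real (height u z) + \<i> * of_real t)" using z by (simp only: mem_Collect_eq)
    then have "(u * cnj u) * z = \<i> * of_real t * u + of_real (height u z) * u"
      by (simp only: mult.assoc distrib_left) (simp only: ac_simps)
    then have "z = \<i> * of_real t * u + of_real (height u z) * u" unfolding uu' by simp
    then show "z \<in> {\<i> * of_real t * u + of_real s * u | s. True}" by blast
  next
    fix z assume "z \<in> {\<i> * of_real t * u + of_real s * u | s. True}"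
    then obtain s where z: "z = \<i> * of_real t * u + of_real s * u" by blast
    have "cnj u * z = (\<i> * of_real t + of_real s) * (cnj u * u)" unfolding z by (simp add: algebra_simps)
    then have "transversal u z = Im ((\<i> * of_real t + of_real s) * 1)" unfolding uu by (rule arg_cong)
    then show "z \<in> {z. transversal u z = t}" unfolding mem_Collect_eq by (rule trans) simp
  qed
qed

lemma xray_eq_imp_card_eq:
  assumes "norm u = 1" "xray u C = xray u C'"
  shows "card {p \<in> C. transversal u p = t} = card {p \<in> C'. transversal u p = t}"
proof -
  let ?l = "{z. transversal u z = t}"
  have l: "?l \<in> lines_in_direction u"
    unfolding transversal_line[OF assms(1)] lines_in_direction_def by blast
  have "xray u C ?l = xray u C' ?l" using assms(2) by simp
  then have "card (C \<inter> ?l) = card (C' \<inter> ?l)" using l unfolding xray_def by simp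
  then show ?thesis by (simp only: Int_def mem_Collect_eq)
qed

lemma transversal_zero_imp_parallel:
  assumes "transversal u z = 0" "u \<noteq> 0" "z \<noteq> 0"
  shows "parallel u z"
proof -
  have "cnj u * z = of_real (height u z)" using assms(1) by (simp only: complex_eq_iff Re_complex_of_real Im_complex_of_real)
  then have "u * (cnj u * z) = u * of_real (height u z)" by (rule arg_cong)
  then have "(u * cnj u) * z = of_real (height u z) * u" by (simp only: mult.assoc mult.commute[of u "of_real _"])
  then have e: "of_real ((norm u)\<^sup>2) * z = of_real (height u z) * u" by (simp only: complex_norm_square)
  have gen: "z = of_real (c / n) * u" if "of_real n * z = of_real c * u" "n \<noteq> 0" for n c :: real
    using that by (simp add: field_simps)
  have z: "z = of_real (height u z / (norm u)\<^sup>2) * u" by (rule gen[OF e]) (use assms in simp)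
  moreover have "height u z / (norm u)\<^sup>2 \<noteq> 0"
  proof
    assume "height u z / (norm u)\<^sup>2 = 0"
    then have "z = of_real 0 * u" using z by (simp only:)
    then show False using assms(3) by simp
  qed
  ultimately show ?thesis unfolding parallel_def by blast
qed

lemma parallel_sym: "parallel u v \<Longrightarrow> parallel v u"
proof -
  assume "parallel u v"
  then obtain c :: real where c: "c \<noteq> 0" "v = of_real c * u" unfolding parallel_def by blast
  have "u = of_real (1 / c) * v" using c by simp
  then show ?thesis unfolding parallel_def using c(1) by (intro exI[of _ "1 / c"]) simp
qed

lemma parallel_trans: "parallel u v \<Longrightarrow> parallel v w \<Longrightarrow> parallel u w"
proof -
  assume "parallel u v" "parallel v w"
  then obtain c d :: real where "c \<noteq> 0" "v = of_real c * u" "d \<noteq> 0" "w = of_real d * v" unfolding parallel_def by blast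
  then show ?thesis unfolding parallel_def by (intro exI[of _ "d * c"]) simp
qed

theorem undetermined_roots_of_unity:
  assumes ud: "uniform_discrete \<Lambda>" and C: "C \<in> convex_subsets \<Lambda>" "C' \<in> convex_subsets \<Lambda>" "C \<noteq> C'"
    and U: "\<And>u. u \<in> U \<Longrightarrow> norm u = 1" and par: "pairwise (\<lambda>u v. \<not> parallel u v) U"
    and two: "u1 \<in> U" "u2 \<in> U" "u1 \<noteq> u2"
    and xr: "\<And>u. u \<in> U \<Longrightarrow> xray u C = xray u C'"
  shows "\<exists>N x \<alpha> \<beta>. N > 0 \<and> inj_on x U \<and> (\<forall>u\<in>U. x u ^ N = 1 \<and> \<alpha> * u + \<beta> * cnj u \<noteq> 0 \<and>
    \<alpha> * u + \<beta> * cnj u = x u * cnj (\<alpha> * u + \<beta> * cnj u))"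
proof -
  have fin: "finite C" "finite C'" using finite_convex_subset[OF ud] C by blast+
  have card_fib: "card {p \<in> C. transversal u p = t} = card {p \<in> C'. transversal u p = t}" if "u \<in> U" for u t
    by (rule xray_eq_imp_card_eq[OF U[OF that] xr[OF that]])
  have bij: "\<exists>g. bij_betw g C C' \<and> (\<forall>p\<in>C. transversal u (g p) = transversal u p)" if "u \<in> U" for u
    by (rule fibrewise_bijection[OF fin card_fib[OF that]])
  have cardC: "card C = card C'" using bij[OF two(1)] bij_betw_same_card by blast
  \<comment> \<open>An X-ray determines the sum of the transversal coordinates, so d is parallel to
    two nonparallel directions unless it is 0. With equal cardinalities this gives a common
    centroid.\<close>
  define d where "d = (\<Sum>p\<in>C. p) - (\<Sum>p\<in>C'. p)"
  have trd: "transversal u d = 0" if u: "u \<in> U" for u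
  proof -
    obtain g where g: "bij_betw g C C'" "\<And>p. p \<in> C \<Longrightarrow> transversal u (g p) = transversal u p" using bij[OF u] by blast
    have tr_sum: "transversal u (\<Sum>p\<in>S. p) = (\<Sum>p\<in>S. transversal u p)" for S
      unfolding sum_distrib_left Im_sum ..
    have "transversal u (\<Sum>p\<in>C'. p) = (\<Sum>p\<in>C. transversal u (g p))"
      unfolding tr_sum by (rule sum.reindex_bij_betw[OF g(1), symmetric])
    also have "\<dots> = transversal u (\<Sum>p\<in>C. p)" unfolding tr_sum by (rule sum.cong[OF refl g(2)])
    finally show ?thesis unfolding d_def right_diff_distrib minus_complex.sel by (simp only: diff_self)
  qed
  have u0: "u \<noteq> 0" if "u \<in> U" for u using U[OF that] by auto
  have d0: "d = 0"
  proof (rule ccontr)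
    assume d: "d \<noteq> 0"
    have "parallel u1 d" "parallel u2 d"
      using transversal_zero_imp_parallel[OF trd u0 d] two by blast+
    then have "parallel u1 u2" using parallel_sym parallel_trans by blast
    then show False using par two unfolding pairwise_def by blast
  qed
  have Cne: "C \<noteq> {}" "C' \<noteq> {}" using cardC C(3) fin by auto
  define n where "n = real (card C)"
  have n: "n > 0" using Cne fin unfolding n_def by (simp add: card_gt_0_iff)
  define b where "b = (1 / n) *\<^sub>R (\<Sum>p\<in>C. p)"
  have b': "b = (1 / n) *\<^sub>R (\<Sum>p\<in>C'. p)" using d0 unfolding b_def d_def by simp
  have hull: "(1 / real (card S)) *\<^sub>R (\<Sum>p\<in>S. p) \<in> convex hull S" if "finite S" "S \<noteq> {}" for S :: "complex set"
  proof -
    have "(\<Sum>p\<in>S. (1 / real (card S)) *\<^sub>R p) \<in> convex hull S"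
      using that by (intro convex_sum convex_convex_hull) (auto intro: hull_inc)
    then show ?thesis by (simp only: scaleR_sum_right)
  qed
  have bC: "b \<in> convex hull C" "b \<in> convex hull C'"
    using hull[OF fin(1) Cne(1)] hull[OF fin(2) Cne(2)] b' unfolding b_def n_def cardC by auto
  let ?P = "(\<lambda>p. p - b) ` (C - C')" and ?Q = "(\<lambda>p. p - b) ` (C' - C)"
  let ?A = "(\<lambda>p. p - b) ` (convex hull C)" and ?B = "(\<lambda>p. p - b) ` (convex hull C')"
  have inj: "inj_on (\<lambda>p. p - b) S" for S by (simp add: inj_on_def)
  have sub: "p \<notin> convex hull S" if "p \<in> T - S" "T \<in> convex_subsets \<Lambda>" "S \<in> convex_subsets \<Lambda>" for p S T
    using that unfolding convex_subsets_def by blast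
  have tr_shift: "transversal u (p - b) = transversal u p - transversal u b" for u p
    unfolding right_diff_distrib minus_complex.sel ..
  interpret switching_pair ?P ?Q ?A ?B
  proof
    show "finite ?P" "finite ?Q" using fin by auto
    show "convex ?A" "convex ?B"
      using convex_translation_subtract[OF convex_convex_hull] by auto
    show "0 \<in> ?A" "0 \<in> ?B" using bC by force+
    show "?P \<subseteq> ?A - ?B" "?Q \<subseteq> ?B - ?A"
      using sub[OF _ C(1,2)] sub[OF _ C(2,1)] by (auto intro!: imageI intro: hull_inc)
    show "?P \<union> ?Q \<noteq> {}" using C(3) by auto
  qed
  have bal: "balanced u" if u: "u \<in> U" for u
    unfolding balanced_def
  proof (intro conjI allI u0[OF u])
    fix t
    have im: "card {p \<in> (\<lambda>p. p - b) ` S. transversal u p = t} = card {p \<in> S. transversal u p = t + transversal u b}" for S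
    proof -
      have "{p \<in> (\<lambda>p. p - b) ` S. transversal u p = t} = (\<lambda>p. p - b) ` {p \<in> S. transversal u p = t + transversal u b}"
        using tr_shift by (auto simp del: times_complex.sel)
      then show ?thesis using card_image[OF inj] by simp
    qed
    let ?t = "t + transversal u b"
    have split: "card {p \<in> S. transversal u p = ?t} = card {p \<in> S - T. transversal u p = ?t} + card {p \<in> S \<inter> T. transversal u p = ?t}"
      if "finite S" for S T
    proof -
      have "{p \<in> S. transversal u p = ?t} = {p \<in> S - T. transversal u p = ?t} \<union> {p \<in> S \<inter> T. transversal u p = ?t}" by blast
      then show ?thesis using that by (simp only:) (rule card_Un_disjoint, auto)
    qed
    \<comment> \<open>Points common to C and C' contribute equally to both fibres and
      cancel.\<close>
    have "card {p \<in> C - C'. transversal u p = ?t} = card {p \<in> C' - C. transversal u p = ?t}"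
      using card_fib[OF u, of ?t] split[OF fin(1), of C'] split[OF fin(2), of C] unfolding Int_commute[of C' C] by linarith
    then show "card {p \<in> ?P. transversal u p = t} = card {q \<in> ?Q. transversal u q = t}" unfolding im .
  qed
  show ?thesis
    by (rule balanced_directions_roots_of_unity[OF bal par two])
qed

section \<open>The field of a cyclotomic Delone set\<close>

lemma rat_adjoin_incl: "x \<in> S \<Longrightarrow> x \<in> rat_adjoin S"
  and rat_adjoin_Rats: "x \<in> \<rat> \<Longrightarrow> x \<in> rat_adjoin S"
  unfolding rat_adjoin_def by (auto intro: generate_field.incl)

lemma rat_adjoin_add: "x \<in> rat_adjoin S \<Longrightarrow> y \<in> rat_adjoin S \<Longrightarrow> x + y \<in> rat_adjoin S"
  using generate_field.eng_add[of x "ring_of_type_algebra" "\<rat> \<union> S" y]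
  unfolding rat_adjoin_def by (simp add: ring_of_type_algebra_def)

lemma rat_adjoin_mult: "x \<in> rat_adjoin S \<Longrightarrow> y \<in> rat_adjoin S \<Longrightarrow> x * y \<in> rat_adjoin S"
  using generate_field.eng_mult[of x "ring_of_type_algebra" "\<rat> \<union> S" y]
  unfolding rat_adjoin_def by (simp add: ring_of_type_algebra_def)

lemma type_algebra_uminus: "\<ominus>\<^bsub>ring_of_type_algebra\<^esub> x = - (x::complex)"
proof -
  interpret ring "ring_of_type_algebra :: complex ring" by (rule ring_from_type_algebra)
  show ?thesis by (rule minus_equality) (auto simp: ring_of_type_algebra_def)
qed

lemma type_algebra_inverse: "x \<noteq> 0 \<Longrightarrow> inv\<^bsub>ring_of_type_algebra\<^esub> x = inverse (x::complex)"
proof -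
  assume x: "x \<noteq> 0"
  interpret cring "ring_of_type_algebra :: complex ring" by (rule cring_from_type_algebra)
  show ?thesis by (rule comm_inv_char) (use x in \<open>auto simp: ring_of_type_algebra_def\<close>)
qed

lemma rat_adjoin_uminus: "x \<in> rat_adjoin S \<Longrightarrow> - x \<in> rat_adjoin S"
  using generate_field.a_inv[of x ring_of_type_algebra "\<rat> \<union> S"]
  unfolding rat_adjoin_def type_algebra_uminus .

lemma rat_adjoin_inverse: "x \<in> rat_adjoin S \<Longrightarrow> inverse x \<in> rat_adjoin S"
proof (cases "x = 0")
  case True
  then show ?thesis by (auto intro: rat_adjoin_Rats)
next
  case False
  assume "x \<in> rat_adjoin S"
  then show ?thesis
    using generate_field.m_inv[of x ring_of_type_algebra "\<rat> \<union> S"] False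
    unfolding rat_adjoin_def type_algebra_inverse[OF False] by (simp add: ring_of_type_algebra_def)
qed

lemma rat_adjoin_diff: "x \<in> rat_adjoin S \<Longrightarrow> y \<in> rat_adjoin S \<Longrightarrow> x - y \<in> rat_adjoin S"
  using rat_adjoin_add[OF _ rat_adjoin_uminus, of x S y] by simp

lemma rat_adjoin_divide: "x \<in> rat_adjoin S \<Longrightarrow> y \<in> rat_adjoin S \<Longrightarrow> x / y \<in> rat_adjoin S"
  using rat_adjoin_mult[OF _ rat_adjoin_inverse, of x S y] by (simp add: divide_inverse)

lemmas rat_adjoin_intros = rat_adjoin_add rat_adjoin_mult rat_adjoin_uminus rat_adjoin_diff
  rat_adjoin_inverse rat_adjoin_divide

lemma rat_adjoin_induct [consumes 1, case_names Rats incl add mult uminus inverse]: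
  assumes x: "x \<in> rat_adjoin S"
    and Rats: "\<And>x. x \<in> \<rat> \<Longrightarrow> P x" and incl: "\<And>x. x \<in> S \<Longrightarrow> P x"
    and add: "\<And>x y. P x \<Longrightarrow> P y \<Longrightarrow> P (x + y)" and mult: "\<And>x y. P x \<Longrightarrow> P y \<Longrightarrow> P (x * y)"
    and uminus: "\<And>x. P x \<Longrightarrow> P (- x)" and inverse: "\<And>x. P x \<Longrightarrow> x \<noteq> 0 \<Longrightarrow> P (inverse x)"
  shows "P x"
  using x unfolding rat_adjoin_def
proof induction
  case one
  show ?case using Rats[of 1] by (simp add: ring_of_type_algebra_def)
next
  case (incl h)
  then show ?case using Rats assms(3) by blast
next
  case (a_inv h)
  then show ?case using uminus by (simp only: type_algebra_uminus)
next
  case (m_inv h)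
  then have "h \<noteq> 0" by (simp add: ring_of_type_algebra_def)
  then show ?case unfolding type_algebra_inverse[OF \<open>h \<noteq> 0\<close>] using inverse m_inv by blast
next
  case (eng_add h1 h2)
  then show ?case using add by (simp add: ring_of_type_algebra_def)
next
  case (eng_mult h1 h2)
  then show ?case using mult by (simp add: ring_of_type_algebra_def)
qed

lemma int_poly_quotients_intro:
  "int_poly_fun f \<Longrightarrow> int_poly_fun g \<Longrightarrow> g z \<noteq> 0 \<Longrightarrow> x = f z / g z \<Longrightarrow> x \<in> int_poly_quotients z"
  unfolding int_poly_quotients_def by blast

lemma rat_adjoin_subset_int_poly_quotients:
  assumes "\<zeta> \<in> int_poly_quotients z"
  shows "rat_adjoin {\<zeta>} \<subseteq> int_poly_quotients z"
proof
  fix x assume "x \<in> rat_adjoin {\<zeta>}"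
  then show "x \<in> int_poly_quotients z"
  proof (induction rule: rat_adjoin_induct)
    case (Rats x)
    then obtain a b where "b \<noteq> 0" "x = of_int a / of_int b"
      by (metis Rats_cases' less_irrefl)
    then show ?case
      by (intro int_poly_quotients_intro[of "\<lambda>z. of_int a" "\<lambda>z. of_int b"] int_poly_intros) auto
  next
    case (incl x)
    then show ?case using assms by simp
  next
    case (add x y)
    then obtain f g f' g' where fg: "int_poly_fun f" "int_poly_fun g" "g z \<noteq> 0" "x = f z / g z"
      "int_poly_fun f'" "int_poly_fun g'" "g' z \<noteq> 0" "y = f' z / g' z" unfolding int_poly_quotients_def by blast
    show ?case
      by (rule int_poly_quotients_intro[of "\<lambda>z. f z * g' z + f' z * g z" "\<lambda>z. g z * g' z"])
        (use fg in \<open>auto intro!: int_poly_intros simp: add_frac_eq\<close>)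
  next
    case (mult x y)
    then obtain f g f' g' where fg: "int_poly_fun f" "int_poly_fun g" "g z \<noteq> 0" "x = f z / g z"
      "int_poly_fun f'" "int_poly_fun g'" "g' z \<noteq> 0" "y = f' z / g' z" unfolding int_poly_quotients_def by blast
    show ?case
      by (rule int_poly_quotients_intro[of "\<lambda>z. f z * f' z" "\<lambda>z. g z * g' z"])
        (use fg in \<open>auto intro!: int_poly_intros\<close>)
  next
    case (uminus x)
    then obtain f g where fg: "int_poly_fun f" "int_poly_fun g" "g z \<noteq> 0" "x = f z / g z"
      unfolding int_poly_quotients_def by blast
    show ?case
      by (rule int_poly_quotients_intro[of "\<lambda>z. - f z" g])
        (use fg in \<open>auto intro!: int_poly_intros\<close>)
  next
    case (inverse x)
    then obtain f g where fg: "int_poly_fun f" "int_poly_fun g" "g z \<noteq> 0" "x = f z / g z" "x \<noteq> 0"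
      unfolding int_poly_quotients_def by blast
    show ?case
      by (rule int_poly_quotients_intro[of g f]) (use fg in auto)
  qed
qed

lemma zeta_eq_primitive_root: "zeta n = primitive_root n"
  unfolding zeta_def cis_conv_exp by (rule arg_cong[of _ _ exp]) (simp add: field_simps)

lemma rat_adjoin_zeta_subset:
  assumes "n > 0"
  shows "rat_adjoin {zeta n} \<subseteq> int_poly_quotients (primitive_root (if even n then n else 2 * n))"
proof (rule rat_adjoin_subset_int_poly_quotients)
  let ?k = "if even n then 1 else 2 :: nat"
  have "primitive_root (if even n then n else 2 * n) ^ ?k = zeta n"
    unfolding zeta_eq_primitive_root Complex.DeMoivre using assms by (auto intro!: arg_cong[of _ _ cis])
  then show "zeta n \<in> int_poly_quotients (primitive_root (if even n then n else 2 * n))"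
    by (intro int_poly_quotients_intro[of "\<lambda>z. z ^ ?k" "\<lambda>z. 1"] int_poly_intros) simp_all
qed

lemma K_field_cnj: "x \<in> K_field \<Lambda> \<Longrightarrow> cnj x \<in> K_field \<Lambda>"
  unfolding K_field_def
proof (induction rule: rat_adjoin_induct)
  case (Rats x)
  then obtain a b where "x = of_int a / of_int b" by (metis Rats_cases')
  then have "cnj x = x" by simp
  then show ?case using rat_adjoin_Rats[OF Rats] by simp
next
  case (incl x)
  then have "cnj x \<in> difference_set \<Lambda> \<union> cnj ` difference_set \<Lambda>" by auto
  then show ?case by (rule rat_adjoin_incl)
qed (auto intro: rat_adjoin_intros)

lemma bracket_in_K_field:
  "v \<in> K_field \<Lambda> \<Longrightarrow> w \<in> K_field \<Lambda> \<Longrightarrow> bracket v w \<in> K_field \<Lambda>"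
  using K_field_cnj[of v \<Lambda>] K_field_cnj[of w \<Lambda>] unfolding bracket_def K_field_def
  by (intro rat_adjoin_intros)

lemma bracket_scale: "bracket (of_real a * u) (of_real b * v) = of_real (a * b) * bracket u v"
  unfolding bracket_def by (simp add: algebra_simps)

lemma direction_ratio_scale:
  assumes "a \<noteq> 0" "b \<noteq> 0" "c \<noteq> 0" "d \<noteq> 0"
  shows "direction_ratio (of_real a * u1) (of_real b * u2) (of_real c * u3) (of_real d * u4) = direction_ratio u1 u2 u3 u4"
  unfolding direction_ratio_def bracket_scale using assms by simp

section \<open>Directions and direction ratios of a cyclotomic Delone set\<close>

context
  fixes n :: nat and \<Lambda> :: "complex set"
  assumes cyc: "cyclotomic_delone_set n \<Lambda>"
begin

lemma cyclotomic_uniform_discrete: "uniform_discrete \<Lambda>"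
  using cyc unfolding cyclotomic_delone_set_def delone_set_def by blast

lemma direction_of_K_field:
  assumes "is_direction_of \<Lambda> u"
  obtains w c where "w \<in> K_field \<Lambda>" "w \<noteq> 0" "c \<noteq> 0" "w = of_real c * u"
proof -
  obtain w c where w: "w \<in> difference_set \<Lambda>" "w \<noteq> 0" "c \<noteq> 0" "w = of_real c * u"
    using assms unfolding is_direction_of_def parallel_def by blast
  have "w \<in> K_field \<Lambda>" unfolding K_field_def using w(1) by (intro rat_adjoin_incl) blast
  then show thesis using that w by blast
qed

text \<open>A homothety mapping 0 and w into \<Lambda> exhibits a positive multiple of w as a
  difference of points of \<Lambda>.\<close>

lemma is_direction_of_K_field:
  assumes w: "w \<in> K_field \<Lambda>" "w \<noteq> 0"
  shows "is_direction_of \<Lambda> (w / of_real (norm w))"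
proof -
  have "0 \<in> K_field \<Lambda>" unfolding K_field_def by (rule rat_adjoin_Rats) simp
  then have "finite {0, w} \<and> {0, w} \<subseteq> K_field \<Lambda>" using w by simp
  then obtain h where h: "homothety h" "h ` {0, w} \<subseteq> \<Lambda>"
    using cyc unfolding cyclotomic_delone_set_def by blast
  then obtain c t where c: "c > 0" "h = (\<lambda>z. of_real c * z + t)" unfolding homothety_def by blast
  have "h w - h 0 \<in> difference_set \<Lambda>" using h(2) unfolding difference_set_def by blast
  moreover have hw: "h w - h 0 = of_real (c * norm w) * (w / of_real (norm w))" using c w by simp
  moreover have cw: "c * norm w \<noteq> 0" using c w by simp
  ultimately have "\<exists>w'\<in>difference_set \<Lambda>. w' \<noteq> 0 \<and> parallel (w / of_real (norm w)) w'"
    unfolding parallel_def using w c by (intro bexI[of _ "h w - h 0"] conjI exI[of _ "c * norm w"]) auto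
  moreover have "norm (w / of_real (norm w)) = 1" using w by (simp add: norm_divide)
  ultimately show ?thesis unfolding is_direction_of_def by blast
qed

lemma nonreal_in_K_field:
  obtains \<tau> where "\<tau> \<in> K_field \<Lambda>" "Im \<tau> \<noteq> 0"
proof -
  obtain R where R: "R > 0" "\<And>z. ball z R \<inter> \<Lambda> \<noteq> {}"
    using cyc unfolding cyclotomic_delone_set_def delone_set_def relatively_dense_def by blast
  obtain v w where v: "v \<in> ball (\<i> * of_real (2 * R)) R" "v \<in> \<Lambda>" and w: "w \<in> ball 0 R" "w \<in> \<Lambda>"
    using R(2) by blast
  have "\<bar>Im (\<i> * of_real (2 * R) - v)\<bar> < R" using v(1) abs_Im_le_cmod le_less_trans unfolding mem_ball dist_norm by blast
  then have "Im v > R" by auto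
  moreover have "\<bar>Im (0 - w)\<bar> < R" using w(1) abs_Im_le_cmod le_less_trans unfolding mem_ball dist_norm by blast
  then have "Im w < R" by auto
  ultimately have "Im (v - w) \<noteq> 0" by simp
  moreover have "v - w \<in> K_field \<Lambda>" unfolding K_field_def
    by (rule rat_adjoin_incl) (use v w in \<open>auto simp: difference_set_def\<close>)
  ultimately show thesis using that by blast
qed

lemma direction_ratio_in_K_field:
  assumes "is_direction_of \<Lambda> u1" "is_direction_of \<Lambda> u2" "is_direction_of \<Lambda> u3" "is_direction_of \<Lambda> u4"
  shows "direction_ratio u1 u2 u3 u4 \<in> K_field \<Lambda>"
proof -
  obtain w1 c1 where w1: "w1 \<in> K_field \<Lambda>" "c1 \<noteq> 0" "w1 = of_real c1 * u1" using direction_of_K_field[OF assms(1)] by metis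
  obtain w2 c2 where w2: "w2 \<in> K_field \<Lambda>" "c2 \<noteq> 0" "w2 = of_real c2 * u2" using direction_of_K_field[OF assms(2)] by metis
  obtain w3 c3 where w3: "w3 \<in> K_field \<Lambda>" "c3 \<noteq> 0" "w3 = of_real c3 * u3" using direction_of_K_field[OF assms(3)] by metis
  obtain w4 c4 where w4: "w4 \<in> K_field \<Lambda>" "c4 \<noteq> 0" "w4 = of_real c4 * u4" using direction_of_K_field[OF assms(4)] by metis
  have "direction_ratio w1 w2 w3 w4 \<in> K_field \<Lambda>"
    using bracket_in_K_field[OF w1(1) w3(1)] bracket_in_K_field[OF w2(1) w4(1)] bracket_in_K_field[OF w1(1) w4(1)] bracket_in_K_field[OF w2(1) w3(1)]
    unfolding direction_ratio_def K_field_def by (intro rat_adjoin_intros)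
  moreover have "direction_ratio w1 w2 w3 w4 = direction_ratio u1 u2 u3 u4"
    unfolding w1(3) w2(3) w3(3) w4(3) by (rule direction_ratio_scale[OF w1(2) w2(2) w3(2) w4(2)])
  ultimately show ?thesis by simp
qed

end

section \<open>Affinely regular hexagons\<close>

lemma card_Int_three:
  assumes "a \<noteq> b" "a \<noteq> c" "b \<noteq> c"
  shows "card ({a, b, c} \<inter> l) = of_bool (a \<in> l) + of_bool (b \<in> l) + of_bool (c \<in> l)"
  using assms by (auto simp: Int_insert_left)

lemma line_mem_iff:
  assumes "l \<in> lines_in_direction u" "parallel u w" "b - a = of_real s * w"
  shows "a \<in> l \<longleftrightarrow> b \<in> l"
proof -
  obtain z where l: "l = {z + of_real t * u | t::real. True}" using assms(1) unfolding lines_in_direction_def by blast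
  obtain c :: real where w: "w = of_real c * u" using assms(2) unfolding parallel_def by blast
  have b: "b = a + of_real (s * c) * u" using assms(3) unfolding w by (simp add: algebra_simps)
  have "b \<in> l" if a: "a \<in> l"
  proof -
    obtain t :: real where "a = z + of_real t * u" using a unfolding l by blast
    then have "b = z + of_real (t + s * c) * u" unfolding b by (simp add: algebra_simps)
    then show ?thesis unfolding l by blast
  qed
  moreover have "a \<in> l" if bl: "b \<in> l"
  proof -
    obtain t :: real where t: "b = z + of_real t * u" using bl unfolding l by blast
    have "a = b - of_real (s * c) * u" unfolding b by simp
    then have "a = z + of_real (t - s * c) * u" unfolding t by (simp add: algebra_simps)
    then show ?thesis unfolding l by blast
  qed
  ultimately show ?thesis by blast
qed

lemma not_in_hull_if_strict_max:
  fixes f :: "complex \<Rightarrow> real"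
  assumes "linear f" "\<And>w. w \<in> S \<Longrightarrow> f w < f v"
  shows "v \<notin> convex hull S"
proof -
  have "convex (f -` {..<f v})" by (rule convex_linear_vimage[OF assms(1)]) simp
  then have "convex hull S \<subseteq> f -` {..<f v}" using assms(2) by (intro hull_minimal) auto
  then show ?thesis by auto
qed

text \<open>A convex set stays convex when an extreme point is deleted, so the deleted points do not
  return in the hull of the rest.\<close>

lemma remove_extreme_points_convex_subset:
  assumes v: "\<And>v. v \<in> E \<Longrightarrow> v extreme_point_of (convex hull S)" and "finite S"
  shows "convex hull S \<inter> \<Lambda> - E \<in> convex_subsets \<Lambda>"
proof -
  let ?C = "convex hull S \<inter> \<Lambda> - E"
  have "bounded (convex hull S)" using \<open>finite S\<close> finite_imp_bounded bounded_convex_hull by blast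
  then have bd: "bounded ?C" by (rule bounded_subset) blast
  have "convex hull ?C \<subseteq> convex hull S" by (rule hull_minimal) auto
  moreover have "v \<notin> convex hull ?C" if "v \<in> E" for v
  proof -
    have "convex (convex hull S - {v})" using v[OF that] extreme_point_of_stillconvex[OF convex_convex_hull] by blast
    then have "convex hull ?C \<subseteq> convex hull S - {v}" using that by (intro hull_minimal) auto
    then show ?thesis by blast
  qed
  ultimately have "?C = convex hull ?C \<inter> \<Lambda>" using hull_subset[of ?C convex] by blast
  then show ?thesis using bd unfolding convex_subsets_def by blast
qed

text \<open>Coordinates with respect to two edge vectors. The third edge direction is their sum, and
  every long diagonal is parallel to an edge.\<close>

definition hexagon :: "(real \<times> real) set" where
  "hexagon = {(1, 0), (1, 1), (0, 1), (-1, 0), (-1, -1), (0, -1)}"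

text \<open>Removing either one of the two alternating triples of vertices of an affinely regular
  hexagon with vertices in \<open>\<Lambda>\<close> leaves the X-rays in the three edge directions equal.\<close>

lemma hexagon_directions_not_determined:
  assumes cyc: "cyclotomic_delone_set n \<Lambda>" and e: "e1 \<in> K_field \<Lambda>" "e2 \<in> K_field \<Lambda>" "transversal e1 e2 \<noteq> 0"
    and U: "\<And>u. u \<in> U \<Longrightarrow> parallel u e1 \<or> parallel u e2 \<or> parallel u (e1 + e2)"
  shows "\<not> determined_by_xrays (convex_subsets \<Lambda>) U"
proof -
  define w where "w = (\<lambda>(x::real, y::real). of_real x * e1 + of_real y * e2)"
  have "w ` hexagon \<subseteq> K_field \<Lambda>"
  proof -
    have neg: "- e1 \<in> K_field \<Lambda>" "- e2 \<in> K_field \<Lambda>" "e1 + e2 \<in> K_field \<Lambda>" "- e1 - e2 \<in> K_field \<Lambda>" "- e2 - e1 \<in> K_field \<Lambda>"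
      using e(1,2) unfolding K_field_def by (auto intro: rat_adjoin_intros)
    show ?thesis using e(1,2) neg unfolding hexagon_def w_def by simp
  qed
  moreover have "finite (w ` hexagon)" unfolding hexagon_def by simp
  ultimately obtain h where h: "homothety h" "h ` (w ` hexagon) \<subseteq> \<Lambda>"
    using cyc unfolding cyclotomic_delone_set_def by blast
  then obtain c t where c: "c > 0" "h = (\<lambda>z. of_real c * z + t)" unfolding homothety_def by blast
  define v where "v = (\<lambda>p. of_real c * w p + t)"
  have v\<Lambda>: "v ` hexagon \<subseteq> \<Lambda>" using h(2) unfolding c(2) v_def by (simp add: image_image)
  define d where "d = transversal e1 e2"
  have d0: "d \<noteq> 0" using e(3) unfolding d_def .
  have d': "transversal e2 e1 = - d" unfolding d_def by (simp add: algebra_simps)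
  have self: "transversal z z = 0" for z by (simp add: algebra_simps)
  \<comment> \<open>The functional with values a at \<open>e1\<close> and b at \<open>e2\<close>, by
    Cramer's rule.\<close>
  define f where "f = (\<lambda>(a::real) (b::real) z. a * (- transversal e2 z / d) + b * (transversal e1 z / d))"
  have lin: "linear (f a b)" for a b
    unfolding f_def by (intro linearI) (simp_all add: algebra_simps add_divide_distrib diff_divide_distrib)
  have fv: "f a b (v (x, y)) = c * (a * x + b * y) + f a b t" for a b x y
  proof -
    have "f a b (v (x, y)) = c *\<^sub>R (x *\<^sub>R f a b e1 + y *\<^sub>R f a b e2) + f a b t"
      using linear_add[OF lin] linear_scale[OF lin] unfolding v_def w_def by (simp add: scaleR_conv_of_real[symmetric])
    moreover have "f a b e1 = a" "f a b e2 = b" unfolding f_def self d' unfolding d_def[symmetric] using d0 by simp_all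
    ultimately show ?thesis by (simp add: algebra_simps)
  qed
  \<comment> \<open>The coefficients are the gradient at p of \<open>x^2 - x * y + y^2\<close>, a
    positive definite form with value 1 at all six vertices, so p is the only vertex where the
    functional is maximal.\<close>
  have max: "f (2 * fst p - snd p) (2 * snd p - fst p) (v q) < f (2 * fst p - snd p) (2 * snd p - fst p) (v p)"
    if "p \<in> hexagon" "q \<in> hexagon" "q \<noteq> p" for p q
  proof -
    have "(2 * fst p - snd p) * fst q + (2 * snd p - fst p) * snd q < (2 * fst p - snd p) * fst p + (2 * snd p - fst p) * snd p"
      using that unfolding hexagon_def by auto
    then show ?thesis using fv[of _ _ "fst p" "snd p"] fv[of _ _ "fst q" "snd q"] c(1) by simp
  qed
  have inj: "v p \<noteq> v q" if "p \<in> hexagon" "q \<in> hexagon" "p \<noteq> q" for p q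
    using max[OF that(1,2)] that(3) by auto
  let ?S = "v ` hexagon"
  have finS: "finite ?S" unfolding hexagon_def by simp
  have ext: "v p extreme_point_of (convex hull ?S)" if p: "p \<in> hexagon" for p
  proof -
    have S: "?S = insert (v p) (v ` (hexagon - {p}))" using p by blast
    have "v p \<notin> convex hull (v ` (hexagon - {p}))"
      by (rule not_in_hull_if_strict_max[OF lin]) (use max[OF p] in auto)
    then show ?thesis unfolding S by (intro extreme_point_of_convex_hull_insert) (auto simp: hexagon_def)
  qed
  define E0 E1 where "E0 = {v (1, 0), v (0, 1), v (-1, -1)}" and "E1 = {v (1, 1), v (-1, 0), v (0, -1)}"
  have E: "E0 \<subseteq> ?S" "E1 \<subseteq> ?S" unfolding E0_def E1_def hexagon_def by auto
  have disj: "E0 \<inter> E1 = {}" unfolding E0_def E1_def using inj by (auto simp: hexagon_def)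
  define H where "H = convex hull ?S \<inter> \<Lambda>"
  have SH: "?S \<subseteq> H" using v\<Lambda> hull_subset[of ?S convex] unfolding H_def by blast
  have C: "H - E0 \<in> convex_subsets \<Lambda>" "H - E1 \<in> convex_subsets \<Lambda>"
    unfolding H_def using E ext by (intro remove_extreme_points_convex_subset finS; blast)+
  have fin: "finite (H - E0)" "finite (H - E1)"
    using finite_convex_subset[OF cyclotomic_uniform_discrete[OF cyc]] C by blast+
  have vd: "v (x', y') - v (x, y) = of_real c * (of_real (x' - x) * e1 + of_real (y' - y) * e2)" for x y x' y'
    unfolding v_def w_def by (simp add: algebra_simps)
  have card_E: "card (E0 \<inter> l) = card (E1 \<inter> l)" if u: "u \<in> U" and l: "l \<in> lines_in_direction u" for u l
  proof -
    have c0: "card (E0 \<inter> l) = of_bool (v (1, 0) \<in> l) + of_bool (v (0, 1) \<in> l) + of_bool (v (-1, -1) \<in> l)"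
      unfolding E0_def by (rule card_Int_three; rule inj) (simp_all add: hexagon_def)
    have c1: "card (E1 \<inter> l) = of_bool (v (1, 1) \<in> l) + of_bool (v (-1, 0) \<in> l) + of_bool (v (0, -1) \<in> l)"
      unfolding E1_def by (rule card_Int_three; rule inj) (simp_all add: hexagon_def)
    from U[OF u] consider "parallel u e1" | "parallel u e2" | "parallel u (e1 + e2)" by blast
    then show ?thesis
    proof cases
      case 1
      note L = line_mem_iff[OF l 1]
      have "v (1, 0) \<in> l \<longleftrightarrow> v (-1, 0) \<in> l" by (rule L[of _ _ "- 2 * c"]) (simp add: vd)
      moreover have "v (0, 1) \<in> l \<longleftrightarrow> v (1, 1) \<in> l" by (rule L[of _ _ c]) (simp add: vd)
      moreover have "v (-1, -1) \<in> l \<longleftrightarrow> v (0, -1) \<in> l" by (rule L[of _ _ c]) (simp add: vd)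
      ultimately show ?thesis unfolding c0 c1 by simp
    next
      case 2
      note L = line_mem_iff[OF l 2]
      have "v (1, 0) \<in> l \<longleftrightarrow> v (1, 1) \<in> l" by (rule L[of _ _ c]) (simp add: vd)
      moreover have "v (0, 1) \<in> l \<longleftrightarrow> v (0, -1) \<in> l" by (rule L[of _ _ "- 2 * c"]) (simp add: vd)
      moreover have "v (-1, -1) \<in> l \<longleftrightarrow> v (-1, 0) \<in> l" by (rule L[of _ _ c]) (simp add: vd)
      ultimately show ?thesis unfolding c0 c1 by simp
    next
      case 3
      note L = line_mem_iff[OF l 3]
      have "v (1, 0) \<in> l \<longleftrightarrow> v (0, -1) \<in> l" by (rule L[of _ _ "- c"]) (simp add: vd algebra_simps)
      moreover have "v (0, 1) \<in> l \<longleftrightarrow> v (-1, 0) \<in> l" by (rule L[of _ _ "- c"]) (simp add: vd algebra_simps)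
      moreover have "v (-1, -1) \<in> l \<longleftrightarrow> v (1, 1) \<in> l" by (rule L[of _ _ "2 * c"]) (simp add: vd algebra_simps)
      ultimately show ?thesis unfolding c0 c1 by simp
    qed
  qed
  have "xray u (H - E0) = xray u (H - E1)" if u: "u \<in> U" for u
    unfolding xray_def
  proof (rule restrict_ext)
    fix l assume l: "l \<in> lines_in_direction u"
    have s0: "(H - E0) \<inter> l = (H - E0 - E1) \<inter> l \<union> (E1 \<inter> l)" using E(2) SH disj by blast
    have s1: "(H - E1) \<inter> l = (H - E0 - E1) \<inter> l \<union> (E0 \<inter> l)" using E(1) SH disj by blast
    have f: "finite ((H - E0 - E1) \<inter> l)" "finite (E0 \<inter> l)" "finite (E1 \<inter> l)"
      using fin(1) unfolding E0_def E1_def by auto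
    have "card ((H - E0) \<inter> l) = card ((H - E0 - E1) \<inter> l) + card (E1 \<inter> l)"
      unfolding s0 by (rule card_Un_disjoint[OF f(1,3)]) blast
    also have "\<dots> = card ((H - E0 - E1) \<inter> l) + card (E0 \<inter> l)" using card_E[OF u l] by simp
    also have "\<dots> = card ((H - E1) \<inter> l)"
      unfolding s1 by (rule card_Un_disjoint[OF f(1,2), symmetric]) blast
    finally show "card ((H - E0) \<inter> l) = card ((H - E1) \<inter> l)" .
  qed
  moreover have "H - E0 \<noteq> H - E1"
  proof -
    have "v (1, 0) \<in> E0" unfolding E0_def by simp
    then have "v (1, 0) \<in> H - E1" "v (1, 0) \<notin> H - E0" using disj E SH by blast+
    then show ?thesis by metis
  qed
  ultimately show ?thesis using C unfolding determined_by_xrays_def by blast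
qed

section \<open>Determination by X-rays\<close>

lemma parallel_imp_bracket_zero: "parallel u v \<Longrightarrow> bracket u v = 0"
  unfolding parallel_def bracket_def by auto

lemma bracket_zero_iff_transversal: "bracket u v = 0 \<longleftrightarrow> transversal u v = 0"
proof -
  have "bracket u v = cnj u * v - cnj (cnj u * v)" unfolding bracket_def by simp
  also have "\<dots> = of_real (2 * transversal u v) * \<i>" by (rule complex_diff_cnj)
  finally show ?thesis by (simp only: mult_eq_0_iff of_real_eq_0_iff complex_i_not_zero) simp
qed

lemma nonparallel_imp_bracket_nonzero:
  "u \<noteq> 0 \<Longrightarrow> v \<noteq> 0 \<Longrightarrow> \<not> parallel u v \<Longrightarrow> bracket u v \<noteq> 0"
  using transversal_zero_imp_parallel bracket_zero_iff_transversal by blast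

lemma cyclotomic_undetermined_roots_of_unity:
  assumes cyc: "cyclotomic_delone_set n \<Lambda>" and U: "nonparallel_directions \<Lambda> U"
    and two: "u1 \<in> U" "u2 \<in> U" "u1 \<noteq> u2"
    and nd: "\<not> determined_by_xrays (convex_subsets \<Lambda>) U"
  shows "\<exists>N x. N > 0 \<and> inj_on x U \<and> (\<forall>u\<in>U. x u ^ N = 1) \<and>
    (\<forall>u1\<in>U. \<forall>u2\<in>U. \<forall>u3\<in>U. \<forall>u4\<in>U. u1 \<noteq> u4 \<longrightarrow> u2 \<noteq> u3 \<longrightarrow>
      cross_ratio (x u1) (x u2) (x u3) (x u4) = direction_ratio u1 u2 u3 u4)"
proof -
  obtain C C' where C: "C \<in> convex_subsets \<Lambda>" "C' \<in> convex_subsets \<Lambda>" "C \<noteq> C'"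
    and xr: "\<And>u. u \<in> U \<Longrightarrow> xray u C = xray u C'"
    using nd unfolding determined_by_xrays_def by blast
  have norm: "norm u = 1" if "u \<in> U" for u
    using U that unfolding nonparallel_directions_def is_direction_of_def by blast
  have par: "pairwise (\<lambda>u v. \<not> parallel u v) U" using U unfolding nonparallel_directions_def by blast
  obtain N x \<alpha> \<beta> where x: "N > 0" "inj_on x U" "\<And>u. u \<in> U \<Longrightarrow> x u ^ N = 1"
    and ab: "\<And>u. u \<in> U \<Longrightarrow> \<alpha> * u + \<beta> * cnj u \<noteq> 0"
      "\<And>u. u \<in> U \<Longrightarrow> \<alpha> * u + \<beta> * cnj u = x u * cnj (\<alpha> * u + \<beta> * cnj u)"
    using undetermined_roots_of_unity[OF cyclotomic_uniform_discrete[OF cyc] C norm par two xr] by metis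
  show ?thesis
  proof (rule exI[of _ N], rule exI[of _ x], intro conjI ballI impI x)
    fix v1 v2 v3 v4 assume v: "v1 \<in> U" "v2 \<in> U" "v3 \<in> U" "v4 \<in> U" "v1 \<noteq> v4" "v2 \<noteq> v3"
    define u where "u = (!) [v1, v2, v3, v4]"
    have ui: "u 0 = v1" "u 1 = v2" "u 2 = v3" "u 3 = v4" unfolding u_def by simp_all
    have uU: "u i \<in> U" if "i < 4" for i
    proof -
      have "i = 0 \<or> i = 1 \<or> i = 2 \<or> i = 3" using that by linarith
      then show ?thesis using ui v by (elim disjE) simp_all
    qed
    have ne: "x (u 0) \<noteq> x (u 3)" "x (u 1) \<noteq> x (u 2)"
      unfolding ui using inj_onD[OF x(2)] v by blast+
    have "direction_ratio (u 0) (u 1) (u 2) (u 3) = cross_ratio (x (u 0)) (x (u 1)) (x (u 2)) (x (u 3))"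
      by (rule direction_ratio_eq_cross_ratio[where x = "\<lambda>i. x (u i)", OF ab(1)[OF uU] ab(2)[OF uU] ne])
    then show "cross_ratio (x v1) (x v2) (x v3) (x v4) = direction_ratio v1 v2 v3 v4" unfolding ui by simp
  qed
qed

lemma four_determining_directions:
  assumes cyc: "cyclotomic_delone_set n \<Lambda>"
  shows "\<exists>U. card U = 4 \<and> nonparallel_directions \<Lambda> U \<and> determined_by_xrays (convex_subsets \<Lambda>) U"
proof -
  obtain \<tau> where \<tau>: "\<tau> \<in> K_field \<Lambda>" "Im \<tau> \<noteq> 0" using nonreal_in_K_field[OF cyc] .
  define w where "w = (\<lambda>s::real. 1 + of_real s * \<tau>)"
  have w0: "w s \<noteq> 0" for s
  proof
    assume "w s = 0"
    then have "Im (w s) = 0" "Re (w s) = 0" by simp_all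
    then show False using \<tau>(2) unfolding w_def by simp
  qed
  define d where "d = \<tau> - cnj \<tau>"
  have d0: "d \<noteq> 0" using \<tau>(2) unfolding d_def complex_diff_cnj by simp
  have br: "bracket (w s) (w s') = of_real (s' - s) * d" for s s'
    unfolding bracket_def w_def d_def by (simp add: algebra_simps)
  define v where "v = (\<lambda>s. w s / of_real (norm (w s)))"
  \<comment> \<open>Rational parameters chosen to produce the forbidden cross ratio,
    \<open>((5 - 0) * (- 3 - 3)) / ((- 3 - 0) * (5 - 3)) = 5\<close>.\<close>
  have wK: "w s \<in> K_field \<Lambda>" if "s \<in> {0, 3, 5, -3}" for s
  proof -
    have "of_real s \<in> (\<rat> :: complex set)" using that by auto
    then show ?thesis unfolding w_def using \<tau>(1) unfolding K_field_def
      by (intro rat_adjoin_intros) (auto intro: rat_adjoin_Rats)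
  qed
  have vw: "v s = of_real (1 / norm (w s)) * w s" "1 / norm (w s) \<noteq> 0" for s
    unfolding v_def using w0[of s] by simp_all
  have np: "\<not> parallel (v s) (v s')" if "s \<noteq> s'" for s s'
  proof
    assume "parallel (v s) (v s')"
    then have "bracket (v s) (v s') = 0" by (rule parallel_imp_bracket_zero)
    then show False unfolding vw(1) bracket_scale br using that d0 w0 by simp
  qed
  have vinj: "v s \<noteq> v s'" if "s \<noteq> s'" for s s'
  proof
    assume "v s = v s'"
    then have "parallel (v s) (v s')" unfolding parallel_def by (intro exI[of _ 1]) simp
    then show False using np[OF that] by blast
  qed
  define V where "V = v ` {0, 3, 5, -3}"
  have card: "card V = 4"
  proof -
    have "inj_on v {0, 3, 5, -3}" using vinj by (meson inj_onI)
    then show ?thesis by (simp only: V_def card_image) simp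
  qed
  have dirs: "nonparallel_directions \<Lambda> V"
    unfolding nonparallel_directions_def
  proof (intro conjI ballI)
    fix u assume "u \<in> V"
    then obtain s where s: "s \<in> {0, 3, 5, -3}" "u = v s" unfolding V_def by (elim imageE) blast
    show "is_direction_of \<Lambda> u" unfolding s(2) v_def by (rule is_direction_of_K_field[OF cyc wK[OF s(1)] w0])
  next
    show "pairwise (\<lambda>u v. \<not> parallel u v) V"
    proof (rule pairwiseI)
      fix a b assume ab: "a \<in> V" "b \<in> V" "a \<noteq> b"
      obtain s where s: "a = v s" using ab(1) unfolding V_def by (rule imageE)
      obtain s' where s': "b = v s'" using ab(2) unfolding V_def by (rule imageE)
      show "\<not> parallel a b" unfolding s s' by (rule np) (use ab(3) s s' in blast)
    qed
  qed
  have "determined_by_xrays (convex_subsets \<Lambda>) V"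
  proof (rule ccontr)
    assume nd: "\<not> ?thesis"
    have vU: "v 0 \<in> V" "v 3 \<in> V" "v 5 \<in> V" "v (-3) \<in> V" unfolding V_def by simp_all
    have ne: "v 0 \<noteq> v (-3)" "v 3 \<noteq> v 5" "v 0 \<noteq> v 3" by (rule vinj; simp)+
    obtain N x where x: "N > 0" "inj_on x V" "\<And>u. u \<in> V \<Longrightarrow> x u ^ N = 1"
      and cr: "\<And>u1 u2 u3 u4. u1 \<in> V \<Longrightarrow> u2 \<in> V \<Longrightarrow> u3 \<in> V \<Longrightarrow> u4 \<in> V \<Longrightarrow> u1 \<noteq> u4 \<Longrightarrow> u2 \<noteq> u3 \<Longrightarrow>
        cross_ratio (x u1) (x u2) (x u3) (x u4) = direction_ratio u1 u2 u3 u4"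
      using cyclotomic_undetermined_roots_of_unity[OF cyc dirs vU(1,2) ne(3) nd] by blast
    have "direction_ratio (v 0) (v 3) (v 5) (v (-3)) = direction_ratio (w 0) (w 3) (w 5) (w (-3))"
      unfolding vw(1) by (rule direction_ratio_scale[OF vw(2) vw(2) vw(2) vw(2)])
    also have "\<dots> = 5" unfolding direction_ratio_def br using d0 by (simp add: field_simps)
    finally have five: "cross_ratio (x (v 0)) (x (v 3)) (x (v 5)) (x (v (-3))) = 5"
      using cr[OF vU ne(1,2)] by simp
    have xne: "x (v 0) \<noteq> x (v (-3))" "x (v 3) \<noteq> x (v 5)"
      using inj_onD[OF x(2)] vU ne by blast+
    then have "(x (v 0) - x (v 5)) * (x (v 3) - x (v (-3))) = 5 * ((x (v 0) - x (v (-3))) * (x (v 3) - x (v 5)))"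
      using five unfolding cross_ratio_def by (simp add: divide_eq_eq)
    from no_cross_ratio_five[OF x(1) x(3)[OF vU(1)] x(3)[OF vU(2)] x(3)[OF vU(3)] x(3)[OF vU(4)] this]
    show False using xne by blast
  qed
  then show ?thesis using card dirs by blast
qed

text \<open>Four pairwise nonparallel directions cannot all be parallel to members of a set of at
  most two, so one of them can be added.\<close>

lemma extend_directions:
  assumes cyc: "cyclotomic_delone_set n \<Lambda>" and U: "finite U" "card U < 4" "nonparallel_directions \<Lambda> U"
  shows "\<exists>T. U \<subseteq> T \<and> card T = 3 \<and> nonparallel_directions \<Lambda> T"
  using U
proof (induction "3 - card U" arbitrary: U)
  case 0
  then have "card U = 3" by simp
  then show ?case using 0 by blast
next
  case (Suc k)
  then have c3: "card U < 3" by simp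
  obtain B where B: "card B = 4" "nonparallel_directions \<Lambda> B" using four_determining_directions[OF cyc] by blast
  have "\<exists>v\<in>B. \<forall>u\<in>U. \<not> parallel u v"
  proof (rule ccontr)
    assume "\<not> ?thesis"
    then have "\<forall>v\<in>B. \<exists>u. u \<in> U \<and> parallel u v" by blast
    then obtain g where g: "\<And>v. v \<in> B \<Longrightarrow> g v \<in> U \<and> parallel (g v) v" by metis
    have "\<not> inj_on g B"
    proof
      assume "inj_on g B"
      then have "card B \<le> card U" by (rule card_inj_on_le) (use g Suc.prems(1) in auto)
      then show False using B(1) c3 by simp
    qed
    then obtain v v' where v: "v \<in> B" "v' \<in> B" "v \<noteq> v'" "g v = g v'" unfolding inj_on_def by blast
    have "parallel v (g v)" "parallel (g v) v'" using g[OF v(1)] g[OF v(2)] v(4) parallel_sym by auto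
    then have "parallel v v'" by (rule parallel_trans)
    then show False using B(2) v unfolding nonparallel_directions_def pairwise_def by blast
  qed
  then obtain v where v: "v \<in> B" "\<And>u. u \<in> U \<Longrightarrow> \<not> parallel u v" by blast
  have "v \<notin> U"
  proof
    assume "v \<in> U"
    moreover have "parallel v v" unfolding parallel_def by (intro exI[of _ 1]) simp
    ultimately show False using v(2) by blast
  qed
  then have card: "card (insert v U) = Suc (card U)" using Suc.prems(1) by simp
  have "nonparallel_directions \<Lambda> (insert v U)"
    using Suc.prems(3) B(2) v parallel_sym unfolding nonparallel_directions_def pairwise_insert by blast
  then have "\<exists>T. insert v U \<subseteq> T \<and> card T = 3 \<and> nonparallel_directions \<Lambda> T"
    using Suc.hyps(2) Suc.prems(1) card c3 by (intro Suc.hyps(1)) auto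
  then show ?case by blast
qed

text \<open>Three pairwise nonparallel directions are the edge directions of an affinely regular
  hexagon with edge vectors in \<open>K_field \<Lambda>\<close>. A counterexample for them serves
  every subset, so smaller sets are first extended to three.\<close>

lemma fewer_directions_not_determining:
  assumes cyc: "cyclotomic_delone_set n \<Lambda>" and U: "finite U" "card U < 4" "nonparallel_directions \<Lambda> U"
  shows "\<not> determined_by_xrays (convex_subsets \<Lambda>) U"
proof -
  obtain T where T: "U \<subseteq> T" "card T = 3" "nonparallel_directions \<Lambda> T"
    using extend_directions[OF cyc U] by blast
  then obtain u1 u2 u3 where T3: "T = {u1, u2, u3}" "u1 \<noteq> u2" "u1 \<noteq> u3" "u2 \<noteq> u3"
    by (auto simp: card_3_iff)
  have np: "\<not> parallel u1 u2" "\<not> parallel u1 u3" "\<not> parallel u2 u3"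
    using T(3) T3 unfolding nonparallel_directions_def pairwise_def by blast+
  have dir: "is_direction_of \<Lambda> u1" "is_direction_of \<Lambda> u2" "is_direction_of \<Lambda> u3"
    using T(3) T3 unfolding nonparallel_directions_def by blast+
  obtain w1 c1 where w1: "w1 \<in> K_field \<Lambda>" "w1 \<noteq> 0" "c1 \<noteq> 0" "w1 = of_real c1 * u1"
    using direction_of_K_field[OF cyc dir(1)] by metis
  obtain w2 c2 where w2: "w2 \<in> K_field \<Lambda>" "w2 \<noteq> 0" "c2 \<noteq> 0" "w2 = of_real c2 * u2"
    using direction_of_K_field[OF cyc dir(2)] by metis
  obtain w3 c3 where w3: "w3 \<in> K_field \<Lambda>" "w3 \<noteq> 0" "c3 \<noteq> 0" "w3 = of_real c3 * u3"
    using direction_of_K_field[OF cyc dir(3)] by metis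
  have pw: "parallel u1 w1" "parallel u2 w2" "parallel u3 w3"
    unfolding parallel_def using w1 w2 w3 by blast+
  have npw: "\<not> parallel w1 w2" "\<not> parallel w1 w3" "\<not> parallel w3 w2"
    using np pw parallel_sym parallel_trans by meson+
  have b: "bracket w1 w2 \<noteq> 0" "bracket w1 w3 \<noteq> 0" "bracket w3 w2 \<noteq> 0"
    using nonparallel_imp_bracket_nonzero npw w1(2) w2(2) w3(2) by blast+
  \<comment> \<open>Cramer's rule: with these coefficients \<open>e1 + e2 = w3\<close> for the
    rescaled vectors.\<close>
  define a1 a2 where "a1 = bracket w3 w2 / bracket w1 w2" and "a2 = bracket w1 w3 / bracket w1 w2"
  have aK: "a1 \<in> K_field \<Lambda>" "a2 \<in> K_field \<Lambda>"
    using bracket_in_K_field[OF w3(1) w2(1)] bracket_in_K_field[OF w1(1) w2(1)] bracket_in_K_field[OF w1(1) w3(1)]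
    unfolding a1_def a2_def K_field_def by (auto intro: rat_adjoin_divide)
  \<comment> \<open>Brackets are purely imaginary, so their quotients are real and the rescaling
    keeps directions.\<close>
  have cnj_b: "cnj (bracket v w) = - bracket v w" for v w unfolding bracket_def by simp
  have real: "a1 \<in> \<real>" "a2 \<in> \<real>" unfolding a1_def a2_def Reals_cnj_iff complex_cnj_divide cnj_b by simp_all
  obtain r1 where r1: "a1 = of_real r1" using real(1) by (auto elim: Reals_cases)
  obtain r2 where r2: "a2 = of_real r2" using real(2) by (auto elim: Reals_cases)
  have r0: "r1 \<noteq> 0" "r2 \<noteq> 0" using b r1 r2 unfolding a1_def a2_def by auto
  define e1 e2 where "e1 = a1 * w1" and "e2 = a2 * w2"
  have "bracket w1 w2 * w3 = bracket w3 w2 * w1 + bracket w1 w3 * w2"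
    unfolding bracket_def by (simp add: algebra_simps)
  then have e12: "e1 + e2 = w3" unfolding e1_def e2_def a1_def a2_def using b(1) by (simp add: field_simps)
  have eK: "e1 \<in> K_field \<Lambda>" "e2 \<in> K_field \<Lambda>"
    using aK w1(1) w2(1) unfolding e1_def e2_def K_field_def by (auto intro: rat_adjoin_mult)
  have pe: "parallel u1 e1" "parallel u2 e2"
    using parallel_trans[OF pw(1), of e1] parallel_trans[OF pw(2), of e2] r0
    unfolding e1_def e2_def r1 r2 by (auto simp: parallel_def)
  have tr: "transversal e1 e2 \<noteq> 0"
    unfolding bracket_zero_iff_transversal[symmetric] e1_def e2_def r1 r2 bracket_scale using r0 b(1) by simp
  show ?thesis
  proof (rule hexagon_directions_not_determined[OF cyc eK tr])
    fix u assume "u \<in> U"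
    then have "u = u1 \<or> u = u2 \<or> u = u3" using T(1) T3(1) by blast
    then show "parallel u e1 \<or> parallel u e2 \<or> parallel u (e1 + e2)" unfolding e12 using pe pw(3) by blast
  qed
qed

text \<open>For odd \<open>n\<close> the \<open>n\<close>-th and \<open>2 * n\<close>-th cyclotomic fields agree.\<close>

definition even_conductor :: "nat \<Rightarrow> nat" where
  "even_conductor n = (if even n then n else 2 * n)"

lemma many_directions_determining:
  assumes n: "n \<ge> 3" and cyc: "cyclotomic_delone_set n \<Lambda>" and U: "card U > max 6 (even_conductor n)"
    "nonparallel_directions \<Lambda> U"
  shows "determined_by_xrays (convex_subsets \<Lambda>) U"
proof (rule ccontr)
  assume nd: "\<not> ?thesis"
  have "card U \<ge> 3" using U(1) by simp
  then obtain u1 u2 where two: "u1 \<in> U" "u2 \<in> U" "u1 \<noteq> u2" by (rule obtain_three)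
  obtain N x where x: "N > 0" "inj_on x U" "\<And>u. u \<in> U \<Longrightarrow> x u ^ N = 1"
    and cr: "\<And>u1 u2 u3 u4. u1 \<in> U \<Longrightarrow> u2 \<in> U \<Longrightarrow> u3 \<in> U \<Longrightarrow> u4 \<in> U \<Longrightarrow> u1 \<noteq> u4 \<Longrightarrow> u2 \<noteq> u3 \<Longrightarrow>
      cross_ratio (x u1) (x u2) (x u3) (x u4) = direction_ratio u1 u2 u3 u4"
    using cyclotomic_undetermined_roots_of_unity[OF cyc U(2) two nd] by blast
  have K: "K_field \<Lambda> \<subseteq> int_poly_quotients (primitive_root (even_conductor n))"
    using cyc rat_adjoin_zeta_subset[of n] n unfolding cyclotomic_delone_set_def even_conductor_def by fastforce
  have dir: "is_direction_of \<Lambda> u" if "u \<in> U" for u using U(2) that unfolding nonparallel_directions_def by blast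
  have "card (x ` U) \<le> max 6 (even_conductor n)"
  proof (rule card_cross_ratio_set[OF _ _ x(1)])
    show "even (even_conductor n)" "even_conductor n > 0" using n unfolding even_conductor_def by auto
    show "y ^ N = 1" if "y \<in> x ` U" for y using that x(3) by blast
    fix x1 x2 x3 x4 assume xs: "x1 \<in> x ` U" "x2 \<in> x ` U" "x3 \<in> x ` U" "x4 \<in> x ` U" "distinct [x1, x2, x3, x4]"
    obtain v1 v2 v3 v4 where v: "v1 \<in> U" "v2 \<in> U" "v3 \<in> U" "v4 \<in> U"
      "x1 = x v1" "x2 = x v2" "x3 = x v3" "x4 = x v4" using xs(1-4) by blast
    have "v1 \<noteq> v4" "v2 \<noteq> v3" using xs(5) v(5-8) by auto
    then have "cross_ratio x1 x2 x3 x4 = direction_ratio v1 v2 v3 v4" unfolding v(5-8) using cr v(1-4) by blast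
    moreover have "direction_ratio v1 v2 v3 v4 \<in> K_field \<Lambda>"
      using v(1-4) by (intro direction_ratio_in_K_field[OF cyc] dir)
    ultimately show "cross_ratio x1 x2 x3 x4 \<in> int_poly_quotients (primitive_root (even_conductor n))"
      using K by auto
  qed
  then show False using card_image[OF x(2)] U(1) by simp
qed

theorem theorem5p11:
  shows "(\<forall>n\<ge>3. \<forall>\<Lambda>. cyclotomic_delone_set n \<Lambda> \<longrightarrow>
            (\<exists>U. card U = 4 \<and> nonparallel_directions \<Lambda> U \<and>
                 determined_by_xrays (convex_subsets \<Lambda>) U) \<and>
            (\<forall>U. finite U \<and> card U < 4 \<and> nonparallel_directions \<Lambda> U \<longrightarrow>
                 \<not> determined_by_xrays (convex_subsets \<Lambda>) U)) \<and>
         (\<exists>c :: nat \<Rightarrow> nat.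
            (\<forall>n\<ge>3. c n > 0 \<and>
               (\<forall>\<Lambda> U. cyclotomic_delone_set n \<Lambda> \<and> card U = c n \<and> nonparallel_directions \<Lambda> U \<longrightarrow>
                 determined_by_xrays (convex_subsets \<Lambda>) U)) \<and>
            c 3 = 7 \<and> c 4 = 7 \<and> c 5 = 11 \<and> c 8 = 9 \<and> c 12 = 13)"
proof (rule conjI)
  show "\<forall>n\<ge>3. \<forall>\<Lambda>. cyclotomic_delone_set n \<Lambda> \<longrightarrow>
            (\<exists>U. card U = 4 \<and> nonparallel_directions \<Lambda> U \<and>
                 determined_by_xrays (convex_subsets \<Lambda>) U) \<and>
            (\<forall>U. finite U \<and> card U < 4 \<and> nonparallel_directions \<Lambda> U \<longrightarrow>
                 \<not> determined_by_xrays (convex_subsets \<Lambda>) U)"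
    using four_determining_directions fewer_directions_not_determining by blast
  \<comment> \<open>One more than the bound of \<open>card_cross_ratio_set\<close>. Here
    \<open>even_conductor n\<close> is the number of roots of unity in the n-th cyclotomic
    field.\<close>
  let ?c = "\<lambda>n. max 6 (even_conductor n) + 1"
  have "determined_by_xrays (convex_subsets \<Lambda>) U"
    if "n \<ge> 3" "cyclotomic_delone_set n \<Lambda>" "card U = ?c n" "nonparallel_directions \<Lambda> U" for n \<Lambda> U
    by (rule many_directions_determining[OF that(1,2) _ that(4)]) (use that(3) in simp)
  then show "\<exists>c :: nat \<Rightarrow> nat.
            (\<forall>n\<ge>3. c n > 0 \<and>
               (\<forall>\<Lambda> U. cyclotomic_delone_set n \<Lambda> \<and> card U = c n \<and> nonparallel_directions \<Lambda> U \<longrightarrow>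
                 determined_by_xrays (convex_subsets \<Lambda>) U)) \<and>
            c 3 = 7 \<and> c 4 = 7 \<and> c 5 = 11 \<and> c 8 = 9 \<and> c 12 = 13"
    by (intro exI[of _ ?c]) (simp add: even_conductor_def)
qed

end
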